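(* Let $T$ be an order-preserving and positively sub-homogeneous self-map of the interior of a symmetric cone $C$ in a finite-dimensional vector space. Let $x\in\operatorname{int}C$ and assume that $$\rho(T):=\lim_{k\to\infty}\frac{\operatorname{RFunk}(x,T^k(x))}{k}>0.$$ Then $$\inf_{y\in\operatorname{int}C}\ \max_{w\in\operatorname{Extr}C}\log\frac{\langle w,T(y)\rangle}{\langle w,y\rangle}=\rho(T)=\max_{u\in C\setminus\{0\}}\ \min_{w\in\operatorname{Extr}C,\ \langle w,u\rangle\neq0}\log\frac{\langle w,\hat T_r(u)\rangle}{\langle w,u\rangle}.$$ Moreover, when $T$ is positively homogeneous, the same conclusion remains valid even when the condition $\rho(T)>0$ does not hold.
   Context: A symmetric cone is a closed, convex, pointed cone $C$ with non-empty interior in a finite-dimensional Euclidean space with scalar product $\langle\cdot,\cdot\rangle$, which is self-dual ($C=C^\star=\{z\mid\langle z,y\rangle\geq0\ \forall y\in C\}$) and such that the group of linear automorphisms of the space leaving $\operatorname{int}C$ invariant acts transitively on $\operatorname{int}C$. The partial order is $x\leq y$ iff $y-x\in C$. $\operatorname{Extr}C$ denotes the set of non-zero vectors belonging to the extreme rays of $C$. $T:\operatorname{int}C\to\operatorname{int}C$ is order-preserving if $x\leq y$ implies $T(x)\leq T(y)$; (positively) sub-homogeneous if $T(\lambda x)\leq\lambda T(x)$ for all $x\in\operatorname{int}C$ and $\lambda\geq1$; positively homogeneous if $T(\lambda x)=\lambda T(x)$ for all $\lambda>0$. For $x,y\in\operatorname{int}C$, $\operatorname{RFunk}(x,y):=\log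 M(y/x)$, where $M(y/x):=\inf\{\lambda>0\mid\lambda x\geq y\}$. (When $T$ is positively homogeneous, it is non-expansive for $\operatorname{RFunk}$, and the limit defining $\rho(T)$ always exists and is independent of $x$.) The radial extension $\hat T:C\to C$ of $T$ is $\hat T(x):=\lim_{\epsilon\to0^+}T(x+\epsilon z)$, where $z$ is any point of $\operatorname{int}C$ (the result does not depend on $z$). The recession map is $\hat T_r:C\to C$, $\hat T_r(x)=\lim_{\gamma\to\infty}\gamma^{-1}\hat T(\gamma x)=\inf_{\gamma>0}\gamma^{-1}\hat T(\gamma x)$ (infimum for the order of $C$); $\hat T_r=\hat T$ if $T$ is positively homogeneous. The convention $\log0=-\infty$ is used. *)

theory Defs
  imports "HOL-Analysis.Analysis"
begin

definition symmetric_cone :: "'a::euclidean_space set \<Rightarrow> bool" where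
  "symmetric_cone C \<longleftrightarrow>
     closed C \<and> convex C \<and> cone C \<and> C \<inter> uminus ` C = {0} \<and> interior C \<noteq> {} \<and>
     C = {z. \<forall>y\<in>C. 0 \<le> z \<bullet> y} \<and>
     (\<forall>x\<in>interior C. \<forall>y\<in>interior C.
        \<exists>g. linear g \<and> bij g \<and> g ` interior C = interior C \<and> g x = y)"

definition cone_le :: "'a::real_vector set \<Rightarrow> 'a \<Rightarrow> 'a \<Rightarrow> bool" where
  "cone_le C x y \<longleftrightarrow> y - x \<in> C"

definition Extr :: "'a::real_vector set \<Rightarrow> 'a set" where
  "Extr C = {w. w \<noteq> 0 \<and> (cone hull {w}) face_of C}"

definition order_preserving :: "'a::euclidean_space set \<Rightarrow> ('a \<Rightarrow> 'a) \<Rightarrow> bool" where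
  "order_preserving C T \<longleftrightarrow>
     (\<forall>x\<in>interior C. \<forall>y\<in>interior C. cone_le C x y \<longrightarrow> cone_le C (T x) (T y))"

definition sub_homogeneous :: "'a::euclidean_space set \<Rightarrow> ('a \<Rightarrow> 'a) \<Rightarrow> bool" where
  "sub_homogeneous C T \<longleftrightarrow>
     (\<forall>x\<in>interior C. \<forall>\<mu>\<ge>1. cone_le C (T (\<mu> *\<^sub>R x)) (\<mu> *\<^sub>R T x))"

definition pos_homogeneous :: "'a::euclidean_space set \<Rightarrow> ('a \<Rightarrow> 'a) \<Rightarrow> bool" where
  "pos_homogeneous C T \<longleftrightarrow>
     (\<forall>x\<in>interior C. \<forall>\<mu>>0. T (\<mu> *\<^sub>R x) = \<mu> *\<^sub>R T x)"

text \<open>\<open>funk_M C x y\<close> is the quantity usually written \<open>M(y/x)\<close>. For \<open>x\<close> and \<open>y\<close> in the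
  interior of a symmetric cone the set below is non-empty and its infimum is positive.\<close>

definition funk_M :: "'a::real_vector set \<Rightarrow> 'a \<Rightarrow> 'a \<Rightarrow> real" where
  "funk_M C x y = Inf {\<mu>. 0 < \<mu> \<and> cone_le C y (\<mu> *\<^sub>R x)}"

definition RFunk :: "'a::real_vector set \<Rightarrow> 'a \<Rightarrow> 'a \<Rightarrow> real" where
  "RFunk C x y = ln (funk_M C x y)"

definition escape_seq :: "'a::real_vector set \<Rightarrow> ('a \<Rightarrow> 'a) \<Rightarrow> 'a \<Rightarrow> nat \<Rightarrow> real" where
  "escape_seq C T x k = RFunk C x ((T ^^ k) x) / real k"

text \<open>Only meaningful when \<open>escape_seq C T x\<close> converges.\<close>

definition escape_rate :: "'a::real_vector set \<Rightarrow> ('a \<Rightarrow> 'a) \<Rightarrow> 'a \<Rightarrow> real" where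
  "escape_rate C T x = lim (escape_seq C T x)"

text \<open>The description requires the limit to exist along every interior direction, with a
  common value.\<close>

definition radial_ext :: "'a::euclidean_space set \<Rightarrow> ('a \<Rightarrow> 'a) \<Rightarrow> 'a \<Rightarrow> 'a" where
  "radial_ext C T x =
     (THE l. \<forall>z\<in>interior C. ((\<lambda>\<epsilon>. T (x + \<epsilon> *\<^sub>R z)) \<longlongrightarrow> l) (at_right 0))"

definition recession_map :: "'a::euclidean_space set \<Rightarrow> ('a \<Rightarrow> 'a) \<Rightarrow> 'a \<Rightarrow> 'a" where
  "recession_map C T x = Lim at_top (\<lambda>\<gamma>. inverse \<gamma> *\<^sub>R radial_ext C T (\<gamma> *\<^sub>R x))"

text \<open>The logarithm of a non-negative real, with \<open>log 0 = -\<infinity>\<close>.\<close>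

definition elog :: "real \<Rightarrow> ereal" where
  "elog t = (if t \<le> 0 then -\<infinity> else ereal (ln t))"

definition log_ratio :: "'a::real_inner \<Rightarrow> 'a \<Rightarrow> 'a \<Rightarrow> ereal" where
  "log_ratio w a b = elog ((w \<bullet> a) / (w \<bullet> b))"

definition is_max :: "'b::order set \<Rightarrow> 'b \<Rightarrow> bool" where
  "is_max S m \<longleftrightarrow> m \<in> S \<and> (\<forall>s\<in>S. s \<le> m)"

definition is_min :: "'b::order set \<Rightarrow> 'b \<Rightarrow> bool" where
  "is_min S m \<longleftrightarrow> m \<in> S \<and> (\<forall>s\<in>S. m \<le> s)"

end

theory Submission
  imports Defs
begin

text \<open>
  Write \<open>x \<preceq> y\<close> for \<open>y - x \<in> C\<close>, \<open>R\<close> for the recession map of \<open>T\<close> and \<open>\<rho>\<close> for the escape rate.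
  A linear functional on a compact base of \<open>C\<close> attains its extrema at extreme points, and these
  span extreme rays. By self-duality, the maximum over \<open>Extr C\<close> in the first formula is therefore
  \<open>ln l\<close> for the least \<open>l\<close> with \<open>T y \<preceq> l y\<close>, and the minimum in the second formula, provided that
  it is attained, is \<open>ln l\<close> for the greatest \<open>l\<close> with \<open>l u \<preceq> R u\<close>. So the theorem is about these
  two kinds of inequalities.

  Both of them survive iteration. From \<open>T y \<preceq> l y\<close> one gets \<open>T\<^sup>k x \<preceq> c l\<^sup>k x\<close> if \<open>l \<ge> 1\<close> or \<open>T\<close> is
  homogeneous (and \<open>l \<ge> 1\<close> is forced when \<open>\<rho> > 0\<close>); from \<open>l u \<preceq> R u\<close> one gets
  \<open>c l\<^sup>k u \<preceq> T\<^sup>k x\<close>, with a constant \<open>c > 0\<close>. Hence \<open>\<rho>\<close> lies between the two optimal values.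
  To see that they agree, fix \<open>e\<close> in the interior and solve \<open>T (n y) + e = l n y\<close> with \<open>y\<close>
  in the base \<open>\<langle>y, e\<rangle> = 1\<close> by Brouwer's theorem (\<open>perturbed_eigenvector\<close>). The solutions \<open>y\<^sub>n\<close>, \<open>l\<^sub>n\<close>
  satisfy \<open>T (n y\<^sub>n) \<preceq> l\<^sub>n n y\<^sub>n\<close>, and along a subsequence \<open>y\<^sub>n \<rightarrow> u\<close>, \<open>l\<^sub>n \<rightarrow> L\<close> with
  \<open>L u \<preceq> R u\<close> (\<open>recession_subeigenvector\<close>). One limit \<open>L\<close> thus serves both sides, so \<open>\<rho> = ln L\<close>,
  the infimum is \<open>\<rho>\<close>, and the maximum is attained at \<open>u\<close> (\<open>escape_rate_eq\<close>).

  The symmetry of the cone is what makes the minimum over \<open>Extr C\<close> exist: the rays with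
  \<open>\<langle>w, u\<rangle> \<noteq> 0\<close> do not form a compact set. With \<open>l\<close> greatest such that \<open>z = R u - l u\<close> is in \<open>C\<close>, one
  needs a ray orthogonal to \<open>z\<close> but not to \<open>u\<close>. If there were none, facial exposedness of \<open>C\<close>
  (\<open>facially_exposed\<close>) would give \<open>z - \<epsilon> u \<in> C\<close> for some \<open>\<epsilon> > 0\<close>, contradicting the choice of \<open>l\<close>.

  Facial exposedness comes from automorphisms of the form \<open>g = k\<^sup>* k\<close>, where \<open>k\<close> is an automorphism
  of \<open>C\<close>: they are symmetric, positive definite and again automorphisms, and some such \<open>g\<close> maps any
  given interior point to any other (\<open>scaling_point\<close>). Applied to \<open>z\<^sub>0 + w\<^sub>0 \<mapsto> z\<^sub>0 + w\<^sub>0 / 2\<close> for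
  orthogonal \<open>z\<^sub>0, w\<^sub>0 \<in> C\<close>, positive definiteness forces \<open>g z\<^sub>0 = z\<^sub>0\<close> and \<open>g w\<^sub>0 = w\<^sub>0 / 2\<close>; the
  powers of \<open>g\<close> then contract \<open>w\<^sub>0\<close>, while every element of \<open>C\<close> below \<open>z\<^sub>0\<close> stays fixed.

  The scaling point is found by calculus with Koecher's characteristic function
  \<open>\<phi>(x) = \<integral>\<^sub>C exp (- \<langle>x, y\<rangle>) dy\<close> and the map \<open>x\<^sup># = - \<nabla> ln \<phi>(x)\<close>. Automorphisms multiply \<open>\<phi>\<close> by
  constants, hence \<open>(g x)\<^sup># = (g\<^sup>*)\<^sup>-\<^sup>1 x\<^sup>#\<close>. The map has a fixed point \<open>e\<close>, so by transitivity it is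
  an involution, so its derivative at \<open>e\<close> squares to the identity; as that derivative is negative
  semidefinite, it is \<open>- 1\<close>. By equivariance the derivative at \<open>g e\<close> is \<open>- (g g\<^sup>*)\<^sup>-\<^sup>1\<close>, and the
  critical point of \<open>x \<mapsto> \<langle>f, x\<^sup>#\<rangle> + \<langle>y, x\<rangle>\<close> provides \<open>k = g\<^sup>-\<^sup>1\<close> with \<open>k\<^sup>* k f = y\<close>.
\<close>


section \<open>Self-dual cones and their order\<close>

locale self_dual_cone =
  fixes C :: "'a::euclidean_space set"
  assumes dual: "C = {z. \<forall>y\<in>C. 0 \<le> z \<bullet> y}"
    and interior_nonempty: "interior C \<noteq> {}"
begin

abbreviation cle (infix "\<preceq>" 50) where "x \<preceq> y \<equiv> cone_le C x y"

lemma mem_iff: "z \<in> C \<longleftrightarrow> (\<forall>y\<in>C. 0 \<le> z \<bullet> y)"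
  using eqset_imp_iff[OF dual, of z] by (simp only: mem_Collect_eq)

lemma inner_nonneg: "x \<in> C \<Longrightarrow> y \<in> C \<Longrightarrow> 0 \<le> x \<bullet> y"
  using mem_iff[of x] by simp

lemma zero_mem: "0 \<in> C"
  by (subst mem_iff) simp

lemma add_mem: "x \<in> C \<Longrightarrow> y \<in> C \<Longrightarrow> x + y \<in> C"
  by (subst mem_iff) (simp add: inner_add_left inner_nonneg)

lemma scale_mem: "x \<in> C \<Longrightarrow> 0 \<le> c \<Longrightarrow> c *\<^sub>R x \<in> C"
  by (subst mem_iff) (simp add: inner_nonneg)

lemma pointed: "x \<in> C \<Longrightarrow> - x \<in> C \<Longrightarrow> x = 0"
  using inner_nonneg[of x "- x"] inner_gt_zero_iff[of x] by fastforce

lemma closed_cone: "closed C"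
proof -
  have "closed (\<Inter>y\<in>C. {z. 0 \<le> y \<bullet> z})"
    by (intro closed_INT ballI closed_halfspace_ge)
  also have "(\<Inter>y\<in>C. {z. 0 \<le> y \<bullet> z}) = {z. \<forall>y\<in>C. 0 \<le> z \<bullet> y}"
    by (auto simp only: inner_commute INT_iff mem_Collect_eq)
  also have "\<dots> = C" by (rule dual [symmetric])
  finally show ?thesis .
qed

lemma convex_cone: "convex C"
  by (auto simp: convex_def intro!: add_mem scale_mem)

lemma cle_iff_inner: "x \<preceq> y \<longleftrightarrow> (\<forall>w\<in>C. w \<bullet> x \<le> w \<bullet> y)"
  by (simp add: cone_le_def mem_iff[of "y - x"] inner_commute[of "y - x"] inner_diff_right)

lemma cle_refl: "x \<preceq> x"
  by (simp add: cle_iff_inner)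

lemma cle_trans [trans]: "x \<preceq> y \<Longrightarrow> y \<preceq> z \<Longrightarrow> x \<preceq> z"
  by (force simp: cle_iff_inner)

lemma cle_antisym: "x \<preceq> y \<Longrightarrow> y \<preceq> x \<Longrightarrow> x = y"
  using pointed[of "y - x"] by (simp add: cone_le_def)

lemma cle_add_mono: "x \<preceq> y \<Longrightarrow> x' \<preceq> y' \<Longrightarrow> x + x' \<preceq> y + y'"
  by (simp add: cle_iff_inner inner_add_right add_mono)

lemma cle_scale: "x \<preceq> y \<Longrightarrow> 0 \<le> c \<Longrightarrow> c *\<^sub>R x \<preceq> c *\<^sub>R y"
  by (simp add: cle_iff_inner mult_left_mono)

lemma cle_scale_right: "x \<in> C \<Longrightarrow> a \<le> b \<Longrightarrow> a *\<^sub>R x \<preceq> b *\<^sub>R x"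
  by (simp add: cone_le_def scaleR_left_diff_distrib [symmetric] scale_mem)

lemma cle_zero_iff: "0 \<preceq> x \<longleftrightarrow> x \<in> C"
  by (simp add: cone_le_def)

lemma cle_add_right: "y \<in> C \<Longrightarrow> x \<preceq> x + y"
  by (simp add: cone_le_def)

text \<open>Self-duality gives \<open>\<langle>x, x\<rangle> \<le> \<langle>x, y\<rangle>\<close>, so order intervals are norm bounded with constant 1.\<close>

lemma norm_mono:
  assumes "x \<in> C" "x \<preceq> y"
  shows "norm x \<le> norm y"
proof -
  have "norm x * norm x = x \<bullet> x" by (simp add: norm_eq_sqrt_inner)
  also have "\<dots> \<le> x \<bullet> y" using assms by (simp add: cle_iff_inner)
  also have "\<dots> \<le> norm x * norm y" by (rule norm_cauchy_schwarz)
  finally show ?thesis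
    by (cases "x = 0") simp_all
qed

lemma interior_inner_pos:
  assumes "x \<in> interior C" "w \<in> C" "w \<noteq> 0"
  shows "0 < w \<bullet> x"
proof -
  obtain r where r: "r > 0" "cball x r \<subseteq> C"
    using assms(1) mem_interior_cball by blast
  have "x - (r / norm w) *\<^sub>R w \<in> C"
    using r assms(3) by (intro subsetD[OF r(2)]) (simp add: dist_norm)
  then have "0 \<le> w \<bullet> x - (r / norm w) * (w \<bullet> w)"
    using inner_nonneg[OF assms(2)] by (fastforce simp: inner_diff_right)
  moreover have "0 < (r / norm w) * (w \<bullet> w)"
    using r assms(3) by simp
  ultimately show ?thesis by linarith
qed

lemma compact_section: "compact (C \<inter> sphere 0 1)"
  by (simp add: closed_Int_compact closed_cone)

text \<open>By compactness of the unit vectors of \<open>C\<close>, strict positivity of a functional is automatically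
  uniform. This is the source of all quantitative statements about interior points.\<close>

lemma inner_coercive:
  assumes "\<And>w. w \<in> C \<Longrightarrow> w \<noteq> 0 \<Longrightarrow> 0 < w \<bullet> x"
  obtains c where "c > 0" "\<And>w. w \<in> C \<Longrightarrow> c * norm w \<le> w \<bullet> x"
proof (cases "C \<inter> sphere 0 1 = {}")
  case True
  have "w = 0" if "w \<in> C" for w
  proof (rule ccontr)
    assume "w \<noteq> 0"
    then have "inverse (norm w) *\<^sub>R w \<in> C \<inter> sphere 0 1"
      using scale_mem[OF that, of "inverse (norm w)"] by simp
    then show False using True by blast
  qed
  then show ?thesis using that[of 1] by fastforce
next
  case False
  have "continuous_on (C \<inter> sphere 0 1) (\<lambda>w. w \<bullet> x)" by (intro continuous_intros)
  then obtain w0 where w0: "w0 \<in> C \<inter> sphere 0 1"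
      "\<And>w. w \<in> C \<inter> sphere 0 1 \<Longrightarrow> w0 \<bullet> x \<le> w \<bullet> x"
    using continuous_attains_inf[OF compact_section False] by blast
  have "w0 \<bullet> x * norm w \<le> w \<bullet> x" if w: "w \<in> C" for w
  proof (cases "w = 0")
    case False
    have "w0 \<bullet> x \<le> (inverse (norm w) *\<^sub>R w) \<bullet> x"
      using w False by (intro w0) (simp add: scale_mem)
    then show ?thesis using False by (simp add: field_simps)
  qed simp
  moreover have "w0 \<bullet> x > 0" using assms[of w0] w0(1) by force
  ultimately show ?thesis using that by blast
qed

lemma interiorI:
  assumes "\<And>w. w \<in> C \<Longrightarrow> w \<noteq> 0 \<Longrightarrow> 0 < w \<bullet> x"
  shows "x \<in> interior C"
proof -
  obtain c where c: "c > 0" "\<And>w. w \<in> C \<Longrightarrow> c * norm w \<le> w \<bullet> x"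
    using inner_coercive[OF assms] by blast
  have "x + v \<in> C" if "norm v \<le> c" for v
  proof (subst mem_iff, intro ballI)
    fix w assume w: "w \<in> C"
    have "- (v \<bullet> w) \<le> norm v * norm w"
      using Cauchy_Schwarz_ineq2[of v w] by linarith
    also have "\<dots> \<le> c * norm w" by (intro mult_right_mono that) simp
    also have "\<dots> \<le> x \<bullet> w" using c(2)[OF w] by (simp add: inner_commute)
    finally show "0 \<le> (x + v) \<bullet> w" by (simp add: inner_add_left)
  qed
  then have "cball x c \<subseteq> C"
    by (metis (no_types) add.commute diff_add_cancel dist_commute dist_norm mem_cball subsetI)
  then show ?thesis using c(1) mem_interior_cball by blast
qed

lemma interior_mem: "x \<in> interior C \<Longrightarrow> x \<in> C"
  using interior_subset by blast

lemma interior_coercive: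
  assumes "x \<in> interior C"
  obtains c where "c > 0" "\<And>w. w \<in> C \<Longrightarrow> c * norm w \<le> w \<bullet> x"
  using inner_coercive interior_inner_pos[OF assms] by metis

lemma interior_add: "x \<in> interior C \<Longrightarrow> y \<in> C \<Longrightarrow> x + y \<in> interior C"
  by (intro interiorI) (simp add: inner_add_right add_pos_nonneg interior_inner_pos inner_nonneg)

lemma interior_scale: "x \<in> interior C \<Longrightarrow> 0 < c \<Longrightarrow> c *\<^sub>R x \<in> interior C"
  by (intro interiorI) (simp add: interior_inner_pos)

lemma interior_up: "x \<in> interior C \<Longrightarrow> x \<preceq> y \<Longrightarrow> y \<in> interior C"
  using interior_add[of x "y - x"] by (simp add: cone_le_def)

lemma interior_order_unit:
  assumes "x \<in> interior C"
  obtains c where "c > 0" "\<And>v. v \<preceq> (c * norm v) *\<^sub>R x"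
proof -
  obtain c where c: "c > 0" "\<And>w. w \<in> C \<Longrightarrow> c * norm w \<le> w \<bullet> x"
    using interior_coercive[OF assms] by blast
  have "v \<preceq> (inverse c * norm v) *\<^sub>R x" for v
    unfolding cle_iff_inner
  proof
    fix w assume w: "w \<in> C"
    have "w \<bullet> v \<le> norm w * norm v" by (rule norm_cauchy_schwarz)
    also have "\<dots> \<le> inverse c * norm v * (w \<bullet> x)"
      using mult_left_mono[OF c(2)[OF w], of "inverse c * norm v"] c(1) by (simp add: field_simps)
    finally show "w \<bullet> v \<le> w \<bullet> (inverse c * norm v) *\<^sub>R x" by simp
  qed
  then show ?thesis using that[of "inverse c"] c(1) by simp
qed

lemma interior_dominates:
  assumes "x \<in> interior C"
  obtains c where "c > 0" "v \<preceq> c *\<^sub>R x"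
proof -
  obtain c where c: "c > 0" "\<And>v. v \<preceq> (c * norm v) *\<^sub>R x"
    using interior_order_unit[OF assms] by blast
  have "v \<preceq> (c * norm v + 1) *\<^sub>R x"
    by (rule cle_trans[OF c(2)]) (simp add: cle_scale_right interior_mem assms)
  then show ?thesis using that c(1) by (meson add_nonneg_pos mult_nonneg_nonneg norm_ge_zero less_imp_le zero_less_one)
qed

lemma interior_ne_zero: "x \<in> interior C \<Longrightarrow> x \<noteq> 0"
proof
  assume x: "x \<in> interior C" and "x = 0"
  then obtain b :: 'a where b: "b \<in> Basis" by fastforce
  obtain c where c: "c > 0" "\<And>v. v \<preceq> (c * norm v) *\<^sub>R x"
    using interior_order_unit[OF x] by blast
  have "b \<preceq> 0" "- b \<preceq> 0" using c(2)[of b] c(2)[of "-b"] \<open>x = 0\<close> by auto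
  then have "b = 0" using pointed[of b] by (simp add: cone_le_def)
  then show False using b nonzero_Basis by blast
qed

lemma cle_lim:
  assumes "(f \<longlongrightarrow> a) F" "(g \<longlongrightarrow> b) F" "eventually (\<lambda>t. f t \<preceq> g t) F" "F \<noteq> bot"
  shows "a \<preceq> b"
  unfolding cone_le_def
  by (rule Lim_in_closed_set[OF closed_cone _ assms(4) tendsto_diff[OF assms(2,1)]])
     (use assms(3) in \<open>simp add: cone_le_def\<close>)

text \<open>The cone spans the space, so convergence may be tested on the functionals from \<open>C\<close>; these turn
  monotone functions into monotone real functions.\<close>

lemma tendsto_by_cone:
  assumes "\<And>w. w \<in> C \<Longrightarrow> \<exists>m. ((\<lambda>t. w \<bullet> f t) \<longlongrightarrow> m) F"
  shows "\<exists>l. (f \<longlongrightarrow> l) F"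
proof -
  obtain e where e: "e \<in> interior C" using interior_nonempty by blast
  have "\<exists>m. ((\<lambda>t. b \<bullet> f t) \<longlongrightarrow> m) F" for b
  proof -
    obtain c where c: "c > 0" "b \<preceq> c *\<^sub>R e" using interior_dominates[OF e] by blast
    obtain m1 m2 where m: "((\<lambda>t. (c *\<^sub>R e) \<bullet> f t) \<longlongrightarrow> m1) F"
        "((\<lambda>t. (c *\<^sub>R e - b) \<bullet> f t) \<longlongrightarrow> m2) F"
      using assms c scale_mem[OF interior_mem[OF e]] by (metis cone_le_def less_imp_le)
    have "((\<lambda>t. (c *\<^sub>R e) \<bullet> f t - (c *\<^sub>R e - b) \<bullet> f t) \<longlongrightarrow> m1 - m2) F"
      by (intro tendsto_intros m)
    then show ?thesis by (auto simp: inner_diff_left)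
  qed
  then obtain m where m: "\<And>b. ((\<lambda>t. b \<bullet> f t) \<longlongrightarrow> m b) F" by metis
  have "((\<lambda>t. \<Sum>b\<in>Basis. (b \<bullet> f t) *\<^sub>R b) \<longlongrightarrow> (\<Sum>b\<in>Basis. m b *\<^sub>R b)) F"
    by (intro tendsto_intros m)
  moreover have "(\<Sum>b\<in>Basis. (b \<bullet> f t) *\<^sub>R b) = f t" for t
    by (subst (2) euclidean_representation [symmetric]) (simp add: inner_commute)
  ultimately show ?thesis by auto
qed

lemma monotone_limit_at_right_0:
  fixes f :: "real \<Rightarrow> 'a"
  assumes mono: "\<And>s t. 0 < s \<Longrightarrow> s \<le> t \<Longrightarrow> f s \<preceq> f t"
    and nonneg: "\<And>t. 0 < t \<Longrightarrow> f t \<in> C"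
  obtains l where "l \<in> C" "(f \<longlongrightarrow> l) (at_right 0)" "\<And>t. 0 < t \<Longrightarrow> l \<preceq> f t"
proof -
  have "\<exists>m. ((\<lambda>t. w \<bullet> f t) \<longlongrightarrow> m) (at_right 0)" if w: "w \<in> C" for w
    using Lim_right_bound[of UNIV 0 "\<lambda>t. w \<bullet> f t" 0] mono nonneg w
    by (auto simp: cle_iff_inner inner_nonneg)
  then obtain l where l: "(f \<longlongrightarrow> l) (at_right 0)" using tendsto_by_cone by blast
  have "l \<preceq> f t" if t: "t > 0" for t
  proof (rule cle_lim[OF l tendsto_const])
    show "\<forall>\<^sub>F s in at_right 0. f s \<preceq> f t"
      using mono t by (auto simp: eventually_at_right_field intro!: exI[of _ t])
  qed simp
  moreover have "0 \<preceq> l"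
    by (rule cle_lim[OF tendsto_const l])
       (use nonneg in \<open>auto simp: eventually_at_right_field cle_zero_iff intro!: exI[of _ 1]\<close>)
  ultimately show ?thesis using that l cle_zero_iff by blast
qed

text \<open>The section \<open>D = {w \<in> C. \<langle>w, e\<rangle> = 1 \<and> \<langle>w, z\<rangle> = 0}\<close> is compact and convex, so the maximum of
  \<open>\<langle>_, a\<rangle>\<close> is attained at an extreme point of \<open>D\<close>. That point spans an extreme ray of the whole
  cone, because \<open>\<langle>_, z\<rangle>\<close> is non-negative on \<open>C\<close>: both summands of any decomposition lie in
  \<open>z\<^sup>\<bottom>\<close> again. The case \<open>z = 0\<close> deals with the full base of \<open>C\<close>, other choices of \<open>z\<close> with
  the rays of an exposed face.\<close>

lemma maximizer_on_extreme_ray: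
  assumes e: "e \<in> interior C" and z: "z \<in> C" and w0: "w0 \<in> C" "w0 \<noteq> 0" "w0 \<bullet> z = 0"
  obtains w where "w \<in> Extr C" "w \<in> C" "w \<bullet> e = 1" "w \<bullet> z = 0"
    "\<And>w'. w' \<in> C \<Longrightarrow> w' \<bullet> z = 0 \<Longrightarrow> w' \<bullet> a \<le> (w \<bullet> a) * (w' \<bullet> e)"
proof -
  define D where "D = C \<inter> {w. e \<bullet> w = 1} \<inter> {w. z \<bullet> w = 0}"
  have normalise: "(1 / (w \<bullet> e)) *\<^sub>R w \<in> D" "0 < w \<bullet> e"
    if "w \<in> C" "w \<noteq> 0" "w \<bullet> z = 0" for w
    using that interior_inner_pos[OF e, of w]
    by (auto simp: D_def inner_commute intro!: scale_mem)
  have ne: "D \<noteq> {}" using normalise w0 by blast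
  have "closed D" unfolding D_def by (intro closed_Int closed_cone closed_hyperplane)
  moreover have "bounded D"
  proof -
    obtain c where "c > 0" "\<And>w. w \<in> C \<Longrightarrow> c * norm w \<le> w \<bullet> e"
      using interior_coercive[OF e] by blast
    then have "norm w \<le> 1 / c" if "w \<in> D" for w
      using that by (force simp: D_def inner_commute field_simps)
    then show ?thesis by (auto simp: bounded_iff)
  qed
  ultimately have comp: "compact D" using compact_eq_bounded_closed by blast
  have conv: "convex D" unfolding D_def by (intro convex_Int convex_cone convex_hyperplane)
  have "continuous_on D (\<lambda>w. a \<bullet> w)" by (intro continuous_intros)
  then obtain m where m: "m \<in> D" "\<And>w. w \<in> D \<Longrightarrow> a \<bullet> w \<le> a \<bullet> m"
    using continuous_attains_sup[OF comp ne] by blast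
  define F where "F = D \<inter> {w. a \<bullet> w = a \<bullet> m}"
  have face: "F face_of D"
    unfolding F_def by (rule face_of_Int_supporting_hyperplane_le[OF conv m(2)])
  have "compact F" "convex F" "F \<noteq> {}"
    using comp conv m(1) unfolding F_def
    by (auto intro!: compact_Int_closed closed_hyperplane convex_Int convex_hyperplane)
  then obtain w where "w extreme_point_of F"
    using extreme_point_exists_convex by blast
  then have w: "w extreme_point_of D" "w \<in> F"
    using extreme_point_of_face[OF face] by auto
  then have wD: "w \<in> D" by (simp add: F_def)
  then have wC: "w \<in> C" "w \<bullet> e = 1" "w \<bullet> z = 0" by (auto simp: D_def inner_commute)
  then have w_ne: "w \<noteq> 0" by auto
  have ray: "cone hull {w} = {t *\<^sub>R w | t. 0 \<le> t}"
    by (auto simp: cone_hull_expl)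
  have "cone hull {w} face_of C"
    unfolding face_of_def
  proof (intro conjI ballI impI)
    show "cone hull {w} \<subseteq> C" using wC by (auto simp: ray intro: scale_mem)
    show "convex (cone hull {w})" by (simp add: convex_cone_hull)
  next
    fix p q y assume p: "p \<in> C" and q: "q \<in> C" and y: "y \<in> cone hull {w}" "y \<in> open_segment p q"
    obtain t where t: "0 \<le> t" "y = t *\<^sub>R w" using y(1) by (auto simp: ray)
    obtain s where s: "0 < s" "s < 1" "y = (1 - s) *\<^sub>R p + s *\<^sub>R q"
      using y(2) by (auto simp: in_segment)
    have pz: "p \<bullet> z = 0" and qz: "q \<bullet> z = 0"
    proof -
      have "(1 - s) * (p \<bullet> z) + s * (q \<bullet> z) = 0"
        using arg_cong[OF s(3), of "\<lambda>v. v \<bullet> z"] t wC by (simp add: inner_add_left)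
      moreover have "0 \<le> (1 - s) * (p \<bullet> z)" "0 \<le> s * (q \<bullet> z)"
        using s p q z by (auto intro!: mult_nonneg_nonneg inner_nonneg)
      ultimately have "(1 - s) * (p \<bullet> z) = 0" "s * (q \<bullet> z) = 0" by linarith+
      then show "p \<bullet> z = 0" "q \<bullet> z = 0" using s by auto
    qed
    have on_ray: "p \<in> cone hull {w}" if "p = (p \<bullet> e) *\<^sub>R w" "p \<in> C" for p
    proof -
      have "0 \<le> p \<bullet> e" using that e interior_mem inner_nonneg by blast
      then show ?thesis using that by (auto simp: ray)
    qed
    have te: "t = (1 - s) * (p \<bullet> e) + s * (q \<bullet> e)"
      using arg_cong[OF s(3), of "\<lambda>v. v \<bullet> e"] t wC by (simp add: inner_add_left)
    have "p = (p \<bullet> e) *\<^sub>R w \<and> q = (q \<bullet> e) *\<^sub>R w"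
    proof (cases "p = 0 \<or> q = 0")
      case True
      then show ?thesis
      proof
        assume "p = 0"
        then show ?thesis using s t te by (simp flip: scaleR_scaleR)
      next
        assume "q = 0"
        then show ?thesis using s t te by (simp flip: scaleR_scaleR)
      qed
    next
      case False
      define P where "P = (1 / (p \<bullet> e)) *\<^sub>R p"
      define Q where "Q = (1 / (q \<bullet> e)) *\<^sub>R q"
      have PQ: "P \<in> D" "Q \<in> D" "0 < p \<bullet> e" "0 < q \<bullet> e"
        using normalise[of p] normalise[of q] p q pz qz False by (auto simp: P_def Q_def)
      have tpos: "t > 0" unfolding te using s PQ by (simp add: add_pos_pos)
      define r where "r = s * (q \<bullet> e) / t"
      have r1: "1 - r = (1 - s) * (p \<bullet> e) / t"
        unfolding r_def using tpos te by (simp add: field_simps)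
      have "0 < r" "r < 1"
      proof -
        show "0 < r" unfolding r_def using s PQ tpos by simp
        have "0 < 1 - r" unfolding r1 using s PQ tpos by simp
        then show "r < 1" by simp
      qed
      moreover have "w = (1 - r) *\<^sub>R P + r *\<^sub>R Q"
      proof -
        have "(1 - r) *\<^sub>R P + r *\<^sub>R Q = (1 / t) *\<^sub>R ((1 - s) *\<^sub>R p + s *\<^sub>R q)"
          unfolding r1 unfolding r_def P_def Q_def using PQ by (simp add: scaleR_add_right)
        then show ?thesis using tpos by (simp flip: s(3) add: t(2))
      qed
      ultimately have "P = Q"
        using w(1) PQ by (auto simp: extreme_point_of_def in_segment)
      then have "P = w" "Q = w"
        using \<open>w = (1 - r) *\<^sub>R P + r *\<^sub>R Q\<close> by (auto simp flip: scaleR_left_distrib)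
      moreover have "p = (p \<bullet> e) *\<^sub>R P" "q = (q \<bullet> e) *\<^sub>R Q"
        using PQ(3,4) by (simp_all add: P_def Q_def)
      ultimately show ?thesis by simp
    qed
    then show "p \<in> cone hull {w}" "q \<in> cone hull {w}" using on_ray p q by auto
  qed
  then have "w \<in> Extr C" using w_ne by (simp add: Extr_def)
  moreover have "w' \<bullet> a \<le> (w \<bullet> a) * (w' \<bullet> e)" if "w' \<in> C" "w' \<bullet> z = 0" for w'
  proof (cases "w' = 0")
    case False
    have "a \<bullet> ((1 / (w' \<bullet> e)) *\<^sub>R w') \<le> a \<bullet> w"
      using m(2)[OF normalise(1)[OF that(1) False that(2)]] w(2) by (simp add: F_def)
    then show ?thesis using normalise(2)[OF that(1) False that(2)]
      by (simp add: field_simps inner_commute)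
  qed simp
  ultimately show ?thesis using that wC by blast
qed

lemma Extr_subset: "w \<in> Extr C \<Longrightarrow> w \<in> C \<and> w \<noteq> 0"
  by (auto simp: Extr_def dest!: face_of_imp_subset intro: hull_inc)

end

section \<open>Order-preserving sub-homogeneous maps\<close>

context self_dual_cone
begin

lemma ratio_maximum_attained:
  assumes y: "y \<in> interior C"
  obtains w where "w \<in> Extr C" "\<And>w'. w' \<in> Extr C \<Longrightarrow> w' \<bullet> v / (w' \<bullet> y) \<le> w \<bullet> v / (w \<bullet> y)"
    "v \<preceq> (w \<bullet> v / (w \<bullet> y)) *\<^sub>R y"
proof -
  have C: "y \<in> C" "y \<noteq> 0" using interior_mem interior_ne_zero y by auto
  obtain w where w: "w \<in> Extr C" "w \<bullet> y = 1"
      and max: "\<And>w'. w' \<in> C \<Longrightarrow> w' \<bullet> v \<le> (w \<bullet> v) * (w' \<bullet> y)"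
    using maximizer_on_extreme_ray[OF y zero_mem C inner_zero_right, of v] by (metis inner_zero_right)
  have "w' \<bullet> v / (w' \<bullet> y) \<le> w \<bullet> v / (w \<bullet> y)" if "w' \<in> Extr C" for w'
    using max[of w'] interior_inner_pos[OF y, of w'] Extr_subset[OF that] w by (simp add: field_simps)
  moreover have "v \<preceq> (w \<bullet> v / (w \<bullet> y)) *\<^sub>R y"
    using max w by (simp add: cle_iff_inner)
  ultimately show ?thesis using that w by blast
qed

lemma funk_M_le: "0 < \<mu> \<Longrightarrow> y \<preceq> \<mu> *\<^sub>R x \<Longrightarrow> funk_M C x y \<le> \<mu>"
  unfolding funk_M_def by (rule cInf_lower) (auto intro!: bdd_belowI[of _ 0])

text \<open>Pairing with \<open>x\<close> itself bounds every admissible factor from below.\<close>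

lemma funk_M_ge:
  assumes x: "x \<in> interior C" and u: "u \<in> C" "u \<noteq> 0" "u \<preceq> y"
  shows "(x \<bullet> u) / (x \<bullet> x) \<le> funk_M C x y"
  unfolding funk_M_def
proof (rule cInf_greatest)
  obtain c where "c > 0" "y \<preceq> c *\<^sub>R x" using interior_dominates[OF x] by blast
  then show "{\<mu>. 0 < \<mu> \<and> y \<preceq> \<mu> *\<^sub>R x} \<noteq> {}" by blast
next
  fix \<mu> assume "\<mu> \<in> {\<mu>. 0 < \<mu> \<and> y \<preceq> \<mu> *\<^sub>R x}"
  then have "u \<preceq> \<mu> *\<^sub>R x" using cle_trans u(3) by blast
  then have "x \<bullet> u \<le> \<mu> * (x \<bullet> x)" using interior_mem[OF x] by (auto simp: cle_iff_inner)
  then show "(x \<bullet> u) / (x \<bullet> x) \<le> \<mu>"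
    using interior_ne_zero[OF x] by (simp add: field_simps)
qed

end

locale subhomogeneous_map = self_dual_cone C for C :: "'a::euclidean_space set" +
  fixes T :: "'a \<Rightarrow> 'a"
  assumes maps_interior: "x \<in> interior C \<Longrightarrow> T x \<in> interior C"
    and image_mono: "x \<in> interior C \<Longrightarrow> y \<in> interior C \<Longrightarrow> cone_le C x y \<Longrightarrow> cone_le C (T x) (T y)"
    and subhom: "x \<in> interior C \<Longrightarrow> 1 \<le> \<mu> \<Longrightarrow> cone_le C (T (\<mu> *\<^sub>R x)) (\<mu> *\<^sub>R T x)"
begin

lemma funpow_interior: "x \<in> interior C \<Longrightarrow> (T ^^ k) x \<in> interior C"
  by (induction k) (auto intro: maps_interior)

text \<open>This is the non-expansiveness of \<open>T\<close> for the positive part of the Funk metric.\<close>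

lemma image_le:
  assumes "x \<in> interior C" "y \<in> interior C" "1 \<le> \<mu>" "y \<preceq> \<mu> *\<^sub>R x"
  shows "T y \<preceq> \<mu> *\<^sub>R T x"
proof (rule cle_trans)
  show "T y \<preceq> T (\<mu> *\<^sub>R x)" using assms by (intro image_mono interior_scale) auto
  show "T (\<mu> *\<^sub>R x) \<preceq> \<mu> *\<^sub>R T x" using assms by (intro subhom)
qed

text \<open>If \<open>X n\<close> tends to \<open>x\<close>, then \<open>(1 - d n) x \<preceq> X n \<preceq> (1 + d n) x\<close> with \<open>d n \<rightarrow> 0\<close>, and \<open>T\<close>
  preserves these bounds by sub-homogeneity.\<close>

lemma continuous_on_interior: "continuous_on (interior C) T"
proof (subst continuous_on_sequentially, intro allI ballI impI)
  fix X x assume x: "x \<in> interior C" and "(\<forall>n. X n \<in> interior C) \<and> X \<longlonglongrightarrow> x"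
  then have X: "\<And>n. X n \<in> interior C" "X \<longlonglongrightarrow> x" by auto
  obtain c where c: "c > 0" "\<And>v. v \<preceq> (c * norm v) *\<^sub>R x"
    using interior_order_unit[OF x] by blast
  have dist0: "(\<lambda>n. norm (X n - x)) \<longlonglongrightarrow> 0"
    using X(2) by (simp add: LIM_zero tendsto_norm_zero)
  define d where "d n = c * norm (X n - x)" for n
  have d0: "d \<longlonglongrightarrow> 0" unfolding d_def using tendsto_mult_right_zero[OF dist0] by simp
  have dn: "d n \<ge> 0" for n using c by (simp add: d_def)
  have ev: "eventually (\<lambda>n. d n < 1) sequentially"
    using order_tendstoD(2)[OF d0, of 1] by simp
  have bound: "norm (T (X n) - T x) \<le> (d n + (1 + d n - (1 - d n))) * norm (T x)" if "d n < 1" for n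
  proof -
    have "X n - x \<preceq> d n *\<^sub>R x" "x - X n \<preceq> d n *\<^sub>R x"
      using c(2)[of "X n - x"] c(2)[of "x - X n"] by (auto simp: d_def norm_minus_commute)
    then have 1: "X n \<preceq> (1 + d n) *\<^sub>R x" and 2: "(1 - d n) *\<^sub>R x \<preceq> X n"
      by (auto simp: cone_le_def algebra_simps)
    have 3: "T (X n) \<preceq> (1 + d n) *\<^sub>R T x"
      using image_le[OF x X(1) _ 1] dn[of n] by simp
    have "x \<preceq> (1 / (1 - d n)) *\<^sub>R X n"
      using cle_scale[OF 2, of "1 / (1 - d n)"] that by simp
    then have "T x \<preceq> (1 / (1 - d n)) *\<^sub>R T (X n)"
      using image_le[OF X(1) x] dn[of n] that by (simp add: field_simps)
    then have 4: "(1 - d n) *\<^sub>R T x \<preceq> T (X n)"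
      using cle_scale[of "T x" "(1 / (1 - d n)) *\<^sub>R T (X n)" "1 - d n"] that by simp
    have "norm ((1 + d n) *\<^sub>R T x - T (X n)) \<le> norm ((1 + d n) *\<^sub>R T x - (1 - d n) *\<^sub>R T x)"
      using 3 4 by (intro norm_mono) (auto simp: cone_le_def)
    also have "\<dots> = (1 + d n - (1 - d n)) * norm (T x)"
      using dn[of n] by (simp flip: scaleR_left_diff_distrib)
    finally have 5: "norm ((1 + d n) *\<^sub>R T x - T (X n)) \<le> (1 + d n - (1 - d n)) * norm (T x)" .
    have "T (X n) - T x = d n *\<^sub>R T x - ((1 + d n) *\<^sub>R T x - T (X n))"
      by (simp add: algebra_simps)
    then have "norm (T (X n) - T x) \<le> norm (d n *\<^sub>R T x) + norm ((1 + d n) *\<^sub>R T x - T (X n))"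
      by (metis norm_triangle_ineq4)
    then show ?thesis using 5 dn[of n] by (simp add: distrib_right)
  qed
  have "(\<lambda>n. (d n + (1 + d n - (1 - d n))) * norm (T x)) \<longlonglongrightarrow> (0 + (1 + 0 - (1 - 0))) * norm (T x)"
    by (intro tendsto_intros d0)
  then have "(\<lambda>n. (d n + (1 + d n - (1 - d n))) * norm (T x)) \<longlonglongrightarrow> 0" by simp
  moreover have "eventually (\<lambda>n. norm (T (X n) - T x) \<le> (d n + (1 + d n - (1 - d n))) * norm (T x)) sequentially"
    using ev by (rule eventually_mono) (rule bound)
  ultimately have "(\<lambda>n. T (X n) - T x) \<longlonglongrightarrow> 0" by (rule Lim_null_comparison[rotated])
  then show "(T \<circ> X) \<longlonglongrightarrow> T x" by (simp add: LIM_zero_cancel o_def)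
qed

text \<open>Along one direction the values decrease with \<open>\<epsilon>\<close> and stay in \<open>C\<close>. Any two interior directions
  are comparable up to a factor, which reparametrises \<open>\<epsilon>\<close>, so their limits bound each other.\<close>

lemma radial_ext_limit:
  assumes x: "x \<in> C"
  shows "radial_ext C T x \<in> C"
    and "z \<in> interior C \<Longrightarrow> ((\<lambda>\<epsilon>. T (x + \<epsilon> *\<^sub>R z)) \<longlongrightarrow> radial_ext C T x) (at_right 0)"
    and "z \<in> interior C \<Longrightarrow> 0 < \<epsilon> \<Longrightarrow> radial_ext C T x \<preceq> T (x + \<epsilon> *\<^sub>R z)"
proof -
  have int: "x + t *\<^sub>R z \<in> interior C" if "z \<in> interior C" "t > 0" for z t
    using interior_add[OF interior_scale[OF that] x] by (simp add: add.commute)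
  have ex: "\<exists>l. l \<in> C \<and> ((\<lambda>\<epsilon>. T (x + \<epsilon> *\<^sub>R z)) \<longlongrightarrow> l) (at_right 0) \<and>
      (\<forall>\<epsilon>>0. l \<preceq> T (x + \<epsilon> *\<^sub>R z))" if z: "z \<in> interior C" for z
  proof (rule monotone_limit_at_right_0[of "\<lambda>\<epsilon>. T (x + \<epsilon> *\<^sub>R z)"])
    show "T (x + s *\<^sub>R z) \<preceq> T (x + t *\<^sub>R z)" if "0 < s" "s \<le> t" for s t
      using that z int cle_scale_right[OF interior_mem[OF z]]
      by (intro image_mono) (auto intro!: cle_add_mono cle_refl)
    show "T (x + t *\<^sub>R z) \<in> C" if "0 < t" for t
      using that z int maps_interior interior_mem by blast
  qed blast
  then obtain l where l: "\<And>z. z \<in> interior C \<Longrightarrow> l z \<in> C"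
      "\<And>z. z \<in> interior C \<Longrightarrow> ((\<lambda>\<epsilon>. T (x + \<epsilon> *\<^sub>R z)) \<longlongrightarrow> l z) (at_right 0)"
      "\<And>z \<epsilon>. z \<in> interior C \<Longrightarrow> 0 < \<epsilon> \<Longrightarrow> l z \<preceq> T (x + \<epsilon> *\<^sub>R z)"
    by metis
  have le: "l z \<preceq> l z'" if z: "z \<in> interior C" "z' \<in> interior C" for z z'
  proof -
    obtain c where c: "c > 0" "z \<preceq> c *\<^sub>R z'" using interior_dominates[OF z(2)] by blast
    have "l z \<preceq> T (x + t *\<^sub>R z')" if t: "t > 0" for t
    proof -
      have "T (x + (t / c) *\<^sub>R z) \<preceq> T (x + t *\<^sub>R z')"
        using cle_scale[OF c(2), of "t / c"] c(1) t z int
        by (intro image_mono cle_add_mono cle_refl int) auto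
      then show ?thesis using cle_trans[OF l(3)[OF z(1), of "t / c"]] c(1) t by simp
    qed
    then show ?thesis
      by (intro cle_lim[OF tendsto_const l(2)[OF z(2)]])
         (auto simp: eventually_at_right_field intro!: exI[of _ 1])
  qed
  obtain z0 where z0: "z0 \<in> interior C" using interior_nonempty by blast
  have eq: "l z = l z0" if "z \<in> interior C" for z
    using le that z0 cle_antisym by blast
  have re: "radial_ext C T x = l z0"
    unfolding radial_ext_def
  proof (rule the_equality)
    show "\<forall>z\<in>interior C. ((\<lambda>\<epsilon>. T (x + \<epsilon> *\<^sub>R z)) \<longlongrightarrow> l z0) (at_right 0)"
      using l(2) eq by simp
    fix k assume "\<forall>z\<in>interior C. ((\<lambda>\<epsilon>. T (x + \<epsilon> *\<^sub>R z)) \<longlongrightarrow> k) (at_right 0)"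
    then show "k = l z0" using l(2)[OF z0] z0 tendsto_unique[OF trivial_limit_at_right_real] by blast
  qed
  show "radial_ext C T x \<in> C" using l(1)[OF z0] re by simp
  show "((\<lambda>\<epsilon>. T (x + \<epsilon> *\<^sub>R z)) \<longlongrightarrow> radial_ext C T x) (at_right 0)" if "z \<in> interior C"
    using l(2)[OF that] eq[OF that] re by simp
  show "radial_ext C T x \<preceq> T (x + \<epsilon> *\<^sub>R z)" if "z \<in> interior C" "0 < \<epsilon>"
    using l(3)[OF that] eq[OF that(1)] re by simp
qed

text \<open>Sub-homogeneity passes to the radial extension, so \<open>\<gamma>\<^sup>-\<^sup>1 radial_ext C T (\<gamma> x)\<close> decreases as
  \<open>\<gamma>\<close> grows; with \<open>t = \<gamma>\<^sup>-\<^sup>1\<close> this is again a monotone limit at \<open>0\<close>. The last claim says that the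
  limit is also a lower bound, which is how the infimum in the description of the recession map
  is used.\<close>

lemma recession_map_limit:
  assumes x: "x \<in> C"
  shows "recession_map C T x \<in> C"
    and "((\<lambda>\<gamma>. inverse \<gamma> *\<^sub>R radial_ext C T (\<gamma> *\<^sub>R x)) \<longlongrightarrow> recession_map C T x) at_top"
    and "0 < \<gamma> \<Longrightarrow> \<gamma> *\<^sub>R recession_map C T x \<preceq> radial_ext C T (\<gamma> *\<^sub>R x)"
proof -
  obtain z where z: "z \<in> interior C" using interior_nonempty by blast
  define f where "f t = t *\<^sub>R radial_ext C T (inverse t *\<^sub>R x)" for t
  have int: "v + t *\<^sub>R z \<in> interior C" if "v \<in> C" "t > 0" for v t
    using interior_add[OF interior_scale[OF z that(2)] that(1)] by (simp add: add.commute)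
  have sub: "radial_ext C T (\<mu> *\<^sub>R v) \<preceq> \<mu> *\<^sub>R radial_ext C T v" if "v \<in> C" "1 \<le> \<mu>" for v \<mu>
  proof (rule cle_lim)
    show "((\<lambda>\<epsilon>. T (\<mu> *\<^sub>R v + \<epsilon> *\<^sub>R (\<mu> *\<^sub>R z))) \<longlongrightarrow> radial_ext C T (\<mu> *\<^sub>R v)) (at_right 0)"
      using that z by (intro radial_ext_limit(2) scale_mem interior_scale) auto
    show "((\<lambda>\<epsilon>. \<mu> *\<^sub>R T (v + \<epsilon> *\<^sub>R z)) \<longlongrightarrow> \<mu> *\<^sub>R radial_ext C T v) (at_right 0)"
      using that z by (intro tendsto_intros radial_ext_limit(2)) auto
    have "T (\<mu> *\<^sub>R v + \<epsilon> *\<^sub>R (\<mu> *\<^sub>R z)) \<preceq> \<mu> *\<^sub>R T (v + \<epsilon> *\<^sub>R z)" if "\<epsilon> > 0" for \<epsilon>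
      using subhom[OF int \<open>1 \<le> \<mu>\<close>, of v \<epsilon>] \<open>v \<in> C\<close> that by (simp add: scaleR_add_right mult.commute)
    then show "\<forall>\<^sub>F \<epsilon> in at_right 0. T (\<mu> *\<^sub>R v + \<epsilon> *\<^sub>R (\<mu> *\<^sub>R z)) \<preceq> \<mu> *\<^sub>R T (v + \<epsilon> *\<^sub>R z)"
      by (auto simp: eventually_at_right_field intro!: exI[of _ 1])
  qed simp
  obtain l where l: "l \<in> C" "(f \<longlongrightarrow> l) (at_right 0)" "\<And>t. 0 < t \<Longrightarrow> l \<preceq> f t"
  proof (rule monotone_limit_at_right_0[of f])
    show "f s \<preceq> f t" if "0 < s" "s \<le> t" for s t
    proof -
      have "radial_ext C T ((t / s) *\<^sub>R (inverse t *\<^sub>R x)) \<preceq> (t / s) *\<^sub>R radial_ext C T (inverse t *\<^sub>R x)"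
        using that x by (intro sub scale_mem) auto
      then have "s *\<^sub>R radial_ext C T ((t / s) *\<^sub>R (inverse t *\<^sub>R x)) \<preceq>
          s *\<^sub>R (t / s) *\<^sub>R radial_ext C T (inverse t *\<^sub>R x)"
        using that by (intro cle_scale) auto
      then show ?thesis using that by (simp add: f_def field_simps)
    qed
    show "f t \<in> C" if "0 < t" for t
      unfolding f_def using that x by (intro scale_mem radial_ext_limit(1)) auto
  qed blast
  have lim: "((\<lambda>\<gamma>. inverse \<gamma> *\<^sub>R radial_ext C T (\<gamma> *\<^sub>R x)) \<longlongrightarrow> l) at_top"
    using l(2) by (simp add: filterlim_at_right_to_top f_def)
  have eq: "recession_map C T x = l"
    unfolding recession_map_def by (rule tendsto_Lim[OF _ lim]) simp
  show "recession_map C T x \<in> C" using eq l(1) by simp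
  show "((\<lambda>\<gamma>. inverse \<gamma> *\<^sub>R radial_ext C T (\<gamma> *\<^sub>R x)) \<longlongrightarrow> recession_map C T x) at_top"
    using eq lim by simp
  show "\<gamma> *\<^sub>R recession_map C T x \<preceq> radial_ext C T (\<gamma> *\<^sub>R x)" if "0 < \<gamma>"
    using cle_scale[OF l(3)[of "inverse \<gamma>"], of \<gamma>] that eq by (simp add: f_def)
qed

text \<open>Inflating \<open>x\<close> to \<open>(1 + d) x\<close> makes room for the interior perturbation \<open>u + d x\<close> of \<open>u\<close>.\<close>

lemma image_ge_radial_ext:
  assumes x: "x \<in> interior C" and u: "u \<in> C" "u \<preceq> x"
  shows "radial_ext C T u \<preceq> T x"
proof (rule cle_lim)
  show "((\<lambda>d. (1 + d) *\<^sub>R T x) \<longlongrightarrow> T x) (at_right 0)"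
    by (rule tendsto_eq_intros refl)+ simp
  have "radial_ext C T u \<preceq> (1 + d) *\<^sub>R T x" if d: "d > 0" for d
  proof -
    have ud: "u + d *\<^sub>R x \<in> interior C"
      using interior_add[OF interior_scale[OF x d] u(1)] by (simp add: add.commute)
    have "u + d *\<^sub>R x \<preceq> (1 + d) *\<^sub>R x" using u(2) by (simp add: cone_le_def algebra_simps)
    then have "T (u + d *\<^sub>R x) \<preceq> (1 + d) *\<^sub>R T x"
      using image_le[OF x ud] d by simp
    then show ?thesis using radial_ext_limit(3)[OF u(1) x d] cle_trans by blast
  qed
  then show "\<forall>\<^sub>F d in at_right 0. radial_ext C T u \<preceq> (1 + d) *\<^sub>R T x"
    by (auto simp: eventually_at_right_field intro!: exI[of _ 1])
qed (auto intro: tendsto_const)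

text \<open>The recession map bounds \<open>T\<close> from below at every scale, so this inequality can be iterated for
  every \<open>l > 0\<close>.\<close>

lemma funpow_lower_bound:
  assumes x: "x \<in> interior C" and u: "u \<in> C" "g *\<^sub>R u \<preceq> x" "0 < g"
    and l: "0 < l" "l *\<^sub>R u \<preceq> recession_map C T u"
  shows "(l ^ k * g) *\<^sub>R u \<preceq> (T ^^ k) x"
proof (induction k)
  case 0
  then show ?case using u by simp
next
  case (Suc k)
  have pos: "0 < l ^ k * g" using l u by simp
  have "(l ^ Suc k * g) *\<^sub>R u = (l ^ k * g) *\<^sub>R (l *\<^sub>R u)" by (simp add: algebra_simps)
  also have "\<dots> \<preceq> (l ^ k * g) *\<^sub>R recession_map C T u" using pos l by (intro cle_scale) auto
  also have "\<dots> \<preceq> radial_ext C T ((l ^ k * g) *\<^sub>R u)" by (rule recession_map_limit(3)[OF u(1) pos])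
  also have "\<dots> \<preceq> T ((T ^^ k) x)"
    using pos u Suc.IH by (intro image_ge_radial_ext funpow_interior x scale_mem) auto
  finally show ?case by simp
qed

text \<open>Sub-homogeneity controls \<open>T\<close> on \<open>\<mu> y\<close> only for \<open>\<mu> \<ge> 1\<close>. Starting with \<open>a \<ge> 1\<close>, the factors
  \<open>l ^ k * a\<close> remain in this range if \<open>l \<ge> 1\<close>; homogeneity removes the restriction.\<close>

lemma funpow_upper_bound:
  assumes x: "x \<in> interior C" and y: "y \<in> interior C" and a: "x \<preceq> a *\<^sub>R y" "1 \<le> a"
    and l: "0 < l" "T y \<preceq> l *\<^sub>R y" and hom: "1 \<le> l \<or> pos_homogeneous C T"
  shows "(T ^^ k) x \<preceq> (l ^ k * a) *\<^sub>R y"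
proof (induction k)
  case 0
  then show ?case using a by simp
next
  case (Suc k)
  have pos: "0 < l ^ k * a" using l a by simp
  have int: "(l ^ k * a) *\<^sub>R y \<in> interior C" by (rule interior_scale[OF y pos])
  have "T ((T ^^ k) x) \<preceq> T ((l ^ k * a) *\<^sub>R y)"
    by (rule image_mono[OF funpow_interior[OF x] int Suc.IH])
  also have "\<dots> \<preceq> (l ^ k * a) *\<^sub>R T y"
    using hom
  proof
    assume "1 \<le> l"
    then have "1 * 1 \<le> l ^ k * a" using a by (intro mult_mono one_le_power) auto
    then show ?thesis using subhom[OF y] by simp
  next
    assume "pos_homogeneous C T"
    then show ?thesis using y pos by (auto simp: pos_homogeneous_def cle_refl)
  qed
  also have "\<dots> \<preceq> (l ^ k * a) *\<^sub>R (l *\<^sub>R y)" using pos l by (intro cle_scale) auto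
  also have "\<dots> = (l ^ Suc k * a) *\<^sub>R y" by (simp add: algebra_simps)
  finally show ?case by simp
qed

end

section \<open>The escape rate\<close>

context subhomogeneous_map
begin

text \<open>The normalised map \<open>y \<mapsto> S y / \<langle>S y, e\<rangle>\<close> with \<open>S y = T (n y) + e\<close> sends the base
  \<open>\<langle>y, e\<rangle> = 1\<close> into its part above \<open>del e\<close>, a compact convex set inside the interior of \<open>C\<close>:
  the summand \<open>e\<close> bounds \<open>S y\<close> from below, and \<open>T\<close> is bounded above on the base since all its
  points lie below one multiple of \<open>e\<close>. Brouwer's theorem applies there. By sub-homogeneity the
  bound \<open>K\<close> on the eigenvalues can be taken independent of \<open>n\<close>, which is what the passage to the
  limit requires.\<close>

lemma perturbed_eigenvector:
  assumes e: "e \<in> interior C"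
  shows "\<exists>K. \<forall>n::nat. 1 \<le> n \<longrightarrow> (\<exists>y l. y \<in> interior C \<and> y \<bullet> e = 1 \<and> 0 < l \<and> l \<le> K \<and>
      T (real n *\<^sub>R y) + e = (l * real n) *\<^sub>R y)"
proof -
  obtain c where c: "c > 0" "\<And>w. w \<in> C \<Longrightarrow> c * norm w \<le> w \<bullet> e"
    using interior_coercive[OF e] by blast
  obtain d where d: "d > 0" "\<And>v. v \<preceq> (d * norm v) *\<^sub>R e"
    using interior_order_unit[OF e] by blast
  define b where "b = d / c"
  have b: "b > 0" using c d by (simp add: b_def)
  have ub: "y \<preceq> b *\<^sub>R e" if "y \<in> C" "y \<bullet> e = 1" for y
  proof -
    have "d * norm y \<le> b" using c(2)[OF that(1)] that(2) c(1) d(1) by (simp add: b_def field_simps)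
    then show ?thesis using cle_trans[OF d(2)] cle_scale_right interior_mem[OF e] by blast
  qed
  have be: "b *\<^sub>R e \<in> interior C" by (rule interior_scale[OF e b])
  define K where "K = T (b *\<^sub>R e) \<bullet> e + e \<bullet> e"
  have ee: "0 < e \<bullet> e" using interior_ne_zero[OF e] by simp
  have Kge: "e \<bullet> e \<le> K"
    using inner_nonneg[of "T (b *\<^sub>R e)" e] maps_interior[OF be] e interior_mem by (simp add: K_def)
  have "\<exists>y l. y \<in> interior C \<and> y \<bullet> e = 1 \<and> 0 < l \<and> l \<le> K \<and>
      T (real n *\<^sub>R y) + e = (l * real n) *\<^sub>R y" if n: "1 \<le> n" for n
  proof -
    define r where "r = real n"
    have r: "1 \<le> r" using n by (simp add: r_def)
    \<comment> \<open>The bounds \<open>e \<preceq> S y\<close> and \<open>\<langle>S y, e\<rangle> \<le> r K\<close> keep the normalised vector above \<open>del e\<close>.\<close>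
    define del where "del = 1 / (r * K)"
    have K0: "K > 0" using ee Kge by linarith
    have del: "del > 0" using r K0 by (simp add: del_def)
    define Y where "Y = C \<inter> {y. y - del *\<^sub>R e \<in> C} \<inter> {y. e \<bullet> y = 1}"
    define S where "S y = T (r *\<^sub>R y) + e" for y
    have Yint: "y \<in> interior C" if "y \<in> Y" for y
      using interior_up[OF interior_scale[OF e del], of y] that by (simp add: Y_def cone_le_def)
    have ry: "r *\<^sub>R y \<in> interior C" if "y \<in> Y" for y
      using interior_scale[OF Yint[OF that], of r] r by simp
    have Se: "0 < S y \<bullet> e" "S y \<bullet> e \<le> r * K" "S y \<in> interior C" "e \<preceq> S y" if y: "y \<in> Y" for y
    proof -
      have TC: "T (r *\<^sub>R y) \<in> interior C" by (rule maps_interior[OF ry[OF y]])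
      show "e \<preceq> S y" using cle_add_right[OF interior_mem[OF TC], of e]
        by (simp add: S_def add.commute)
      then show "S y \<in> interior C" using interior_up[OF e] by blast
      then show "0 < S y \<bullet> e"
        using interior_inner_pos[OF e] interior_mem interior_ne_zero by blast
      have "y \<bullet> e = 1" using y by (simp add: Y_def inner_commute)
      then have "r *\<^sub>R y \<preceq> r *\<^sub>R (b *\<^sub>R e)"
        using y r by (intro cle_scale ub) (auto simp: Y_def)
      then have "T (r *\<^sub>R y) \<preceq> r *\<^sub>R T (b *\<^sub>R e)"
        using r by (intro image_le be ry y)
      then have "T (r *\<^sub>R y) \<bullet> e \<le> r * (T (b *\<^sub>R e) \<bullet> e)"
        using interior_mem[OF e] by (auto simp: cle_iff_inner inner_commute)
      moreover have "e \<bullet> e \<le> r * (e \<bullet> e)" using r ee by simp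
      ultimately show "S y \<bullet> e \<le> r * K" by (simp add: S_def K_def inner_add_left distrib_left)
    qed
    have "compact Y"
    proof -
      have "closed Y" unfolding Y_def
      proof (intro closed_Int closed_cone closed_hyperplane)
        have "{y. y - del *\<^sub>R e \<in> C} = (\<lambda>y. y - del *\<^sub>R e) -` C" by auto
        then show "closed {y. y - del *\<^sub>R e \<in> C}"
          by (simp add: closed_cone closed_vimage continuous_on_diff continuous_on_id continuous_on_const)
      qed
      moreover have "norm y \<le> 1 / c" if "y \<in> Y" for y
        using c(2)[of y] that c(1) by (simp add: Y_def inner_commute field_simps)
      then have "bounded Y" by (auto simp: bounded_iff)
      ultimately show ?thesis using compact_eq_bounded_closed by blast
    qed
    moreover have "convex Y"
    proof -
      have "{y. y - del *\<^sub>R e \<in> C} = (\<lambda>y. del *\<^sub>R e + y) ` C"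
        by (auto simp: image_iff) (metis add.commute diff_add_cancel)
      then have "convex {y. y - del *\<^sub>R e \<in> C}" by (simp add: convex_cone convex_translation)
      then show ?thesis unfolding Y_def by (intro convex_Int convex_cone convex_hyperplane)
    qed
    moreover have "Y \<noteq> {}"
    proof -
      have "del \<le> 1 / (e \<bullet> e)"
      proof -
        have "1 * (e \<bullet> e) \<le> r * K" using r Kge ee by (intro mult_mono) auto
        then show ?thesis using ee r K0 by (simp add: del_def field_simps)
      qed
      then have "(1 / (e \<bullet> e)) *\<^sub>R e - del *\<^sub>R e \<in> C"
        using cle_scale_right[OF interior_mem[OF e]] by (simp add: cone_le_def)
      moreover have "(1 / (e \<bullet> e)) *\<^sub>R e \<in> C"
        using ee by (intro scale_mem interior_mem e) auto
      ultimately have "(1 / (e \<bullet> e)) *\<^sub>R e \<in> Y" using ee by (simp add: Y_def)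
      then show ?thesis by blast
    qed
    moreover have "continuous_on Y (\<lambda>y. (1 / (S y \<bullet> e)) *\<^sub>R S y)"
    proof -
      have "continuous_on Y (\<lambda>y. T (r *\<^sub>R y))"
        by (rule continuous_on_compose2[OF continuous_on_interior]) (use ry in \<open>auto intro!: continuous_intros\<close>)
      then have cS: "continuous_on Y S" unfolding S_def by (intro continuous_intros)
      have nz: "\<forall>y\<in>Y. S y \<bullet> e \<noteq> 0" using Se(1) by force
      show ?thesis by (intro continuous_intros cS nz)
    qed
    moreover have "(\<lambda>y. (1 / (S y \<bullet> e)) *\<^sub>R S y) \<in> Y \<rightarrow> Y"
    proof
      fix y assume y: "y \<in> Y"
      have "del *\<^sub>R e \<preceq> (1 / (S y \<bullet> e)) *\<^sub>R e"
        using Se(1,2)[OF y] r K0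
        by (intro cle_scale_right interior_mem e) (simp add: del_def field_simps)
      also have "\<dots> \<preceq> (1 / (S y \<bullet> e)) *\<^sub>R S y"
        using Se(1,4)[OF y] by (intro cle_scale) auto
      finally have "del *\<^sub>R e \<preceq> (1 / (S y \<bullet> e)) *\<^sub>R S y" .
      moreover have "(1 / (S y \<bullet> e)) *\<^sub>R S y \<in> C"
        using Se(1,3)[OF y] by (intro scale_mem interior_mem) auto
      ultimately show "(1 / (S y \<bullet> e)) *\<^sub>R S y \<in> Y"
        using Se(1)[OF y] by (simp add: Y_def cone_le_def inner_commute[of e])
    qed
    ultimately obtain y where y: "y \<in> Y" "(1 / (S y \<bullet> e)) *\<^sub>R S y = y"
      by (rule brouwer)
    have "S y = (S y \<bullet> e) *\<^sub>R ((1 / (S y \<bullet> e)) *\<^sub>R S y)" using Se(1)[OF y(1)] by simp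
    then have "S y = (S y \<bullet> e) *\<^sub>R y" using y(2) by simp
    then have "T (r *\<^sub>R y) + e = (S y \<bullet> e / r * r) *\<^sub>R y" using r by (simp add: S_def)
    moreover have "0 < S y \<bullet> e / r" "S y \<bullet> e / r \<le> K"
      using Se[OF y(1)] r by (auto simp: field_simps)
    moreover have "y \<bullet> e = 1" using y(1) by (simp add: Y_def inner_commute)
    ultimately show ?thesis using Yint[OF y(1)] unfolding r_def by blast
  qed
  then show ?thesis by blast
qed

text \<open>The points \<open>n y\<^sub>n\<close> from the previous lemma satisfy \<open>T (n y\<^sub>n) \<preceq> l\<^sub>n n y\<^sub>n\<close> since the added \<open>e\<close> is
  positive. If \<open>y\<^sub>n \<rightarrow> u\<close>, then \<open>y\<^sub>n\<close> is eventually below \<open>u + (t / g) e\<close>, so sub-homogeneity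
  bounds \<open>T (g u + t e)\<close> below by \<open>(g / n) T (n y\<^sub>n) = g l\<^sub>n y\<^sub>n - (g / n) e\<close>. Letting first \<open>n\<close>
  tend to infinity, then \<open>t\<close> to \<open>0\<close> and \<open>g\<close> to infinity yields the inequality for the recession
  map.\<close>

lemma recession_subeigenvector:
  "\<exists>u (L::real) (y :: nat \<Rightarrow> 'a) (l :: nat \<Rightarrow> real). u \<in> C \<and> u \<noteq> 0 \<and>
     L *\<^sub>R u \<preceq> recession_map C T u \<and> l \<longlonglongrightarrow> L \<and>
     (\<forall>n. y n \<in> interior C \<and> 0 < l n \<and> T (y n) \<preceq> l n *\<^sub>R y n)"
proof -
  obtain e where e: "e \<in> interior C" using interior_nonempty by blast
  obtain K where K: "\<And>n::nat. 1 \<le> n \<Longrightarrow> \<exists>y l. y \<in> interior C \<and> y \<bullet> e = 1 \<and> 0 < l \<and> l \<le> K \<and>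
      T (real n *\<^sub>R y) + e = (l * real n) *\<^sub>R y"
    using perturbed_eigenvector[OF e] by auto
  have "\<forall>n. \<exists>y l. y \<in> interior C \<and> y \<bullet> e = 1 \<and> 0 < l \<and> l \<le> K \<and>
      T (real (Suc n) *\<^sub>R y) + e = (l * real (Suc n)) *\<^sub>R y"
    by (intro allI K) simp
  from choice[OF this] obtain y where "\<forall>n. \<exists>l. y n \<in> interior C \<and> y n \<bullet> e = 1 \<and> 0 < l \<and> l \<le> K \<and>
      T (real (Suc n) *\<^sub>R y n) + e = (l * real (Suc n)) *\<^sub>R y n" by blast
  from choice[OF this] obtain l where "\<forall>n. y n \<in> interior C \<and> y n \<bullet> e = 1 \<and> 0 < l n \<and> l n \<le> K \<and>
      T (real (Suc n) *\<^sub>R y n) + e = (l n * real (Suc n)) *\<^sub>R y n" by blast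
  then have yl: "\<And>n. y n \<in> interior C" "\<And>n. y n \<bullet> e = 1" "\<And>n. 0 < l n" "\<And>n. l n \<le> K"
      "\<And>n. T (real (Suc n) *\<^sub>R y n) + e = (l n * real (Suc n)) *\<^sub>R y n"
    by simp_all
  obtain c where c: "c > 0" "\<And>w. w \<in> C \<Longrightarrow> c * norm w \<le> w \<bullet> e"
    using interior_coercive[OF e] by blast
  have "norm (y n) \<le> 1 / c" for n
    using c(2)[of "y n"] c(1) yl(1,2)[of n] interior_mem by (simp add: field_simps)
  then have "\<forall>n. (y n, l n) \<in> cball 0 (1 / c) \<times> {0..K}" using yl(3,4) by (auto intro: less_imp_le)
  moreover have "compact (cball (0::'a) (1 / c) \<times> {0..K})" by (intro compact_Times) auto
  then have "\<forall>f. (\<forall>n. f n \<in> cball (0::'a) (1 / c) \<times> {0..K}) \<longrightarrow>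
      (\<exists>p \<in> cball 0 (1 / c) \<times> {0..K}. \<exists>s::nat\<Rightarrow>nat. strict_mono s \<and> (f \<circ> s) \<longlonglongrightarrow> p)"
    unfolding compact_def .
  ultimately obtain p s where ps: "strict_mono s" "((\<lambda>n. (y n, l n)) \<circ> s) \<longlonglongrightarrow> p"
    by (elim allE[of _ "\<lambda>n. (y n, l n)"]) auto
  define u where "u = fst p"
  define L where "L = snd p"
  have yu: "(\<lambda>n. y (s n)) \<longlonglongrightarrow> u" and lL: "(\<lambda>n. l (s n)) \<longlonglongrightarrow> L"
    unfolding u_def L_def using tendsto_fst[OF ps(2)] tendsto_snd[OF ps(2)] by (simp_all add: o_def)
  have uC: "u \<in> C"
    by (rule Lim_in_closed_set[OF closed_cone _ _ yu]) (simp_all add: interior_mem yl(1))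
  have "(\<lambda>n. y (s n) \<bullet> e) \<longlonglongrightarrow> u \<bullet> e" by (intro tendsto_intros yu)
  then have "u \<bullet> e = 1" by (simp add: yl(2) LIMSEQ_const_iff)
  then have u0: "u \<noteq> 0" by auto
  have s_top: "filterlim (\<lambda>n. real (Suc (s n))) at_top sequentially"
    using filterlim_compose[OF filterlim_real_sequentially
        filterlim_compose[OF filterlim_Suc filterlim_subseq[OF ps(1)]]] .
  have key: "(g * L) *\<^sub>R u \<preceq> T (g *\<^sub>R u + t *\<^sub>R e)" if g: "g > 0" and t: "t > 0" for g t
  proof (rule cle_lim)
    have pint: "u + (t / g) *\<^sub>R e \<in> interior C"
      using interior_add[OF interior_scale[OF e, of "t / g"] uC] g t by (simp add: add.commute)
    obtain d where d: "d > 0" "\<And>v. v \<preceq> (d * norm v) *\<^sub>R e"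
      using interior_order_unit[OF e] by blast
    have "(\<lambda>n. d * norm (y (s n) - u)) \<longlonglongrightarrow> d * norm (u - u)" by (intro tendsto_intros yu)
    then have "(\<lambda>n. d * norm (y (s n) - u)) \<longlonglongrightarrow> 0" by simp
    then have ev1: "eventually (\<lambda>n. d * norm (y (s n) - u) < t / g) sequentially"
      by (rule order_tendstoD(2)) (use g t in simp)
    have ev2: "eventually (\<lambda>n. g \<le> real (Suc (s n))) sequentially"
      using s_top by (simp add: filterlim_at_top)
    show "\<forall>\<^sub>F n in sequentially. (g * l (s n)) *\<^sub>R y (s n) - (g / real (Suc (s n))) *\<^sub>R e \<preceq> T (g *\<^sub>R u + t *\<^sub>R e)"
      using ev1 ev2
    proof eventually_elim
      case (elim n)
      define N where "N = real (Suc (s n))"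
      have N: "N > 0" "g \<le> N" using elim by (auto simp: N_def)
      have "y (s n) - u \<preceq> (t / g) *\<^sub>R e"
        using cle_trans[OF d(2)[of "y (s n) - u"] cle_scale_right[OF interior_mem[OF e]]] elim by simp
      then have "y (s n) \<preceq> u + (t / g) *\<^sub>R e" by (simp add: cone_le_def algebra_simps)
      then have "N *\<^sub>R y (s n) \<preceq> N *\<^sub>R (u + (t / g) *\<^sub>R e)" using N by (intro cle_scale) auto
      also have "N *\<^sub>R (u + (t / g) *\<^sub>R e) = (N / g) *\<^sub>R (g *\<^sub>R u + t *\<^sub>R e)"
        using g by (simp add: algebra_simps)
      finally have "N *\<^sub>R y (s n) \<preceq> (N / g) *\<^sub>R (g *\<^sub>R u + t *\<^sub>R e)" .
      moreover have "g *\<^sub>R u + t *\<^sub>R e \<in> interior C"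
        using interior_scale[OF pint g] g by (simp add: algebra_simps)
      ultimately have "T (N *\<^sub>R y (s n)) \<preceq> (N / g) *\<^sub>R T (g *\<^sub>R u + t *\<^sub>R e)"
        using N g yl(1) by (intro image_le interior_scale) auto
      then have "(g / N) *\<^sub>R T (N *\<^sub>R y (s n)) \<preceq> (g / N) *\<^sub>R (N / g) *\<^sub>R T (g *\<^sub>R u + t *\<^sub>R e)"
        using N g by (intro cle_scale) auto
      moreover have "T (N *\<^sub>R y (s n)) = (l (s n) * N) *\<^sub>R y (s n) - e"
        using yl(5)[of "s n"] unfolding N_def by (simp add: algebra_simps)
      ultimately show ?case using N g unfolding N_def[symmetric] by (simp add: algebra_simps)
    qed
    have "(\<lambda>n. (g * l (s n)) *\<^sub>R y (s n) - (g / real (Suc (s n))) *\<^sub>R e) \<longlonglongrightarrow> (g * L) *\<^sub>R u - 0 *\<^sub>R e"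
      by (intro tendsto_intros yu lL real_tendsto_divide_at_top[OF tendsto_const s_top])
    then show "(\<lambda>n. (g * l (s n)) *\<^sub>R y (s n) - (g / real (Suc (s n))) *\<^sub>R e) \<longlonglongrightarrow> (g * L) *\<^sub>R u"
      by simp
  qed (auto intro: tendsto_const)
  have rad: "(g * L) *\<^sub>R u \<preceq> radial_ext C T (g *\<^sub>R u)" if g: "g > 0" for g
  proof (rule cle_lim[OF tendsto_const radial_ext_limit(2)[OF _ e]])
    show "g *\<^sub>R u \<in> C" using g uC scale_mem by simp
    show "\<forall>\<^sub>F \<epsilon> in at_right 0. (g * L) *\<^sub>R u \<preceq> T (g *\<^sub>R u + \<epsilon> *\<^sub>R e)"
      using key[OF g] by (auto simp: eventually_at_right_field intro!: exI[of _ 1])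
  qed simp
  have "L *\<^sub>R u \<preceq> recession_map C T u"
  proof (rule cle_lim[OF tendsto_const recession_map_limit(2)[OF uC]])
    show "\<forall>\<^sub>F g in at_top. L *\<^sub>R u \<preceq> inverse g *\<^sub>R radial_ext C T (g *\<^sub>R u)"
      using eventually_gt_at_top[of 0]
    proof eventually_elim
      case (elim g)
      have eq: "inverse g *\<^sub>R (g * L) *\<^sub>R u = L *\<^sub>R u" using elim by (simp add: field_simps)
      show ?case using cle_scale[OF rad[OF elim], of "inverse g"] elim unfolding eq by simp
    qed
  qed simp
  moreover have "T (real (Suc (s n)) *\<^sub>R y (s n)) \<preceq> l (s n) *\<^sub>R (real (Suc (s n)) *\<^sub>R y (s n))" for n
    using cle_add_right[OF interior_mem[OF e], of "T (real (Suc (s n)) *\<^sub>R y (s n))"]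
    by (simp only: yl(5) scaleR_scaleR)
  moreover have "real (Suc (s n)) *\<^sub>R y (s n) \<in> interior C" for n
    by (intro interior_scale yl) simp
  ultimately show ?thesis
    using uC u0 lL yl(3)
    by (intro exI[of _ u] exI[of _ L] exI[of _ "\<lambda>n. real (Suc (s n)) *\<^sub>R y (s n)"]
        exI[of _ "\<lambda>n. l (s n)"]) blast
qed

lemma escape_seq_lower_bound:
  assumes x: "x \<in> interior C" and u: "u \<in> C" "u \<noteq> 0" and l: "0 < l"
    and le: "\<And>k. (l ^ k) *\<^sub>R u \<preceq> (T ^^ k) x"
  shows "\<exists>A. \<forall>k\<ge>1. ln l + A / real k \<le> escape_seq C T x k"
proof -
  define a where "a = (x \<bullet> u) / (x \<bullet> x)"
  have a: "a > 0"
    using interior_inner_pos[OF x u] interior_ne_zero[OF x] by (simp add: a_def inner_commute)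
  have "ln l + ln a / real k \<le> escape_seq C T x k" if k: "1 \<le> k" for k
  proof -
    have "l ^ k * a \<le> funk_M C x ((T ^^ k) x)"
      using funk_M_ge[OF x _ _ le[of k]] u l by (simp add: a_def scale_mem)
    then have "ln (l ^ k * a) \<le> RFunk C x ((T ^^ k) x)"
      unfolding RFunk_def using l a by (intro ln_mono) auto
    then have "real k * ln l + ln a \<le> RFunk C x ((T ^^ k) x)"
      using l a by (simp add: ln_mult ln_realpow)
    then have "(real k * ln l + ln a) / real k \<le> RFunk C x ((T ^^ k) x) / real k"
      by (rule divide_right_mono) simp
    then show ?thesis using k by (simp add: escape_seq_def add_divide_distrib)
  qed
  then show ?thesis by blast
qed

lemma escape_seq_upper_bound:
  assumes x: "x \<in> interior C" and y: "y \<in> interior C"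
    and l: "0 < l" "T y \<preceq> l *\<^sub>R y" and hom: "1 \<le> l \<or> pos_homogeneous C T"
  shows "\<exists>B. \<forall>k\<ge>1. escape_seq C T x k \<le> ln l + B / real k"
proof -
  obtain a0 where a0: "a0 > 0" "x \<preceq> a0 *\<^sub>R y" using interior_dominates[OF y] by blast
  define a where "a = max 1 a0"
  have a: "1 \<le> a" "x \<preceq> a *\<^sub>R y"
    using cle_trans[OF a0(2) cle_scale_right[OF interior_mem[OF y]]] by (auto simp: a_def)
  obtain b where b: "b > 0" "y \<preceq> b *\<^sub>R x" using interior_dominates[OF x] by blast
  have "escape_seq C T x k \<le> ln l + ln (a * b) / real k" if k: "1 \<le> k" for k
  proof -
    have "(T ^^ k) x \<preceq> (l ^ k * a) *\<^sub>R y" by (rule funpow_upper_bound[OF x y a(2,1) l hom])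
    also have "\<dots> \<preceq> (l ^ k * a) *\<^sub>R (b *\<^sub>R x)" using l a b by (intro cle_scale) auto
    finally have "funk_M C x ((T ^^ k) x) \<le> l ^ k * (a * b)"
      using l a b by (intro funk_M_le) (auto simp: mult.assoc)
    moreover have "0 < funk_M C x ((T ^^ k) x)"
    proof -
      have Tk: "(T ^^ k) x \<in> interior C" by (rule funpow_interior[OF x])
      have "0 < (x \<bullet> (T ^^ k) x) / (x \<bullet> x)"
        using interior_inner_pos[OF x interior_mem[OF Tk] interior_ne_zero[OF Tk]]
          interior_ne_zero[OF x] by (simp add: inner_commute)
      also have "\<dots> \<le> funk_M C x ((T ^^ k) x)"
        by (rule funk_M_ge[OF x interior_mem[OF Tk] interior_ne_zero[OF Tk] cle_refl])
      finally show ?thesis .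
    qed
    ultimately have "RFunk C x ((T ^^ k) x) \<le> ln (l ^ k * (a * b))"
      unfolding RFunk_def by (intro ln_mono)
    also have "\<dots> = real k * ln l + ln (a * b)"
      using l a b by (simp add: ln_mult_pos ln_realpow)
    finally have "RFunk C x ((T ^^ k) x) / real k \<le> (real k * ln l + ln (a * b)) / real k"
      by (rule divide_right_mono) simp
    then show ?thesis using k by (simp add: escape_seq_def add_divide_distrib)
  qed
  then show ?thesis by blast
qed

lemma le_if_eventually_le_plus_inverse:
  fixes f :: "nat \<Rightarrow> real"
  assumes "f \<longlonglongrightarrow> a" "\<And>k. 1 \<le> k \<Longrightarrow> f k \<le> b + B / real k"
  shows "a \<le> b"
proof -
  have "(\<lambda>k. b + B / real k) \<longlonglongrightarrow> b + 0"
    by (intro tendsto_intros lim_const_over_n)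
  then show ?thesis
    using LIMSEQ_le[OF assms(1)] assms(2) by fastforce
qed

text \<open>The two kinds of inequalities bound \<open>escape_seq C T x k\<close> up to an error \<open>O(1/k)\<close>. The pairs
  \<open>(y n, l n)\<close> and \<open>(u, L)\<close> from \<open>recession_subeigenvector\<close> therefore squeeze the sequence between
  \<open>ln L\<close> and \<open>ln (l n) \<longlonglongrightarrow> ln L\<close>. This needs \<open>L > 0\<close>, which follows from any lower bound on the
  escape sequence: it is bounded if it converges, and if \<open>T\<close> is homogeneous then
  \<open>x \<preceq> c T x\<close> iterates to \<open>x \<preceq> c\<^sup>k T\<^sup>k x\<close>.\<close>

theorem escape_rate_eq:
  assumes x: "x \<in> interior C"
    and cond: "(convergent (escape_seq C T x) \<and> escape_rate C T x > 0) \<or> pos_homogeneous C T"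
  shows "convergent (escape_seq C T x)"
    and "y \<in> interior C \<Longrightarrow> 0 < l \<Longrightarrow> T y \<preceq> l *\<^sub>R y \<Longrightarrow> escape_rate C T x \<le> ln l"
    and "escape_rate C T x < b \<Longrightarrow> \<exists>y\<in>interior C. \<exists>l>0. T y \<preceq> l *\<^sub>R y \<and> ln l < b"
    and "u \<in> C \<Longrightarrow> u \<noteq> 0 \<Longrightarrow> 0 < l \<Longrightarrow> l *\<^sub>R u \<preceq> recession_map C T u \<Longrightarrow> ln l \<le> escape_rate C T x"
    and "\<exists>u\<in>C - {0}. exp (escape_rate C T x) *\<^sub>R u \<preceq> recession_map C T u"
proof -
  have upper: "\<exists>B. \<forall>k\<ge>1. escape_seq C T x k \<le> ln l + B / real k"
    if y: "y \<in> interior C" and l: "0 < l" "T y \<preceq> l *\<^sub>R y" for y l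
  proof -
    have "1 \<le> l \<or> pos_homogeneous C T"
    proof (rule disjCI, rule ccontr)
      \<comment> \<open>If \<open>l < 1\<close>, then \<open>T y \<preceq> y\<close>, the orbit stays bounded and the escape rate cannot be positive.\<close>
      assume "\<not> pos_homogeneous C T" "\<not> 1 \<le> l"
      then have lim: "escape_seq C T x \<longlonglongrightarrow> escape_rate C T x" "escape_rate C T x > 0"
        using cond by (auto simp: escape_rate_def convergent_LIMSEQ_iff)
      have "T y \<preceq> 1 *\<^sub>R y"
        by (rule cle_trans[OF l(2) cle_scale_right[OF interior_mem[OF y]]])
           (use \<open>\<not> 1 \<le> l\<close> in simp)
      then obtain B where "\<And>k. 1 \<le> k \<Longrightarrow> escape_seq C T x k \<le> ln 1 + B / real k"
        using escape_seq_upper_bound[OF x y, of 1] by (simp only: scaleR_one) auto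
      then have "escape_rate C T x \<le> ln 1" by (rule le_if_eventually_le_plus_inverse[OF lim(1)])
      then show False using lim(2) by simp
    qed
    then show ?thesis by (rule escape_seq_upper_bound[OF x y l])
  qed
  have lower: "\<exists>A. \<forall>k\<ge>1. ln l + A / real k \<le> escape_seq C T x k"
    if u: "u \<in> C" "u \<noteq> 0" and l: "0 < l" "l *\<^sub>R u \<preceq> recession_map C T u" for u l
  proof -
    obtain c where c: "c > 0" "u \<preceq> c *\<^sub>R x" using interior_dominates[OF x] by blast
    have "(1 / c) *\<^sub>R u \<preceq> x" using cle_scale[OF c(2), of "1 / c"] c(1) by simp
    then have "\<And>k. (l ^ k) *\<^sub>R ((1 / c) *\<^sub>R u) \<preceq> (T ^^ k) x"
      using funpow_lower_bound[OF x u(1) _ _ l, of "1 / c"] c(1) by simp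
    moreover have "(1 / c) *\<^sub>R u \<in> C" "(1 / c) *\<^sub>R u \<noteq> 0"
      using u c(1) by (auto intro: scale_mem)
    ultimately show ?thesis using escape_seq_lower_bound[OF x _ _ l(1)] by blast
  qed
  \<comment> \<open>Any lower bound on the escape sequence keeps the \<open>l n\<close> away from \<open>0\<close>.\<close>
  have bounded_below: "\<exists>m. \<forall>k\<ge>1. m \<le> escape_seq C T x k"
    using cond
  proof
    assume "convergent (escape_seq C T x) \<and> escape_rate C T x > 0"
    then have "Bseq (escape_seq C T x)" using convergent_imp_Bseq by blast
    then obtain K where "\<And>k. norm (escape_seq C T x k) \<le> K" using BseqE by metis
    then have "- K \<le> escape_seq C T x k" for k by (smt (verit) real_norm_def)
    then show ?thesis by blast
  next
    assume hom: "pos_homogeneous C T"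
    obtain c where c: "c > 0" "x \<preceq> c *\<^sub>R T x" using interior_dominates[OF maps_interior[OF x]] by blast
    have d: "(1 / c) *\<^sub>R x \<preceq> T x" using cle_scale[OF c(2), of "1 / c"] c(1) by simp
    have "((1 / c) ^ k) *\<^sub>R x \<preceq> (T ^^ k) x" for k
    proof (induction k)
      case 0 show ?case by (simp add: cle_refl)
    next
      case (Suc k)
      have pos: "(1 / c) ^ k > 0" using c by simp
      have "((1 / c) ^ Suc k) *\<^sub>R x = ((1 / c) ^ k) *\<^sub>R ((1 / c) *\<^sub>R x)" by simp
      also have "\<dots> \<preceq> ((1 / c) ^ k) *\<^sub>R T x" using pos d by (intro cle_scale) auto
      also have "\<dots> = T (((1 / c) ^ k) *\<^sub>R x)" using hom x pos by (simp add: pos_homogeneous_def)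
      also have "\<dots> \<preceq> T ((T ^^ k) x)"
        by (intro image_mono interior_scale x funpow_interior Suc.IH pos)
      finally show ?case by simp
    qed
    then obtain A where A: "\<And>k. 1 \<le> k \<Longrightarrow> ln (1 / c) + A / real k \<le> escape_seq C T x k"
      using escape_seq_lower_bound[OF x interior_mem[OF x] interior_ne_zero[OF x], of "1 / c"] c by auto
    have "ln (1 / c) - \<bar>A\<bar> \<le> escape_seq C T x k" if k: "1 \<le> k" for k
    proof -
      have "\<bar>A\<bar> / real k \<le> \<bar>A\<bar> / 1" using k by (intro divide_left_mono) auto
      moreover have "- (\<bar>A\<bar> / real k) \<le> A / real k"
        using k by (simp add: field_simps)
      ultimately show ?thesis using A[OF k] by linarith
    qed
    then show ?thesis by blast
  qed
  then obtain m where m: "\<And>k. 1 \<le> k \<Longrightarrow> m \<le> escape_seq C T x k" by blast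
  obtain u L y and l :: "nat \<Rightarrow> real" where u: "u \<in> C" "u \<noteq> 0" "L *\<^sub>R u \<preceq> recession_map C T u" and lim: "l \<longlonglongrightarrow> L"
    and yl: "\<And>n. y n \<in> interior C" "\<And>n. 0 < l n" "\<And>n. T (y n) \<preceq> l n *\<^sub>R y n"
    using recession_subeigenvector by blast
  have "exp m \<le> l n" for n
  proof -
    obtain B where "\<forall>k\<ge>1. escape_seq C T x k \<le> ln (l n) + B / real k" using upper[OF yl] by blast
    then have "\<And>k. 1 \<le> k \<Longrightarrow> m \<le> ln (l n) + B / real k" using m order_trans by blast
    then have "m \<le> ln (l n)" by (rule le_if_eventually_le_plus_inverse[OF tendsto_const])
    then show ?thesis using yl(2)[of n] by (metis exp_le_cancel_iff exp_ln)
  qed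
  then have "exp m \<le> L" using LIMSEQ_le_const[OF lim] by blast
  then have L: "0 < L" using exp_gt_zero[of m] by linarith
  have lnl: "(\<lambda>n. ln (l n)) \<longlonglongrightarrow> ln L" using lim L by (intro tendsto_intros) auto
  have conv: "escape_seq C T x \<longlonglongrightarrow> ln L"
  proof (rule order_tendstoI)
    fix a assume a: "a < ln L"
    obtain A where A: "\<And>k. 1 \<le> k \<Longrightarrow> ln L + A / real k \<le> escape_seq C T x k"
      using lower[OF u(1,2) L u(3)] by blast
    have "(\<lambda>k. ln L + A / real k) \<longlonglongrightarrow> ln L + 0" by (intro tendsto_intros lim_const_over_n)
    then have "\<forall>\<^sub>F k in sequentially. a < ln L + A / real k" using a by (intro order_tendstoD(1)) auto
    then show "\<forall>\<^sub>F k in sequentially. a < escape_seq C T x k"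
      using eventually_ge_at_top[of 1] by eventually_elim (use A in \<open>force intro: less_le_trans\<close>)
  next
    fix b assume b: "ln L < b"
    then obtain n where n: "ln (l n) < b"
      using eventually_happens'[OF sequentially_bot order_tendstoD(2)[OF lnl b]] by blast
    obtain B where B: "\<And>k. 1 \<le> k \<Longrightarrow> escape_seq C T x k \<le> ln (l n) + B / real k"
      using upper[OF yl] by blast
    have "(\<lambda>k. ln (l n) + B / real k) \<longlonglongrightarrow> ln (l n) + 0" by (intro tendsto_intros lim_const_over_n)
    then have "\<forall>\<^sub>F k in sequentially. ln (l n) + B / real k < b" using n by (intro order_tendstoD(2)) auto
    then show "\<forall>\<^sub>F k in sequentially. escape_seq C T x k < b"
      using eventually_ge_at_top[of 1] by eventually_elim (use B in \<open>force intro: le_less_trans\<close>)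
  qed
  then show "convergent (escape_seq C T x)" using convergent_def by blast
  have rate: "escape_rate C T x = ln L" unfolding escape_rate_def using conv by (rule limI)
  show "escape_rate C T x \<le> ln l" if "y \<in> interior C" "0 < l" "T y \<preceq> l *\<^sub>R y" for y l
    using upper[OF that] le_if_eventually_le_plus_inverse[OF conv] rate by metis
  show "\<exists>y\<in>interior C. \<exists>l>0. T y \<preceq> l *\<^sub>R y \<and> ln l < b" if "escape_rate C T x < b" for b
  proof -
    have "\<forall>\<^sub>F n in sequentially. ln (l n) < b"
      using order_tendstoD(2)[OF lnl] that rate by simp
    then obtain n where "ln (l n) < b"
      using eventually_happens'[OF sequentially_bot] by blast
    then show ?thesis using yl(1,3) yl(2)[of n] by (intro bexI[of _ "y n"] exI[of _ "l n"]) auto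
  qed
  show "ln l \<le> escape_rate C T x"
    if u': "u \<in> C" "u \<noteq> 0" "0 < l" "l *\<^sub>R u \<preceq> recession_map C T u" for u l
  proof -
    obtain A where A: "\<And>k. 1 \<le> k \<Longrightarrow> ln l + A / real k \<le> escape_seq C T x k"
      using lower[OF u'] by blast
    have "- escape_seq C T x k \<le> - ln l + (- A) / real k" if "1 \<le> k" for k
      using A[OF that] by simp
    from le_if_eventually_le_plus_inverse[OF tendsto_minus[OF conv] this]
    show ?thesis using rate by simp
  qed
  show "\<exists>u\<in>C - {0}. exp (escape_rate C T x) *\<^sub>R u \<preceq> recession_map C T u"
    using u L rate by (intro bexI[of _ u]) auto
qed

end

section \<open>Integration against decaying exponentials\<close>

lemma nn_integral_lborel_translate:
  fixes h :: "'a::euclidean_space \<Rightarrow> ennreal"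
  assumes [measurable]: "h \<in> borel_measurable borel"
  shows "(\<integral>\<^sup>+z. h (c + z) \<partial>lborel) = (\<integral>\<^sup>+z. h z \<partial>lborel)"
  by (subst (2) lborel_distr_plus [symmetric, of c]) (simp add: nn_integral_distr)

lemma nn_integral_lborel_reflect:
  fixes h :: "'a::euclidean_space \<Rightarrow> ennreal"
  assumes [measurable]: "h \<in> borel_measurable borel"
  shows "(\<integral>\<^sup>+z. h (c - z) \<partial>lborel) = (\<integral>\<^sup>+z. h z \<partial>lborel)"
  by (subst (2) lborel_affine [of "-1" c]) (simp_all add: nn_integral_distr nn_integral_density)

text \<open>A linear change of variables multiplies all integrals by the same factor. As in the proof that a
  translation invariant measure is unique, this follows by shifting and exchanging the two
  integrals in \<open>\<integral>\<integral> f (A y) h (z + A y)\<close>.\<close>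

lemma nn_integral_linear_proportional:
  fixes A :: "'a::euclidean_space \<Rightarrow> 'a"
  assumes A: "linear A" "surj A"
    and [measurable]: "f \<in> borel_measurable borel" "h \<in> borel_measurable borel"
  shows "(\<integral>\<^sup>+y. f (A y) \<partial>lborel) * (\<integral>\<^sup>+z. h z \<partial>lborel) =
         (\<integral>\<^sup>+y. h (A y) \<partial>lborel) * (\<integral>\<^sup>+z. f z \<partial>lborel)"
proof -
  have [measurable]: "A \<in> borel_measurable borel"
    using A(1) by (intro borel_measurable_continuous_onI linear_continuous_on linear_conv_bounded_linear[THEN iffD1])
  obtain B where B: "\<And>z. A (B z) = z" using A(2) by (metis surj_def)
  have eq: "(\<integral>\<^sup>+y. f (A y) * h (z + A y) \<partial>lborel) = (\<integral>\<^sup>+y. f (A y - z) * h (A y) \<partial>lborel)" for z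
  proof -
    have "(\<integral>\<^sup>+y. f (A (- B z + y)) * h (z + A (- B z + y)) \<partial>lborel) = (\<integral>\<^sup>+y. f (A y) * h (z + A y) \<partial>lborel)"
      by (rule nn_integral_lborel_translate) measurable
    then show ?thesis by (simp add: B linear_diff[OF A(1)])
  qed
  have "(\<integral>\<^sup>+y. f (A y) \<partial>lborel) * (\<integral>\<^sup>+z. h z \<partial>lborel) =
      (\<integral>\<^sup>+y. \<integral>\<^sup>+z. f (A y) * h (A y + z) \<partial>lborel \<partial>lborel)"
    by (simp add: nn_integral_cmult nn_integral_multc nn_integral_lborel_translate)
  also have "\<dots> = (\<integral>\<^sup>+y. \<integral>\<^sup>+z. f (A y) * h (z + A y) \<partial>lborel \<partial>lborel)"
    by (simp add: add.commute)
  also have "\<dots> = (\<integral>\<^sup>+z. \<integral>\<^sup>+y. f (A y) * h (z + A y) \<partial>lborel \<partial>lborel)"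
    by (rule lborel_pair.Fubini') measurable
  also have "\<dots> = (\<integral>\<^sup>+z. \<integral>\<^sup>+y. f (A y - z) * h (A y) \<partial>lborel \<partial>lborel)"
    by (simp only: eq)
  also have "\<dots> = (\<integral>\<^sup>+y. \<integral>\<^sup>+z. f (A y - z) * h (A y) \<partial>lborel \<partial>lborel)"
    by (rule lborel_pair.Fubini') measurable
  also have "\<dots> = (\<integral>\<^sup>+y. h (A y) \<partial>lborel) * (\<integral>\<^sup>+z. f z \<partial>lborel)"
    by (simp add: nn_integral_cmult nn_integral_multc nn_integral_lborel_reflect mult.commute)
  finally show ?thesis .
qed

lemma nn_integral_exp_abs_finite:
  assumes d: "d > 0"
  shows "(\<integral>\<^sup>+t. ennreal (exp (- (d * \<bar>t\<bar>))) \<partial>lborel) < \<infinity>"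
proof -
  have tail: "(\<integral>\<^sup>+t. ennreal (exp (- (d * t))) * indicator {0..} t \<partial>lborel) = ennreal (0 - (- exp (- (d * 0)) / d))"
  proof (rule nn_integral_FTC_atLeast)
    show "((\<lambda>t. - exp (- (d * t)) / d) has_real_derivative exp (- (d * t))) (at t)" if "0 \<le> t" for t
      using d by (auto intro!: derivative_eq_intros)
    have "filterlim (\<lambda>t. d * t) at_top at_top"
      by (rule filterlim_tendsto_pos_mult_at_top[OF tendsto_const d filterlim_ident])
    then have "filterlim (\<lambda>t. - (d * t)) at_bot at_top" by (simp add: filterlim_uminus_at_bot)
    then have lim: "((\<lambda>t. exp (- (d * t))) \<longlongrightarrow> 0) at_top"
      by (rule filterlim_compose[OF exp_at_bot])
    have "((\<lambda>t. - exp (- (d * t)) / d) \<longlongrightarrow> - 0 / d) at_top"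
      using d by (intro tendsto_intros lim) auto
    then show "((\<lambda>t. - exp (- (d * t)) / d) \<longlongrightarrow> 0) at_top" by simp
  qed auto
  have "(\<integral>\<^sup>+t. ennreal (exp (- (d * \<bar>t\<bar>))) \<partial>lborel) \<le>
      (\<integral>\<^sup>+t. ennreal (exp (- (d * t))) * indicator {0..} t +
         ennreal (exp (- (d * (0 - t)))) * indicator {0..} (0 - t) \<partial>lborel)"
    by (intro nn_integral_mono) (auto simp: indicator_def)
  also have "\<dots> = (\<integral>\<^sup>+t. ennreal (exp (- (d * t))) * indicator {0..} t \<partial>lborel) +
      (\<integral>\<^sup>+t. ennreal (exp (- (d * (0 - t)))) * indicator {0..} (0 - t) \<partial>lborel)"
    by (intro nn_integral_add) auto
  also have "(\<integral>\<^sup>+t. ennreal (exp (- (d * (0 - t)))) * indicator {0..} (0 - t) \<partial>lborel) =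
      (\<integral>\<^sup>+t. ennreal (exp (- (d * t))) * indicator {0..} t \<partial>lborel)"
    by (rule nn_integral_lborel_reflect[where h = "\<lambda>t. ennreal (exp (- (d * t))) * indicator {0..} t" and c = 0]) measurable
  finally show ?thesis unfolding tail by (simp add: ennreal_plus[symmetric] le_less_trans del: ennreal_plus)
qed

text \<open>The exponential of the norm is dominated by a product of one-variable exponentials, because the
  \<open>l\<^sup>1\<close>-norm is at most \<open>DIM('a)\<close> times the Euclidean norm.\<close>

lemma integrable_exp_norm:
  assumes a: "a > 0"
  shows "integrable lborel (\<lambda>y::'a::euclidean_space. exp (- (a * norm y)))"
proof (rule integrableI_bounded)
  define d where "d = a / DIM('a)"
  have d: "d > 0" using a by (simp add: d_def)
  have le: "exp (- (a * norm y)) \<le> (\<Prod>b\<in>Basis. exp (- (d * \<bar>y \<bullet> b\<bar>)))" for y :: 'a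
  proof -
    have "(\<Sum>b\<in>Basis. \<bar>y \<bullet> b\<bar>) \<le> (\<Sum>b\<in>(Basis::'a set). norm y)"
      by (intro sum_mono Basis_le_norm)
    then have "d * (\<Sum>b\<in>Basis. \<bar>y \<bullet> b\<bar>) \<le> a * norm y"
      using mult_left_mono[of _ _ d] d by (fastforce simp: d_def)
    then show ?thesis by (simp add: exp_sum[symmetric] sum_negf sum_distrib_left)
  qed
  have "(\<integral>\<^sup>+y. ennreal (norm (exp (- (a * norm (y::'a))))) \<partial>lborel) \<le>
      (\<integral>\<^sup>+y. (\<Prod>b\<in>(Basis::'a set). ennreal (exp (- (d * \<bar>y \<bullet> b\<bar>)))) \<partial>lborel)"
    by (intro nn_integral_mono) (simp add: prod_ennreal ennreal_leI le)
  also have "\<dots> = (\<Prod>b\<in>(Basis::'a set). (\<integral>\<^sup>+t. ennreal (exp (- (d * \<bar>t\<bar>))) \<partial>lborel))"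
    by (subst nn_integral_lborel_prod) auto
  also have "\<dots> < \<infinity>"
    using nn_integral_exp_abs_finite[OF d] by (simp add: power_less_top_ennreal)
  finally show "(\<integral>\<^sup>+y. ennreal (norm (exp (- (a * norm (y::'a))))) \<partial>lborel) < \<infinity>" .
qed measurable

definition tempered :: "('a::euclidean_space \<Rightarrow> 'b::euclidean_space) \<Rightarrow> bool" where
  "tempered p \<longleftrightarrow> p \<in> borel_measurable borel \<and> (\<exists>B m. \<forall>y. norm (p y) \<le> B * (1 + norm y) ^ m)"

lemma tempered_measurable: "tempered p \<Longrightarrow> p \<in> borel_measurable borel"
  by (simp add: tempered_def)

lemma tempered_exp_bound:
  assumes p: "tempered p" and a: "a > 0"
  obtains K where "K \<ge> 0" "\<And>y. norm (p y) * exp (- (a * norm y)) \<le> K * exp (- (a / 2 * norm y))"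
proof -
  obtain B m where B: "\<And>y. norm (p y) \<le> B * (1 + norm y) ^ m" using p by (auto simp: tempered_def)
  \<comment> \<open>Chosen such that \<open>b (1 + r) \<le> exp (b r)\<close> and \<open>m b \<le> a / 2\<close>.\<close>
  define b where "b = min 1 (a / (2 * (real m + 1)))"
  have b: "0 < b" "b \<le> 1" "real m * b \<le> a / 2"
  proof -
    show "0 < b" "b \<le> 1" using a by (auto simp: b_def)
    have "real m * b \<le> real m * (a / (2 * (real m + 1)))" by (intro mult_left_mono) (auto simp: b_def)
    also have "\<dots> \<le> a / 2" using a by (simp add: field_simps)
    finally show "real m * b \<le> a / 2" .
  qed
  have B0: "0 \<le> B" using order_trans[OF norm_ge_zero B[of 0]] by simp
  have "norm (p y) * exp (- (a * norm y)) \<le> (B / b ^ m) * exp (- (a / 2 * norm y))" for y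
  proof -
    have "b * (1 + norm y) \<le> 1 + b * norm y" using b by (simp add: distrib_left)
    also have "\<dots> \<le> exp (b * norm y)" by (rule exp_ge_add_one_self)
    finally have "1 + norm y \<le> exp (b * norm y) / b" using b by (simp add: field_simps)
    then have "(1 + norm y) ^ m \<le> (exp (b * norm y) / b) ^ m" by (intro power_mono) auto
    also have "\<dots> = exp (real m * b * norm y) / b ^ m"
      by (simp add: power_divide exp_of_nat_mult[symmetric] mult.assoc)
    also have "\<dots> \<le> exp (a / 2 * norm y) / b ^ m"
      using b mult_right_mono[OF b(3), of "norm y"] by (intro divide_right_mono) auto
    finally have "B * (1 + norm y) ^ m \<le> B * (exp (a / 2 * norm y) / b ^ m)"
      using B0 by (intro mult_left_mono)
    then have "norm (p y) * exp (- (a * norm y)) \<le> B * (exp (a / 2 * norm y) / b ^ m) * exp (- (a * norm y))"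
      using B[of y] by (intro mult_right_mono) auto
    also have "\<dots> = (B / b ^ m) * exp (- (a / 2 * norm y))"
      by (simp add: exp_add[symmetric])
    finally show ?thesis .
  qed
  moreover have "0 \<le> B / b ^ m" using B0 b by simp
  ultimately show ?thesis using that by blast
qed

lemma tempered_integrable:
  assumes "tempered p" "a > 0"
  shows "integrable lborel (\<lambda>y. norm (p y) * exp (- (a * norm y)))"
proof -
  note [measurable] = tempered_measurable[OF assms(1)]
  obtain K where K: "K \<ge> 0" "\<And>y. norm (p y) * exp (- (a * norm y)) \<le> K * exp (- (a / 2 * norm y))"
    using tempered_exp_bound[OF assms] by blast
  show ?thesis
  proof (rule Bochner_Integration.integrable_bound)
    show "integrable lborel (\<lambda>y::'a. K * exp (- (a / 2 * norm y)))"
      using assms(2) by (intro integrable_mult_right integrable_exp_norm) auto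
    show "AE y in lborel. norm (norm (p y) * exp (- (a * norm y))) \<le> norm (K * exp (- (a / 2 * norm y)))"
      using K by (intro AE_I2) simp
  qed measurable
qed

lemma tempered_const: "tempered (\<lambda>_. c)"
  unfolding tempered_def by (intro conjI exI[of _ "norm c"] exI[of _ 0]; simp)

lemma tempered_id: "tempered (\<lambda>y. y)"
  unfolding tempered_def by (auto intro!: exI[of _ 1])

lemma tempered_inner: "tempered (\<lambda>y. y \<bullet> h)"
proof -
  have "norm (y \<bullet> h) \<le> norm h * (1 + norm y) ^ 1" for y
    using Cauchy_Schwarz_ineq2[of y h] by (simp add: distrib_left mult.commute add_increasing)
  then show ?thesis unfolding tempered_def by (intro conjI exI allI) measurable
qed

lemma tempered_add:
  assumes "tempered p" "tempered q" shows "tempered (\<lambda>y. p y + q y)"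
proof -
  note [measurable] = tempered_measurable[OF assms(1)] tempered_measurable[OF assms(2)]
  obtain B m where B: "\<And>y. norm (p y) \<le> B * (1 + norm y) ^ m" using assms(1) by (auto simp: tempered_def)
  obtain B' m' where B': "\<And>y. norm (q y) \<le> B' * (1 + norm y) ^ m'" using assms(2) by (auto simp: tempered_def)
  have pos: "0 \<le> B" "0 \<le> B'"
    using order_trans[OF norm_ge_zero B[of 0]] order_trans[OF norm_ge_zero B'[of 0]] by simp_all
  have "norm (p y + q y) \<le> (B + B') * (1 + norm y) ^ (m + m')" for y
  proof -
    have "B * (1 + norm y) ^ m \<le> B * (1 + norm y) ^ (m + m')"
         "B' * (1 + norm y) ^ m' \<le> B' * (1 + norm y) ^ (m + m')"
      using pos by (intro mult_left_mono power_increasing; simp)+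
    then show ?thesis
      using norm_triangle_ineq[of "p y" "q y"] B[of y] B'[of y] unfolding distrib_right by linarith
  qed
  then show ?thesis unfolding tempered_def by (intro conjI exI allI) measurable
qed

lemma tempered_scale:
  assumes "tempered p" shows "tempered (\<lambda>y. (y \<bullet> h) *\<^sub>R p y)"
proof -
  note [measurable] = tempered_measurable[OF assms(1)]
  obtain B m where B: "\<And>y. norm (p y) \<le> B * (1 + norm y) ^ m" using assms by (auto simp: tempered_def)
  have "norm ((y \<bullet> h) *\<^sub>R p y) \<le> (norm h * B) * (1 + norm y) ^ Suc m" for y
  proof -
    have "\<bar>y \<bullet> h\<bar> \<le> norm h * (1 + norm y)"
      using Cauchy_Schwarz_ineq2[of y h] by (simp add: distrib_left mult.commute add_increasing)
    then have "\<bar>y \<bullet> h\<bar> * norm (p y) \<le> (norm h * (1 + norm y)) * (B * (1 + norm y) ^ m)"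
      by (intro mult_mono B) auto
    then show ?thesis by (simp add: mult_ac)
  qed
  then show ?thesis unfolding tempered_def by (intro conjI exI allI) measurable
qed

lemma tempered_norm_square:
  assumes "tempered p" shows "tempered (\<lambda>y. (norm y)\<^sup>2 *\<^sub>R p y)"
proof -
  note [measurable] = tempered_measurable[OF assms(1)]
  obtain B m where B: "\<And>y. norm (p y) \<le> B * (1 + norm y) ^ m" using assms by (auto simp: tempered_def)
  have "norm ((norm y)\<^sup>2 *\<^sub>R p y) \<le> B * (1 + norm y) ^ (2 + m)" for y
  proof -
    have "(norm y)\<^sup>2 * norm (p y) \<le> (1 + norm y)\<^sup>2 * (B * (1 + norm y) ^ m)"
      by (intro mult_mono B power_mono) auto
    then show ?thesis unfolding power_add by (simp add: mult_ac)
  qed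
  then show ?thesis unfolding tempered_def by (intro conjI exI allI) measurable
qed

lemma abs_exp_taylor_le: "\<bar>exp t - 1 - t\<bar> \<le> t\<^sup>2 * exp \<bar>t :: real\<bar>"
proof -
  obtain s where s: "\<bar>s\<bar> \<le> \<bar>t\<bar>" "exp t = (\<Sum>m<2. t ^ m / fact m) + exp s / fact 2 * t ^ 2"
    using Maclaurin_exp_le[of t 2] by blast
  have "exp t - 1 - t = exp s / 2 * t\<^sup>2" using s(2) by (simp add: numeral_2_eq_2)
  then have "\<bar>exp t - 1 - t\<bar> = exp s / 2 * t\<^sup>2" by (simp only: abs_mult) simp
  also have "\<dots> \<le> exp \<bar>t\<bar> * t\<^sup>2"
  proof (intro mult_right_mono)
    have "exp s / 2 \<le> exp s" by simp
    also have "\<dots> \<le> exp \<bar>t\<bar>" using s(1) by simp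
    finally show "exp s / 2 \<le> exp \<bar>t\<bar>" .
  qed simp
  finally show ?thesis by (simp add: mult.commute)
qed

section \<open>The characteristic function of the cone\<close>

context self_dual_cone
begin

text \<open>The Laplace transform of \<open>p\<close> restricted to \<open>C\<close>. One vector-valued definition covers the
  characteristic function (\<open>p = 1\<close>), its negative gradient (\<open>p = id\<close>) and the second moments.\<close>

definition laplace :: "('a \<Rightarrow> 'b::euclidean_space) \<Rightarrow> 'a \<Rightarrow> 'b" where
  "laplace p x = (\<integral>y. (indicator C y * exp (- (x \<bullet> y))) *\<^sub>R p y \<partial>lborel)"

lemma cone_measurable [measurable]: "C \<in> sets borel"
  by (rule borel_closed[OF closed_cone])

lemma laplace_integrable:
  assumes x: "x \<in> interior C" and p: "tempered p"
  shows "integrable lborel (\<lambda>y. (indicator C y * exp (- (x \<bullet> y))) *\<^sub>R p y)"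
proof -
  note [measurable] = tempered_measurable[OF p]
  obtain c where c: "c > 0" "\<And>w. w \<in> C \<Longrightarrow> c * norm w \<le> w \<bullet> x"
    using interior_coercive[OF x] by blast
  show ?thesis
  proof (rule Bochner_Integration.integrable_bound[OF tempered_integrable[OF p c(1)]])
    have "norm ((indicator C y * exp (- (x \<bullet> y))) *\<^sub>R p y) \<le> norm (p y) * exp (- (c * norm y))" for y
      using c(2)[of y] by (auto simp: indicator_def inner_commute mult.commute[of "norm (p y)"] intro!: mult_right_mono)
    then show "AE y in lborel. norm ((indicator C y * exp (- (x \<bullet> y))) *\<^sub>R p y)
        \<le> norm (norm (p y) * exp (- (c * norm y)))"
      by (intro AE_I2) simp
  qed measurable
qed

lemma laplace_add:
  assumes "x \<in> interior C" "tempered p" "tempered q"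
  shows "laplace (\<lambda>y. p y + q y) x = laplace p x + laplace q x"
  unfolding laplace_def
  by (subst Bochner_Integration.integral_add[symmetric]) (simp_all add: laplace_integrable assms scaleR_add_right)

lemma laplace_scaleR: "laplace (\<lambda>y. c *\<^sub>R p y) x = c *\<^sub>R laplace p x"
  unfolding laplace_def
  by (subst Bochner_Integration.integral_scaleR_right[symmetric]) (simp add: mult_ac)

lemma laplace_inner:
  assumes "x \<in> interior C" "tempered p"
  shows "laplace p x \<bullet> h = laplace (\<lambda>y. p y \<bullet> h) x"
  unfolding laplace_def
  by (subst integral_inner_left[symmetric]) (simp_all add: laplace_integrable assms)

lemma laplace_mono:
  fixes p q :: "'a \<Rightarrow> real"
  assumes "x \<in> interior C" "tempered p" "tempered q" "\<And>y. y \<in> C \<Longrightarrow> p y \<le> q y"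
  shows "laplace p x \<le> laplace q x"
  unfolding laplace_def
  by (rule integral_mono[OF laplace_integrable laplace_integrable])
     (use assms in \<open>auto simp: indicator_def\<close>)

text \<open>Near \<open>x\<close>, the second order Taylor remainder of the exponential is at most
  \<open>|h|\<^sup>2 |y|\<^sup>2 |p y| exp (- c |y| / 2)\<close> on \<open>C\<close>, where \<open>c |y| \<le> \<langle>x, y\<rangle>\<close>; the halved exponent absorbs
  \<open>|h| \<le> c / 2\<close>. This majorant is integrable.\<close>

lemma laplace_has_derivative:
  fixes p :: "'a \<Rightarrow> 'b::euclidean_space"
  assumes x: "x \<in> interior C" and p: "tempered p"
  shows "(laplace p has_derivative (\<lambda>h. - laplace (\<lambda>y. (y \<bullet> h) *\<^sub>R p y) x)) (at x)"
proof -
  note [measurable] = tempered_measurable[OF p]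
  obtain c where c: "c > 0" "\<And>w. w \<in> C \<Longrightarrow> c * norm w \<le> w \<bullet> x"
    using interior_coercive[OF x] by blast
  define J where "J = (\<integral>y. norm ((norm y)\<^sup>2 *\<^sub>R p y) * exp (- (c / 2 * norm y)) \<partial>lborel)"
  have Jint: "integrable lborel (\<lambda>y. norm ((norm y)\<^sup>2 *\<^sub>R p y) * exp (- (c / 2 * norm y)))"
    using c(1) by (intro tempered_integrable tempered_norm_square p) auto
  have J0: "0 \<le> J" unfolding J_def by (intro integral_nonneg_AE) auto
  obtain d where d: "d > 0" "ball x d \<subseteq> interior C" using x open_contains_ball by blast
  have est: "norm (laplace p (x + h) - laplace p x + laplace (\<lambda>y. (y \<bullet> h) *\<^sub>R p y) x) \<le> (norm h)\<^sup>2 * J"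
    if h: "norm h < d" "norm h \<le> c / 2" for h
  proof -
    have xh: "x + h \<in> interior C" using h d by (auto simp: dist_norm)
    let ?R = "\<lambda>y. (indicator C y * exp (- ((x + h) \<bullet> y))) *\<^sub>R p y - (indicator C y * exp (- (x \<bullet> y))) *\<^sub>R p y
        + (indicator C y * exp (- (x \<bullet> y))) *\<^sub>R (y \<bullet> h) *\<^sub>R p y"
    note int = laplace_integrable[OF xh p] laplace_integrable[OF x p]
      laplace_integrable[OF x tempered_scale[OF p, of h]]
    have "laplace p (x + h) - laplace p x + laplace (\<lambda>y. (y \<bullet> h) *\<^sub>R p y) x = (\<integral>y. ?R y \<partial>lborel)"
      unfolding laplace_def
      by (simp only: Bochner_Integration.integral_add[OF Bochner_Integration.integrable_diff[OF int(1,2)] int(3)]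
          Bochner_Integration.integral_diff[OF int(1,2)])
    also have "norm \<dots> \<le> (\<integral>y. (norm h)\<^sup>2 * (norm ((norm y)\<^sup>2 *\<^sub>R p y) * exp (- (c / 2 * norm y))) \<partial>lborel)"
    proof (rule Bochner_Integration.integral_norm_bound_integral)
      show "integrable lborel ?R"
        by (intro Bochner_Integration.integrable_add Bochner_Integration.integrable_diff int)
      show "integrable lborel (\<lambda>y. (norm h)\<^sup>2 * (norm ((norm y)\<^sup>2 *\<^sub>R p y) * exp (- (c / 2 * norm y))))"
        by (intro integrable_mult_right Jint)
      fix y
      show "norm (?R y) \<le> (norm h)\<^sup>2 * (norm ((norm y)\<^sup>2 *\<^sub>R p y) * exp (- (c / 2 * norm y)))"
      proof (cases "y \<in> C")
        case True
        define t where "t = - (h \<bullet> y)"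
        have t: "\<bar>t\<bar> \<le> norm h * norm y" using Cauchy_Schwarz_ineq2[of h y] by (simp add: t_def)
        have "?R y = (exp (- (x \<bullet> y)) * (exp t - 1 - t)) *\<^sub>R p y"
        proof -
          have "exp (- ((x + h) \<bullet> y)) = exp (- (x \<bullet> y)) * exp t"
            by (simp add: t_def inner_add_left exp_add[symmetric])
          then show ?thesis using True by (simp add: t_def inner_commute[of y h] algebra_simps)
        qed
        then have "norm (?R y) = exp (- (x \<bullet> y)) * \<bar>exp t - 1 - t\<bar> * norm (p y)"
          by (simp add: abs_mult)
        also have "\<dots> \<le> exp (- (c * norm y)) * ((norm h * norm y)\<^sup>2 * exp (c / 2 * norm y)) * norm (p y)"
        proof (intro mult_right_mono mult_mono)
          show "exp (- (x \<bullet> y)) \<le> exp (- (c * norm y))" using c(2)[OF True] by (simp add: inner_commute)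
          have "t\<^sup>2 \<le> (norm h * norm y)\<^sup>2"
            using power_mono[OF t abs_ge_zero, of 2] by simp
          moreover have "\<bar>t\<bar> \<le> c / 2 * norm y"
            using t mult_right_mono[OF h(2) norm_ge_zero[of y]] by linarith
          ultimately have "t\<^sup>2 * exp \<bar>t\<bar> \<le> (norm h * norm y)\<^sup>2 * exp (c / 2 * norm y)"
            by (intro mult_mono) auto
          then show "\<bar>exp t - 1 - t\<bar> \<le> (norm h * norm y)\<^sup>2 * exp (c / 2 * norm y)"
            using abs_exp_taylor_le[of t] by linarith
        qed auto
        also have "\<dots> = (norm h)\<^sup>2 * ((norm y)\<^sup>2 * norm (p y) * (exp (- (c * norm y)) * exp (c / 2 * norm y)))"
          by (simp add: power_mult_distrib)
        also have "exp (- (c * norm y)) * exp (c / 2 * norm y) = exp (- (c / 2 * norm y))"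
          by (simp add: exp_add[symmetric])
        finally show ?thesis by simp
      qed (simp add: zero_le_mult_iff)
    qed
    also have "\<dots> = (norm h)\<^sup>2 * J" by (simp add: J_def)
    finally show ?thesis .
  qed
  have "linear (\<lambda>h. - laplace (\<lambda>y. (y \<bullet> h) *\<^sub>R p y) x)"
  proof (rule linearI)
    fix a b r
    have "laplace (\<lambda>y. (y \<bullet> a) *\<^sub>R p y + (y \<bullet> b) *\<^sub>R p y) x =
        laplace (\<lambda>y. (y \<bullet> a) *\<^sub>R p y) x + laplace (\<lambda>y. (y \<bullet> b) *\<^sub>R p y) x"
      by (intro laplace_add x tempered_scale p)
    then show "- laplace (\<lambda>y. (y \<bullet> (a + b)) *\<^sub>R p y) x =
        - laplace (\<lambda>y. (y \<bullet> a) *\<^sub>R p y) x + - laplace (\<lambda>y. (y \<bullet> b) *\<^sub>R p y) x"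
      by (simp add: inner_add_right scaleR_add_left)
    show "- laplace (\<lambda>y. (y \<bullet> (r *\<^sub>R a)) *\<^sub>R p y) x = r *\<^sub>R - laplace (\<lambda>y. (y \<bullet> a) *\<^sub>R p y) x"
      using laplace_scaleR[of r "\<lambda>y. (y \<bullet> a) *\<^sub>R p y" x] by simp
  qed
  moreover have "\<exists>r>0. \<forall>z. norm (z - x) < r \<longrightarrow>
      norm (laplace p z - laplace p x - - laplace (\<lambda>y. (y \<bullet> (z - x)) *\<^sub>R p y) x) \<le> e * norm (z - x)"
    if e: "e > 0" for e
  proof (intro exI conjI allI impI)
    show "0 < min (min d (c / 2)) (e / (J + 1))" using d c e J0 by simp
    fix z assume z: "norm (z - x) < min (min d (c / 2)) (e / (J + 1))"
    have "norm (z - x) * (J + 1) \<le> e" using z J0 by (simp add: field_simps)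
    then have "norm (z - x) * J \<le> e" using norm_ge_zero[of "z - x"] unfolding distrib_left by linarith
    then have "norm (z - x) * (norm (z - x) * J) \<le> norm (z - x) * e" by (intro mult_left_mono) auto
    then show "norm (laplace p z - laplace p x - - laplace (\<lambda>y. (y \<bullet> (z - x)) *\<^sub>R p y) x) \<le> e * norm (z - x)"
      using est[of "z - x"] z by (simp add: power2_eq_square mult_ac)
  qed
  ultimately show ?thesis
    unfolding has_derivative_at_alt using linear_conv_bounded_linear by blast
qed

definition char_fun :: "'a \<Rightarrow> real" where "char_fun = laplace (\<lambda>_. 1)"

definition moment :: "'a \<Rightarrow> 'a" where "moment = laplace (\<lambda>y. y)"

text \<open>The negative gradient of \<open>ln \<circ> char_fun\<close>, known as Vinberg's \<open>*\<close>-map. It is the mean of the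
  density proportional to \<open>exp (- \<langle>x, y\<rangle>)\<close> on \<open>C\<close>.\<close>

definition dual_point :: "'a \<Rightarrow> 'a" where "dual_point x = (1 / char_fun x) *\<^sub>R moment x"

lemma moment_inner: "x \<in> interior C \<Longrightarrow> moment x \<bullet> h = laplace (\<lambda>y. y \<bullet> h) x"
  unfolding moment_def by (rule laplace_inner[OF _ tempered_id])

lemma char_fun_has_derivative:
  assumes x: "x \<in> interior C"
  shows "(char_fun has_derivative (\<lambda>h. - (moment x \<bullet> h))) (at x)"
  using laplace_has_derivative[OF x tempered_const[of "1::real"]]
  by (simp add: char_fun_def moment_inner[OF x])

text \<open>The same integral as \<open>char_fun\<close>, but with values in the extended reals: at boundary points, where
  it diverges, the Bochner integral would return \<open>0\<close>.\<close>

definition char_integral :: "'a \<Rightarrow> ennreal" where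
  "char_integral x = (\<integral>\<^sup>+y. ennreal (indicator C y * exp (- (x \<bullet> y))) \<partial>lborel)"

lemma char_integral_eq_char_fun:
  assumes x: "x \<in> interior C"
  shows "char_integral x = ennreal (char_fun x)"
  unfolding char_integral_def char_fun_def laplace_def
  using laplace_integrable[OF x tempered_const[of "1::real"]]
  by (subst nn_integral_eq_integral) auto

lemma nn_integral_pos_of_open:
  fixes f :: "'a \<Rightarrow> ennreal"
  assumes U: "open U" "U \<noteq> {}" and f: "\<And>y. y \<in> U \<Longrightarrow> 0 < f y"
    and [measurable]: "f \<in> borel_measurable borel"
  shows "(\<integral>\<^sup>+y. f y \<partial>lborel) \<noteq> 0"
proof
  assume "(\<integral>\<^sup>+y. f y \<partial>lborel) = 0"
  then have "AE y in lborel. f y = 0" by (simp add: nn_integral_0_iff_AE)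
  then have "AE y in lborel. y \<notin> U" by eventually_elim (use f in force)
  moreover have "U \<in> sets lborel" using U(1) by simp
  ultimately have "U \<in> null_sets lborel" by (simp add: AE_iff_null_sets)
  then have "negligible U" by (simp add: negligible_iff_null_sets null_sets_completionI)
  then show False using U open_not_negligible by blast
qed

lemma char_fun_pos:
  assumes x: "x \<in> interior C"
  shows "0 < char_fun x"
proof -
  have "char_integral x \<noteq> 0"
    unfolding char_integral_def by (rule nn_integral_pos_of_open[OF open_interior interior_nonempty])
       (auto simp: interior_mem)
  then show ?thesis unfolding char_integral_eq_char_fun[OF x] by (simp add: ennreal_eq_0_iff not_le)
qed

text \<open>At a boundary point \<open>x\<close> there is \<open>y0 \<in> C\<close> orthogonal to \<open>x\<close>, and the integrand \<open>f\<close> is invariant in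
  the direction \<open>y0\<close> within \<open>C\<close>. Shifting by \<open>y0\<close> preserves the integral of \<open>f\<close> but strictly
  decreases \<open>f\<close> on the open set of interior points that leave \<open>C\<close> under subtraction of \<open>y0\<close>; so
  the integral cannot be finite.\<close>

lemma char_integral_infinite_on_boundary:
  assumes x: "x \<in> C" "x \<notin> interior C"
  shows "char_integral x = \<infinity>"
proof (rule ccontr)
  assume fin: "char_integral x \<noteq> \<infinity>"
  obtain y0 where y0: "y0 \<in> C" "y0 \<noteq> 0" "y0 \<bullet> x = 0"
    using interiorI[of x] x inner_nonneg[OF _ x(1)] by force
  define f where "f y = ennreal (indicator C y * exp (- (x \<bullet> y)))" for y
  have [measurable]: "f \<in> borel_measurable borel" unfolding f_def by measurable
  have trans: "(\<integral>\<^sup>+y. f (- y0 + y) \<partial>lborel) = (\<integral>\<^sup>+y. f y \<partial>lborel)"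
    by (rule nn_integral_lborel_translate) measurable
  have fin': "(\<integral>\<^sup>+y. f y \<partial>lborel) \<noteq> \<infinity>"
    using fin unfolding char_integral_def f_def .
  have shift: "f (- y0 + y) \<le> f y" for y
  proof -
    have "- y0 + y \<in> C \<Longrightarrow> y \<in> C" using add_mem[OF y0(1), of "- y0 + y"] by simp
    then show ?thesis
      using y0(3) by (auto simp: f_def indicator_def inner_diff_right inner_commute[of x y0])
  qed
  define g where "g y = f y - f (- y0 + y)" for y
  have [measurable]: "g \<in> borel_measurable borel" unfolding g_def by measurable
  have "(\<integral>\<^sup>+y. g y \<partial>lborel) = (\<integral>\<^sup>+y. f y \<partial>lborel) - (\<integral>\<^sup>+y. f (- y0 + y) \<partial>lborel)"
    unfolding g_def
  proof (rule nn_integral_diff)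
    show "(\<integral>\<^sup>+y. f (- y0 + y) \<partial>lborel) \<noteq> \<infinity>"
      unfolding trans by (rule fin')
  qed (use shift in auto)
  also have "\<dots> = 0" unfolding trans using fin' by simp
  finally have g0: "(\<integral>\<^sup>+y. g y \<partial>lborel) = 0" .
  define U where "U = interior C \<inter> {y. - y0 + y \<notin> C}"
  have "{y. - y0 + y \<notin> C} = (\<lambda>y. - y0 + y) -` (- C)" by auto
  then have "open {y. - y0 + y \<notin> C}"
    using closed_cone by (auto intro!: open_vimage continuous_intros)
  then have "open U" unfolding U_def by auto
  moreover have "U \<noteq> {}"
  proof -
    obtain p where p: "p \<in> interior C" using interior_nonempty by blast
    have "\<not> (\<forall>t>0. - y0 + t *\<^sub>R p \<in> C)"
    proof
      assume *: "\<forall>t>0. - y0 + t *\<^sub>R p \<in> C"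
      have "((\<lambda>t. - y0 + t *\<^sub>R p) \<longlongrightarrow> - y0 + 0 *\<^sub>R p) (at_right 0)" by (intro tendsto_intros)
      then have "- y0 + 0 *\<^sub>R p \<in> C"
        by (rule Lim_in_closed_set[OF closed_cone, rotated 2])
           (use * in \<open>auto simp: eventually_at_right_field intro!: exI[of _ 1]\<close>)
      then show False using pointed y0 by simp
    qed
    then obtain t where "t > 0" "- y0 + t *\<^sub>R p \<notin> C" by blast
    then have "t *\<^sub>R p \<in> U" using interior_scale[OF p] by (simp add: U_def)
    then show ?thesis by blast
  qed
  moreover have "0 < g y" if "y \<in> U" for y
    using that interior_mem by (auto simp: U_def g_def f_def)
  ultimately have "(\<integral>\<^sup>+y. g y \<partial>lborel) \<noteq> 0"
    by (intro nn_integral_pos_of_open[of U]) auto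
  then show False using g0 by simp
qed

text \<open>By Fatou's lemma the bound persists at the limit, which by the previous lemma cannot be a boundary
  point. So the sublevel sets of \<open>char_fun\<close> do not touch the boundary.\<close>

lemma limit_in_interior_of_bounded_char_fun:
  assumes X: "\<And>n. X n \<in> interior C" "X \<longlonglongrightarrow> x" and bd: "\<And>n. char_fun (X n) \<le> M"
  shows "x \<in> interior C"
proof (rule ccontr)
  assume nx: "x \<notin> interior C"
  have xC: "x \<in> C"
    by (rule Lim_in_closed_set[OF closed_cone _ _ X(2)]) (simp_all add: X(1) interior_mem)
  have "char_integral x = (\<integral>\<^sup>+y. liminf (\<lambda>n. ennreal (indicator C y * exp (- (X n \<bullet> y)))) \<partial>lborel)"
    unfolding char_integral_def
  proof (intro nn_integral_cong)
    fix y
    have "(\<lambda>n. ennreal (indicator C y * exp (- (X n \<bullet> y)))) \<longlonglongrightarrow> ennreal (indicator C y * exp (- (x \<bullet> y)))"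
      by (intro tendsto_intros tendsto_ennrealI X(2))
    then show "ennreal (indicator C y * exp (- (x \<bullet> y))) = liminf (\<lambda>n. ennreal (indicator C y * exp (- (X n \<bullet> y))))"
      by (intro lim_imp_Liminf[symmetric]) auto
  qed
  also have "\<dots> \<le> liminf (\<lambda>n. char_integral (X n))"
    unfolding char_integral_def by (rule nn_integral_liminf) measurable
  also have "\<dots> \<le> limsup (\<lambda>n. char_integral (X n))" by (rule Liminf_le_Limsup) simp
  also have "\<dots> \<le> ennreal M"
    using bd by (intro Limsup_bounded always_eventually allI) (simp add: char_integral_eq_char_fun X(1) ennreal_leI)
  finally show False using char_integral_infinite_on_boundary[OF xC nx] by (simp add: top_unique)
qed

text \<open>The gradient inequality for the convex function \<open>ln \<circ> char_fun\<close>. It is Jensen's inequality for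
  the probability density proportional to \<open>exp (- \<langle>x, y\<rangle>)\<close> on \<open>C\<close>, whose mean is \<open>dual_point x\<close>;
  below, the exponential is bounded by its tangent at that mean.\<close>

lemma char_fun_convexity:
  assumes x: "x \<in> interior C" and p: "p \<in> interior C"
  shows "char_fun x * exp (- ((p - x) \<bullet> dual_point x)) \<le> char_fun p"
proof -
  define t where "t = (p - x) \<bullet> dual_point x"
  have tm: "t * char_fun x = moment x \<bullet> (p - x)"
    using char_fun_pos[OF x] by (simp add: t_def dual_point_def inner_commute)
  let ?f = "\<lambda>y. exp (- t) * (1 + t) + (- exp (- t)) * (y \<bullet> (p - x))"
  have tid: "tempered (\<lambda>y. (- exp (- t)) *\<^sub>R (y \<bullet> (p - x)))"
    using tempered_inner[of "(- exp (- t)) *\<^sub>R (p - x)"] by simp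
  have "exp (- t) * char_fun x = exp (- t) * (1 + t) * char_fun x - exp (- t) * (moment x \<bullet> (p - x))"
    by (simp only: tm[symmetric]) (simp add: algebra_simps)
  also have "\<dots> = laplace ?f x"
  proof -
    have "laplace ?f x = laplace (\<lambda>y. exp (- t) * (1 + t)) x + laplace (\<lambda>y. (- exp (- t)) *\<^sub>R (y \<bullet> (p - x))) x"
      using laplace_add[OF x tempered_const tid] by simp
    also have "laplace (\<lambda>y. (- exp (- t)) *\<^sub>R (y \<bullet> (p - x))) x = - exp (- t) * (moment x \<bullet> (p - x))"
      by (subst laplace_scaleR) (simp add: moment_inner[OF x])
    also have "laplace (\<lambda>y. exp (- t) * (1 + t)) x = exp (- t) * (1 + t) * char_fun x"
      using laplace_scaleR[of "exp (- t) * (1 + t)" "\<lambda>_. 1::real" x] by (simp add: char_fun_def)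
    finally show ?thesis by simp
  qed
  also have "\<dots> \<le> char_fun p"
    unfolding char_fun_def laplace_def
  proof (rule integral_mono)
    have "tempered ?f" using tempered_add[OF tempered_const tempered_inner[of "(- exp (- t)) *\<^sub>R (p - x)"]] by simp
    then show "integrable lborel (\<lambda>y. (indicator C y * exp (- (x \<bullet> y))) *\<^sub>R ?f y)"
      by (rule laplace_integrable[OF x])
    show "integrable lborel (\<lambda>y. (indicator C y * exp (- (p \<bullet> y))) *\<^sub>R (1::real))"
      by (rule laplace_integrable[OF p tempered_const])
    fix y
    have "1 + (t - y \<bullet> (p - x)) \<le> exp (t - y \<bullet> (p - x))" by (rule exp_ge_add_one_self)
    then have "exp (- t) * (1 + (t - y \<bullet> (p - x))) \<le> exp (- t) * exp (t - y \<bullet> (p - x))"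
      by (intro mult_left_mono) auto
    also have "\<dots> = exp (- (y \<bullet> (p - x)))" by (simp add: exp_add[symmetric])
    finally have "?f y \<le> exp (- (y \<bullet> (p - x)))" by (simp add: algebra_simps)
    then have "exp (- (x \<bullet> y)) * ?f y \<le> exp (- (x \<bullet> y)) * exp (- (y \<bullet> (p - x)))"
      by (intro mult_left_mono) auto
    also have "\<dots> = exp (- (p \<bullet> y))" by (simp add: exp_add[symmetric] inner_diff_right inner_commute)
    finally show "(indicator C y * exp (- (x \<bullet> y))) *\<^sub>R ?f y \<le> (indicator C y * exp (- (p \<bullet> y))) *\<^sub>R 1"
      by (simp add: indicator_def)
  qed
  finally show ?thesis by (simp add: t_def mult.commute)
qed

text \<open>The derivative at \<open>x\<close> is minus the covariance of the density proportional to \<open>exp (- \<langle>x, y\<rangle>)\<close> on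
  \<open>C\<close>, and a variance is non-negative.\<close>

lemma dual_point_differentiable:
  assumes x: "x \<in> interior C"
  obtains D where "(dual_point has_derivative D) (at x)" "\<And>h. D h \<bullet> h \<le> 0"
proof -
  have pp: "char_fun x > 0" by (rule char_fun_pos[OF x])
  note dm = laplace_has_derivative[OF x tempered_id, folded moment_def]
  define M where "M h = laplace (\<lambda>y. (y \<bullet> h) *\<^sub>R y) x" for h
  define D where "D h = (1 / char_fun x) *\<^sub>R (- M h) + (moment x \<bullet> h / (char_fun x * char_fun x)) *\<^sub>R moment x" for h
  have "((\<lambda>x. (1 / char_fun x) *\<^sub>R moment x) has_derivative D) (at x)"
    unfolding D_def M_def using pp
    by (auto intro!: derivative_eq_intros char_fun_has_derivative[OF x] dm simp: field_simps)
  then have "(dual_point has_derivative D) (at x)" by (simp add: dual_point_def[abs_def])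
  moreover have "D h \<bullet> h \<le> 0" for h
  proof -
    define s where "s = moment x \<bullet> h / char_fun x"
    have s: "s * char_fun x = moment x \<bullet> h" using pp by (simp add: s_def)
    have eq: "(y \<bullet> h) *\<^sub>R (y \<bullet> h) + ((- 2 * s) *\<^sub>R (y \<bullet> h) + s\<^sup>2 *\<^sub>R 1) = (y \<bullet> h - s)\<^sup>2" for y
      by (simp add: power2_eq_square algebra_simps)
    have t1: "tempered (\<lambda>y. (y \<bullet> h) *\<^sub>R (y \<bullet> h))" by (rule tempered_scale[OF tempered_inner])
    have t2: "tempered (\<lambda>y. (- 2 * s) *\<^sub>R (y \<bullet> h))"
      using tempered_inner[of "(- 2 * s) *\<^sub>R h"] by simp
    have t3: "tempered (\<lambda>y::'a. s\<^sup>2 *\<^sub>R (1::real))" by (rule tempered_const)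
    have "0 = laplace (\<lambda>y. 0 *\<^sub>R (0::real)) x" by (simp only: laplace_scaleR) simp
    also have "\<dots> \<le> laplace (\<lambda>y. (y \<bullet> h) *\<^sub>R (y \<bullet> h) + ((- 2 * s) *\<^sub>R (y \<bullet> h) + s\<^sup>2 *\<^sub>R 1)) x"
    proof (rule laplace_mono[OF x])
      show "0 *\<^sub>R (0::real) \<le> (y \<bullet> h) *\<^sub>R (y \<bullet> h) + ((- 2 * s) *\<^sub>R (y \<bullet> h) + s\<^sup>2 *\<^sub>R 1)" for y
        unfolding eq by simp
    qed (intro tempered_add t1 t2 t3 tempered_const)+
    also have "\<dots> = M h \<bullet> h + ((- 2 * s) *\<^sub>R (moment x \<bullet> h) + s\<^sup>2 *\<^sub>R char_fun x)"
      by (subst laplace_add[OF x t1 tempered_add[OF t2 t3]], subst laplace_add[OF x t2 t3],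
          unfold laplace_scaleR moment_inner[OF x] char_fun_def M_def
            laplace_inner[OF x tempered_scale[OF tempered_id]]) simp
    finally have "0 \<le> M h \<bullet> h - s * (moment x \<bullet> h)"
      by (simp add: s[symmetric] power2_eq_square)
    moreover have "D h \<bullet> h = - (M h \<bullet> h - s * (moment x \<bullet> h)) / char_fun x"
      unfolding D_def s_def using pp
      by (simp add: inner_add_left inner_diff_left diff_divide_distrib)
    ultimately show ?thesis using pp by (simp add: divide_nonpos_pos)
  qed
  ultimately show ?thesis using that by blast
qed

end

section \<open>Automorphisms and the scaling point\<close>

context self_dual_cone
begin

definition cone_aut :: "('a \<Rightarrow> 'a) \<Rightarrow> bool" where
  "cone_aut g \<longleftrightarrow> linear g \<and> bij g \<and> g ` C = C"

lemma cone_autD: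
  assumes "cone_aut g"
  shows "linear g" "bij g" "g x \<in> C \<longleftrightarrow> x \<in> C"
  using assms inj_image_mem_iff[of g x C] by (auto simp: cone_aut_def bij_is_inj)

lemma cone_aut_adjoint:
  assumes g: "cone_aut g"
  shows "cone_aut (adjoint g)"
proof -
  note lin = cone_autD(1)[OF g]
  have lin': "linear (adjoint g)" by (rule adjoint_linear[OF lin])
  have "inj (adjoint g)"
  proof (rule linear_injective_0[OF lin', THEN iffD2], intro allI impI)
    fix x assume "adjoint g x = 0"
    then have "g y \<bullet> x = 0" for y using adjoint_works[OF lin, of y x] by simp
    moreover obtain y where "x = g y" using cone_autD(2)[OF g] by (metis bij_pointE)
    ultimately show "x = 0" by (metis inner_eq_zero_iff)
  qed
  then have bij': "bij (adjoint g)"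
    using lin' linear_injective_imp_surjective by (auto simp: bij_def)
  have "adjoint g y \<in> C \<longleftrightarrow> y \<in> C" for y
  proof
    assume a: "adjoint g y \<in> C"
    have "0 \<le> y \<bullet> w" if w: "w \<in> C" for w
    proof -
      obtain v where "w = g v" "v \<in> C" using g w by (auto simp: cone_aut_def)
      then show ?thesis using inner_nonneg[OF a, of v] adjoint_works[OF lin, of v y]
        by (simp add: inner_commute)
    qed
    then show "y \<in> C" by (subst mem_iff) blast
  next
    assume y: "y \<in> C"
    have "0 \<le> adjoint g y \<bullet> v" if v: "v \<in> C" for v
      using inner_nonneg[OF y, of "g v"] cone_autD(3)[OF g, of v] v adjoint_works[OF lin, of v y]
      by (simp add: inner_commute)
    then show "adjoint g y \<in> C" by (subst mem_iff) blast
  qed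
  then have "adjoint g ` C = C"
    using bij' by (auto simp: image_iff) (metis bij_pointE)
  then show ?thesis using lin' bij' by (simp add: cone_aut_def)
qed

lemma cone_aut_inv:
  assumes g: "cone_aut g"
  shows "cone_aut (inv g)"
proof -
  have "inv g ` C = C"
    using g bij_is_inj image_inv_f_f by (metis cone_aut_def)
  moreover have "linear (inv g)"
    using g linear_injective_left_inverse unfolding cone_aut_def
    by (metis bij_betw_def bij_is_inj inj_imp_bij_betw_inv inv_unique_comp linear_inj_iff_eq_0 linear_inverse_left linear_surjective_right_inverse)
  ultimately show ?thesis using g bij_imp_bij_inv by (auto simp: cone_aut_def)
qed

lemma cone_aut_interior:
  assumes g: "cone_aut g" and x: "x \<in> interior C"
  shows "g x \<in> interior C"
proof (rule interiorI)
  fix w assume w: "w \<in> C" "w \<noteq> 0"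
  note a = cone_aut_adjoint[OF g]
  have "adjoint g w \<in> C" using cone_autD(3)[OF a] w by simp
  moreover have "adjoint g w \<noteq> 0"
    using w(2) cone_autD(1,2)[OF a] by (metis bij_is_inj injD linear_0)
  ultimately have "0 < adjoint g w \<bullet> x" by (rule interior_inner_pos[OF x])
  then show "0 < w \<bullet> g x"
    using adjoint_works[OF cone_autD(1)[OF g], of x w] by (simp add: inner_commute)
qed

lemma cone_aut_interior_iff:
  assumes g: "cone_aut g"
  shows "g x \<in> interior C \<longleftrightarrow> x \<in> interior C"
  using cone_aut_interior[OF g, of x] cone_aut_interior[OF cone_aut_inv[OF g], of "g x"]
    cone_autD(2)[OF g] by (auto simp: bij_is_inj)

text \<open>The substitution \<open>y \<mapsto> adjoint g y\<close> turns the integral for \<open>x\<close> into that for \<open>g x\<close>, so automorphisms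
  change \<open>char_fun\<close> by a constant factor.\<close>

lemma char_fun_aut_proportional:
  assumes g: "cone_aut g" and x: "x \<in> interior C" and z: "z \<in> interior C"
  shows "char_fun (g x) * char_fun z = char_fun (g z) * char_fun x"
proof -
  note a = cone_aut_adjoint[OF g]
  have char_integral: "char_integral (g v) = (\<integral>\<^sup>+y. ennreal (indicator C (adjoint g y) * exp (- (v \<bullet> adjoint g y))) \<partial>lborel)" for v
    unfolding char_integral_def using cone_autD(3)[OF a]
    by (simp add: indicator_def adjoint_works[OF cone_autD(1)[OF g]])
  have "char_integral (g x) * char_integral z = char_integral (g z) * char_integral x"
    unfolding char_integral unfolding char_integral_def
    by (rule nn_integral_linear_proportional) (use cone_autD[OF a] in \<open>auto simp: bij_is_surj\<close>)
  then show ?thesis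
    using char_fun_pos x z cone_aut_interior[OF g]
    by (simp add: char_integral_eq_char_fun ennreal_mult[symmetric] less_imp_le)
qed

text \<open>Differentiate \<open>char_fun (g z) = \<kappa> char_fun z\<close>: the constant cancels in the logarithmic derivative.\<close>

lemma dual_point_equivariant:
  assumes g: "cone_aut g" and x: "x \<in> interior C"
  shows "adjoint g (dual_point (g x)) = dual_point x"
proof -
  note lin = cone_autD(1)[OF g]
  define \<kappa> where "\<kappa> = char_fun (g x) / char_fun x"
  have gx: "g x \<in> interior C" by (rule cone_aut_interior[OF g x])
  have pos: "char_fun x > 0" "char_fun (g x) > 0" by (rule char_fun_pos x gx)+
  have eq: "char_fun (g z) = \<kappa> * char_fun z" if "z \<in> interior C" for z
    using char_fun_aut_proportional[OF g x that] pos by (simp add: \<kappa>_def field_simps)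
  have "(g has_derivative g) (at x)"
    by (rule linear_imp_has_derivative[OF lin])
  then have "((\<lambda>z. char_fun (g z)) has_derivative (\<lambda>h. - (moment (g x) \<bullet> g h))) (at x)"
    using char_fun_has_derivative[OF gx] by (rule has_derivative_compose)
  moreover have "((\<lambda>z. char_fun (g z)) has_derivative (\<lambda>h. \<kappa> * - (moment x \<bullet> h))) (at x)"
    by (rule has_derivative_transform_within_open[OF has_derivative_mult_right[OF char_fun_has_derivative[OF x]] open_interior x])
       (simp add: eq)
  ultimately have "(\<lambda>h. - (moment (g x) \<bullet> g h)) = (\<lambda>h. \<kappa> * - (moment x \<bullet> h))"
    by (rule has_derivative_unique)
  from fun_cong[OF this] have "moment (g x) \<bullet> g h = \<kappa> * (moment x \<bullet> h)" for h by simp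
  then have "h \<bullet> adjoint g (moment (g x)) = h \<bullet> (\<kappa> *\<^sub>R moment x)" for h
    by (simp add: adjoint_works[OF lin] inner_commute)
  then have "adjoint g (moment (g x)) = \<kappa> *\<^sub>R moment x"
    using vector_eq_ldot by blast
  then show ?thesis
    using pos by (simp add: dual_point_def linear_scale[OF adjoint_linear[OF lin]] \<kappa>_def)
qed

lemma minimum_on_interior:
  fixes f :: "'a \<Rightarrow> real"
  assumes cont: "continuous_on (interior C) f" and x0: "x0 \<in> interior C"
    and bd: "bounded {x \<in> interior C. f x \<le> f x0}"
    and lim: "\<And>X x. (\<And>n. X n \<in> interior C) \<Longrightarrow> (\<And>n. f (X n) \<le> f x0) \<Longrightarrow> X \<longlonglongrightarrow> x \<Longrightarrow> x \<in> interior C"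
  shows "\<exists>x\<in>interior C. \<forall>y\<in>interior C. f x \<le> f y"
proof -
  define S where "S = {x \<in> interior C. f x \<le> f x0}"
  have "closed S"
    unfolding closed_sequential_limits
  proof (intro allI impI)
    fix X x assume "(\<forall>n. X n \<in> S) \<and> X \<longlonglongrightarrow> x"
    then have X: "\<And>n. X n \<in> interior C" "\<And>n. f (X n) \<le> f x0" "X \<longlonglongrightarrow> x"
      by (auto simp: S_def)
    have x: "x \<in> interior C" by (rule lim[OF X])
    have "(\<lambda>n. f (X n)) \<longlonglongrightarrow> f x"
      by (rule continuous_on_tendsto_compose[OF cont X(3) x]) (simp add: X(1))
    then have "f x \<le> f x0" by (rule LIMSEQ_le_const2) (simp add: X(2))
    then show "x \<in> S" using x by (simp add: S_def)
  qed
  then have comp: "compact S" using bd by (simp add: compact_eq_bounded_closed S_def)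
  have ne: "S \<noteq> {}" using x0 by (auto simp: S_def)
  have "continuous_on S f" by (rule continuous_on_subset[OF cont]) (auto simp: S_def)
  then obtain x where x: "x \<in> S" "\<forall>y\<in>S. f x \<le> f y"
    using continuous_attains_inf[OF comp ne] by blast
  have "f x \<le> f y" if "y \<in> interior C" for y
  proof (cases "f y \<le> f x0")
    case True
    then show ?thesis using x(2) that by (simp add: S_def)
  next
    case False
    then show ?thesis using x(1) by (simp add: S_def)
  qed
  moreover have "x \<in> interior C" using x(1) by (simp add: S_def)
  ultimately show ?thesis by blast
qed

lemma char_fun_continuous: "continuous_on (interior C) char_fun"
  by (intro continuous_at_imp_continuous_on ballI) (rule has_derivative_continuous[OF char_fun_has_derivative])

text \<open>The fixed points are the critical points of \<open>ln (char_fun x) + \<langle>x, x\<rangle> / 2\<close>. This function has a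
  minimiser: the first summand decreases at most linearly by the gradient inequality, and
  sublevel sets stay away from the boundary.\<close>

lemma dual_point_fixed_point: "\<exists>e\<in>interior C. dual_point e = e"
proof -
  obtain x0 where x0: "x0 \<in> interior C" using interior_nonempty by blast
  define f where "f x = ln (char_fun x) + (x \<bullet> x) / 2" for x
  have "\<exists>e\<in>interior C. \<forall>y\<in>interior C. f e \<le> f y"
  proof (rule minimum_on_interior[of f x0])
    show "continuous_on (interior C) f"
      unfolding f_def by (intro continuous_intros char_fun_continuous) (auto dest: char_fun_pos)
    define E where "E = f x0 - ln (char_fun x0) - x0 \<bullet> dual_point x0"
    have "norm (x - dual_point x0) \<le> sqrt ((norm (dual_point x0))\<^sup>2 + 2 * E)"
      if x: "x \<in> interior C" "f x \<le> f x0" for x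
    proof (rule real_le_rsqrt)
      have "ln (char_fun x0 * exp (- ((x - x0) \<bullet> dual_point x0))) \<le> ln (char_fun x)"
        using char_fun_convexity[OF x0 x(1)] char_fun_pos[OF x0] by (intro ln_mono) auto
      then have "ln (char_fun x0) - (x - x0) \<bullet> dual_point x0 \<le> ln (char_fun x)"
        using char_fun_pos[OF x0] by (simp add: ln_mult)
      then have "(x \<bullet> x) - 2 * (x \<bullet> dual_point x0) \<le> 2 * E"
        using x(2) unfolding f_def E_def by (simp add: inner_diff_left)
      moreover have "(norm (x - dual_point x0))\<^sup>2 = (x \<bullet> x) - 2 * (x \<bullet> dual_point x0) + (norm (dual_point x0))\<^sup>2"
        by (simp add: power2_norm_eq_inner inner_diff_left inner_diff_right inner_commute)
      ultimately show "(norm (x - dual_point x0))\<^sup>2 \<le> (norm (dual_point x0))\<^sup>2 + 2 * E"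
        by simp
    qed
    then have "{x \<in> interior C. f x \<le> f x0} \<subseteq> cball (dual_point x0) (sqrt ((norm (dual_point x0))\<^sup>2 + 2 * E))"
      by (simp add: subset_iff dist_norm norm_minus_commute)
    then show "bounded {x \<in> interior C. f x \<le> f x0}" by (rule bounded_subset[OF bounded_cball])
    show "x \<in> interior C" if X: "\<And>n. X n \<in> interior C" "\<And>n. f (X n) \<le> f x0" "X \<longlonglongrightarrow> x" for X x
    proof (rule limit_in_interior_of_bounded_char_fun[OF X(1,3)])
      fix n
      have "ln (char_fun (X n)) \<le> f x0" using X(2)[of n] inner_ge_zero[of "X n"] unfolding f_def by linarith
      then have "exp (ln (char_fun (X n))) \<le> exp (f x0)" by simp
      then show "char_fun (X n) \<le> exp (f x0)" using char_fun_pos[OF X(1)[of n]] by simp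
    qed
  qed (rule x0)
  then obtain e where e: "e \<in> interior C" "\<And>y. y \<in> interior C \<Longrightarrow> f e \<le> f y" by blast
  have pp: "char_fun e > 0" by (rule char_fun_pos[OF e(1)])
  have "(f has_derivative (\<lambda>h. - (moment e \<bullet> h) / char_fun e + e \<bullet> h)) (at e)"
    unfolding f_def using pp
    by (auto intro!: derivative_eq_intros char_fun_has_derivative[OF e(1)] simp: inner_commute field_simps)
  then have "(\<lambda>h. - (moment e \<bullet> h) / char_fun e + e \<bullet> h) = (\<lambda>h. 0)"
    using e by (intro differential_zero_maxmin[OF e(1) open_interior]) auto
  from fun_cong[OF this] have "- (moment e \<bullet> h) / char_fun e + e \<bullet> h = 0" for h .
  then have "dual_point e \<bullet> h = e \<bullet> h" for h by (simp add: dual_point_def add_eq_0_iff)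
  then have "dual_point e = e" using vector_eq_rdot[of "dual_point e" e] by simp
  then show ?thesis using e(1) by blast
qed

end

locale symmetric_self_dual_cone = self_dual_cone +
  assumes transitive: "x \<in> interior C \<Longrightarrow> y \<in> interior C \<Longrightarrow>
    \<exists>g. linear g \<and> bij g \<and> g ` interior C = interior C \<and> g x = y"
begin

lemma transitive_aut:
  assumes "x \<in> interior C" "y \<in> interior C"
  obtains g where "cone_aut g" "g x = y"
proof -
  obtain g where g: "linear g" "bij g" "g ` interior C = interior C" "g x = y"
    using transitive[OF assms] by blast
  have cl: "closure (interior C) = C"
    using convex_closure_interior[OF convex_cone interior_nonempty] closed_cone by simp
  have "g ` closure (interior C) = closure (g ` interior C)"
    by (rule closure_injective_linear_image[OF g(1) bij_is_inj[OF g(2)]])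
  then have "g ` C = C" unfolding g(3) cl .
  then show ?thesis using that g by (simp add: cone_aut_def)
qed

text \<open>Write \<open>x = g e\<close> with a fixed point \<open>e\<close>. Equivariance under \<open>g\<close> says that \<open>adjoint g\<close> maps
  \<open>dual_point x\<close> to \<open>e\<close>; equivariance under \<open>adjoint g\<close> then sends the dual of that point back
  to \<open>g e = x\<close>.\<close>

lemma dual_point_involution:
  obtains e where "e \<in> interior C" "dual_point e = e" "\<And>x. x \<in> interior C \<Longrightarrow> dual_point x \<in> interior C"
    "\<And>x. x \<in> interior C \<Longrightarrow> dual_point (dual_point x) = x"
proof -
  obtain e where e: "e \<in> interior C" "dual_point e = e" using dual_point_fixed_point by blast
  have "dual_point x \<in> interior C \<and> dual_point (dual_point x) = x" if x: "x \<in> interior C" for x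
  proof -
    obtain g where g: "cone_aut g" "g e = x" using transitive_aut[OF e(1) x] by blast
    note a = cone_aut_adjoint[OF g(1)]
    have ae: "adjoint g (dual_point x) = e" using dual_point_equivariant[OF g(1) e(1)] g(2) e(2) by simp
    then have int: "dual_point x \<in> interior C" using cone_aut_interior_iff[OF a, of "dual_point x"] e(1) by simp
    have "g e = dual_point (dual_point x)"
      using dual_point_equivariant[OF a int] adjoint_adjoint[OF cone_autD(1)[OF g(1)]] ae e(2) by simp
    then show ?thesis using int g(2) by simp
  qed
  then show ?thesis using that e by blast
qed

text \<open>At a fixed point the derivative of the involution is an involution; being negative semidefinite it
  is \<open>- 1\<close>. Equivariance transports this to every interior point.\<close>

lemma dual_point_derivative:
  assumes x: "x \<in> interior C"
  obtains g D where "cone_aut g" "(dual_point has_derivative D) (at x)" "\<And>v. adjoint g (D (g v)) = - v"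
proof -
  obtain e where e: "e \<in> interior C" "dual_point e = e"
    and inv: "\<And>x. x \<in> interior C \<Longrightarrow> dual_point (dual_point x) = x"
    using dual_point_involution by metis
  obtain D where D: "(dual_point has_derivative D) (at e)" "\<And>h. D h \<bullet> h \<le> 0"
    using dual_point_differentiable[OF e(1)] by blast
  have "(dual_point has_derivative D) (at (dual_point e))" using D(1) e(2) by simp
  then have "((\<lambda>x. dual_point (dual_point x)) has_derivative (\<lambda>h. D (D h))) (at e)"
    by (rule has_derivative_compose[OF D(1)])
  moreover have "((\<lambda>x. dual_point (dual_point x)) has_derivative (\<lambda>h. h)) (at e)"
    by (rule has_derivative_transform_within_open[OF has_derivative_ident open_interior e(1)])
       (simp add: inv)
  ultimately have "(\<lambda>h. D (D h)) = (\<lambda>h. h)" by (rule has_derivative_unique)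
  from fun_cong[OF this] have DD: "D (D h) = h" for h .
  have linD: "linear D" using D(1) has_derivative_linear by blast
  have Dm: "D h = - h" for h
  proof -
    have "D (D h + h) = D h + h" using DD by (simp add: linear_add[OF linD] add.commute)
    then have "(D h + h) \<bullet> (D h + h) \<le> 0" using D(2)[of "D h + h"] by simp
    then have "(D h + h) \<bullet> (D h + h) = 0" using inner_ge_zero order_antisym by blast
    then have "D h + h = 0" by (rule inner_eq_zero_iff[THEN iffD1])
    then show ?thesis by (simp add: eq_neg_iff_add_eq_0)
  qed
  obtain g where g: "cone_aut g" "g e = x" using transitive_aut[OF e(1) x] by blast
  note lin = cone_autD(1)[OF g(1)]
  obtain D' where D': "(dual_point has_derivative D') (at x)" using dual_point_differentiable[OF x] by metis
  have "((\<lambda>z. dual_point (g z)) has_derivative (\<lambda>v. D' (g v))) (at e)"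
    using D' g(2) by (intro has_derivative_compose[OF linear_imp_has_derivative[OF lin]]) simp
  then have "((\<lambda>z. adjoint g (dual_point (g z))) has_derivative (\<lambda>v. adjoint g (D' (g v)))) (at e)"
    by (rule has_derivative_compose[OF _ linear_imp_has_derivative[OF adjoint_linear[OF lin]]])
  then have "(dual_point has_derivative (\<lambda>v. adjoint g (D' (g v)))) (at e)"
    by (rule has_derivative_transform_within_open[OF _ open_interior e(1)])
       (simp add: dual_point_equivariant[OF g(1)])
  then have "(\<lambda>v. adjoint g (D' (g v))) = D" using D(1) by (rule has_derivative_unique)
  from fun_cong[OF this] have "adjoint g (D' (g v)) = - v" for v using Dm by simp
  then show ?thesis using that g(1) D' by blast
qed

text \<open>Minimise \<open>F x = \<langle>f, dual_point x\<rangle> + \<langle>y, x\<rangle>\<close>. Both summands are non-negative; a bound on the second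
  keeps \<open>x\<close> bounded, and one on the first keeps \<open>dual_point x\<close> bounded, so that by the gradient
  inequality \<open>char_fun\<close> is bounded and \<open>x\<close> stays away from the boundary. At the minimiser
  the derivative formula says \<open>adjoint k (k f) = y\<close> for \<open>k = inv g\<close>.\<close>

lemma scaling_point:
  assumes f: "f \<in> interior C" and y: "y \<in> interior C"
  obtains k where "cone_aut k" "adjoint k (k f) = y"
proof -
  obtain e where si: "\<And>x. x \<in> interior C \<Longrightarrow> dual_point x \<in> interior C"
    using dual_point_involution by metis
  define F where "F x = f \<bullet> dual_point x + y \<bullet> x" for x
  have nonneg: "0 \<le> f \<bullet> dual_point x" "0 \<le> y \<bullet> x" if "x \<in> interior C" for x
    using that si f y interior_mem inner_nonneg by auto
  have "\<exists>x\<in>interior C. \<forall>z\<in>interior C. F x \<le> F z"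
  proof (rule minimum_on_interior[of F f])
    have "continuous_on (interior C) dual_point"
    proof (intro continuous_at_imp_continuous_on ballI)
      fix x assume x: "x \<in> interior C"
      obtain D where "(dual_point has_derivative D) (at x)" using dual_point_differentiable[OF x] by blast
      then show "isCont dual_point x" by (rule has_derivative_continuous)
    qed
    then show "continuous_on (interior C) F" unfolding F_def by (intro continuous_intros)
    obtain c where c: "c > 0" "\<And>w. w \<in> C \<Longrightarrow> c * norm w \<le> w \<bullet> y"
      using interior_coercive[OF y] by blast
    have bound: "norm x \<le> F f / c" if "x \<in> interior C" "F x \<le> F f" for x
    proof -
      have "c * norm x \<le> F f"
        using c(2)[of x] nonneg[of x] that interior_mem by (simp add: F_def inner_commute)
      then show ?thesis using c(1) by (simp add: field_simps)
    qed
    then show "bounded {x \<in> interior C. F x \<le> F f}" by (auto simp: bounded_iff)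
    obtain d where d: "d > 0" "\<And>w. w \<in> C \<Longrightarrow> d * norm w \<le> w \<bullet> f"
      using interior_coercive[OF f] by blast
    show "x \<in> interior C" if X: "\<And>n. X n \<in> interior C" "\<And>n. F (X n) \<le> F f" "X \<longlonglongrightarrow> x" for X x
    proof (rule limit_in_interior_of_bounded_char_fun[OF X(1,3)])
      fix n
      let ?s = "dual_point (X n)"
      have "d * norm ?s \<le> F f"
        using d(2)[of ?s] nonneg[OF X(1)[of n]] X(2)[of n] interior_mem[OF si[OF X(1)]]
        by (simp add: F_def inner_commute)
      then have s: "norm ?s \<le> F f / d" using d(1) by (simp add: field_simps)
      have "(f - X n) \<bullet> ?s \<le> norm (f - X n) * norm ?s" by (rule norm_cauchy_schwarz)
      also have "\<dots> \<le> (norm f + F f / c) * (F f / d)"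
      proof (intro mult_mono s)
        have b: "norm (X n) \<le> F f / c" by (rule bound[OF X(1,2)])
        then show "norm (f - X n) \<le> norm f + F f / c" using norm_triangle_ineq4[of f "X n"] by linarith
        show "0 \<le> norm f + F f / c" using order_trans[OF norm_ge_zero b] by simp
      qed simp
      finally have "exp (- ((norm f + F f / c) * (F f / d))) \<le> exp (- ((f - X n) \<bullet> ?s))" by simp
      then have "char_fun (X n) * exp (- ((norm f + F f / c) * (F f / d))) \<le> char_fun (X n) * exp (- ((f - X n) \<bullet> ?s))"
        using char_fun_pos[OF X(1)] by (intro mult_left_mono) (auto intro: less_imp_le)
      also have "\<dots> \<le> char_fun f" by (rule char_fun_convexity[OF X(1) f])
      finally show "char_fun (X n) \<le> char_fun f * exp ((norm f + F f / c) * (F f / d))"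
        by (simp add: exp_minus field_simps)
    qed
  qed (rule f)
  then obtain x where x: "x \<in> interior C" "\<And>z. z \<in> interior C \<Longrightarrow> F x \<le> F z" by blast
  obtain g D where g: "cone_aut g" and D: "(dual_point has_derivative D) (at x)"
      and gD: "\<And>v. adjoint g (D (g v)) = - v"
    using dual_point_derivative[OF x(1)] by blast
  have "(F has_derivative (\<lambda>v. f \<bullet> D v + y \<bullet> v)) (at x)"
    unfolding F_def by (auto intro!: derivative_eq_intros D)
  then have "(\<lambda>v. f \<bullet> D v + y \<bullet> v) = (\<lambda>v. 0)"
    using x by (intro differential_zero_maxmin[OF x(1) open_interior]) auto
  from fun_cong[OF this] have crit: "f \<bullet> D v + y \<bullet> v = 0" for v .
  define k where "k = inv g"
  have k: "cone_aut k" unfolding k_def by (rule cone_aut_inv[OF g])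
  have gk: "g (k v) = v" for v
    using cone_autD(2)[OF g] by (simp add: k_def bij_is_surj surj_f_inv_f)
  have "v \<bullet> adjoint k (k f) = v \<bullet> y" for v
  proof -
    have "v \<bullet> adjoint k (k f) = k v \<bullet> k f" by (rule adjoint_works[OF cone_autD(1)[OF k]])
    also have "\<dots> = - (k f \<bullet> adjoint g (D (g (k v))))" by (simp add: gD inner_commute)
    also have "\<dots> = - (f \<bullet> D v)" by (simp add: adjoint_works[OF cone_autD(1)[OF g]] gk)
    also have "\<dots> = v \<bullet> y" using crit[of v] by (simp add: inner_commute)
    finally show ?thesis .
  qed
  then have "adjoint k (k f) = y" using vector_eq_ldot by blast
  then show ?thesis using that k by blast
qed

end

section \<open>Facial exposedness\<close>

lemma zero_if_inner_self_nonpos: "d \<bullet> d \<le> 0 \<Longrightarrow> d = 0" for d :: "'a::real_inner"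
  using inner_gt_zero_iff[of d] by fastforce

text \<open>For symmetric \<open>g\<close> the sequence \<open>n \<mapsto> |g\<^sup>n z|\<^sup>2\<close> is convex, with second difference
  \<open>|g\<^sup>n\<^sup>+\<^sup>2 z - g\<^sup>n z|\<^sup>2\<close>. A bounded convex sequence cannot start with an increase.\<close>

lemma norm_le_of_bounded_iterates:
  fixes g :: "'a::real_inner \<Rightarrow> 'a"
  assumes sym: "\<And>x y. g x \<bullet> y = x \<bullet> g y" and bd: "\<And>n. norm ((g ^^ n) z) \<le> B"
  shows "norm (g z) \<le> norm z"
proof -
  define a where "a n = (g ^^ n) z \<bullet> (g ^^ n) z" for n
  have conv: "a (Suc n) - a n \<le> a (Suc (Suc n)) - a (Suc n)" for n
  proof -
    let ?v = "(g ^^ n) z"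
    have "0 \<le> (g (g ?v) - ?v) \<bullet> (g (g ?v) - ?v)" by simp
    also have "\<dots> = a (Suc (Suc n)) - 2 * a (Suc n) + a n"
      using sym[of "g ?v" ?v] by (simp add: a_def inner_diff_left inner_diff_right inner_commute)
    finally show ?thesis by simp
  qed
  have slope: "a 1 - a 0 \<le> a (Suc n) - a n" for n
  proof (induction n)
    case (Suc n)
    then show ?case using conv[of n] by linarith
  qed simp
  have lin: "a 0 + real n * (a 1 - a 0) \<le> a n" for n
  proof (induction n)
    case (Suc n)
    then show ?case using slope[of n] by (simp add: algebra_simps)
  qed simp
  have ub: "a n \<le> B\<^sup>2" for n
    using power_mono[OF bd[of n] norm_ge_zero, of 2] by (simp add: a_def power2_norm_eq_inner)
  have "a 1 - a 0 \<le> 0"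
  proof (rule ccontr)
    assume "\<not> a 1 - a 0 \<le> 0"
    then obtain n where "B\<^sup>2 < real n * (a 1 - a 0)" using reals_Archimedean3[of "a 1 - a 0"] by auto
    moreover have "0 \<le> a 0" by (simp add: a_def)
    ultimately show False using lin[of n] ub[of n] by linarith
  qed
  then show ?thesis by (simp add: a_def norm_le)
qed

context symmetric_self_dual_cone
begin

text \<open>A face that is not cut out by a supporting hyperplane would provide \<open>z\<close> and \<open>u\<close> violating the
  conclusion. Put \<open>z0 = z + u\<close>, and choose \<open>w0\<close> in the relative interior of the face
  \<open>F = C \<inter> z\<^sup>\<bottom>\<close>, which by hypothesis is also \<open>C \<inter> z0\<^sup>\<bottom>\<close>. Then \<open>z + w0\<close> is an interior point of
  \<open>C\<close>, so \<open>z0 \<preceq> c (z + w0)\<close> for some \<open>c\<close>. A symmetric positive definite automorphism \<open>g\<close> with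
  \<open>g w0 = w0 / 2\<close> that fixes both \<open>z\<close> and \<open>z0\<close> turns this into \<open>z0 \<preceq> c (z + w0 / 2\<^sup>n)\<close> for all \<open>n\<close>,
  hence into \<open>z0 \<preceq> c z\<close>, which is the claim with \<open>\<epsilon> = 1 / c\<close>.\<close>

lemma facially_exposed:
  assumes z: "z \<in> C" and u: "u \<in> C" and zu: "\<And>w. w \<in> C \<Longrightarrow> w \<bullet> z = 0 \<Longrightarrow> w \<bullet> u = 0"
  shows "\<exists>\<epsilon>>0. z - \<epsilon> *\<^sub>R u \<in> C"
proof -
  define F where "F = {w \<in> C. w \<bullet> z = 0}"
  obtain B where B: "B \<subseteq> F" "independent B" "F \<subseteq> span B"
    using maximal_independent_subset by blast
  have finB: "finite B" using B(2) independent_imp_finite by blast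
  \<comment> \<open>A sum over a spanning subset of \<open>F\<close> serves as a relative interior point.\<close>
  define w0 where "w0 = \<Sum>B"
  have "\<Sum>A \<in> C" if "finite A" "A \<subseteq> C" for A
    using that by (induction A rule: finite_induct) (auto intro: add_mem zero_mem)
  then have w0C: "w0 \<in> C" using finB B(1) by (auto simp: w0_def F_def)
  have w0z: "w0 \<bullet> z = 0" unfolding w0_def inner_sum_left using B(1) by (intro sum.neutral) (auto simp: F_def)
  have w0_int: "0 < w \<bullet> w0" if w: "w \<in> C" "w \<bullet> z = 0" "w \<noteq> 0" for w
  proof (rule ccontr)
    assume "\<not> 0 < w \<bullet> w0"
    then have "(\<Sum>b\<in>B. w \<bullet> b) = 0"
      using inner_nonneg[OF w(1) w0C] by (simp add: w0_def inner_sum_right)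
    then have "\<forall>b\<in>B. w \<bullet> b = 0"
      using finB B(1) inner_nonneg[OF w(1)] by (subst (asm) sum_nonneg_eq_0_iff) (auto simp: F_def)
    then have "span B \<subseteq> {v. w \<bullet> v = 0}" by (intro span_minimal subspace_hyperplane) auto
    moreover have "w \<in> span B" using B(3) w by (auto simp: F_def)
    ultimately have "w \<bullet> w = 0" by blast
    then show False using w(3) by simp
  qed
  have zw_int: "z + c *\<^sub>R w0 \<in> interior C" if c: "c > 0" for c
  proof (rule interiorI)
    fix w assume w: "w \<in> C" "w \<noteq> 0"
    show "0 < w \<bullet> (z + c *\<^sub>R w0)"
    proof (cases "w \<bullet> z = 0")
      case True
      then show ?thesis using w0_int[OF w(1) True w(2)] c by (simp add: inner_add_right)
    next
      case False
      then have "0 < w \<bullet> z" using inner_nonneg[OF w(1) z] by simp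
      then show ?thesis using inner_nonneg[OF w(1) w0C] c
        by (simp add: inner_add_right add_pos_nonneg)
    qed
  qed
  define z0 where "z0 = z + u"
  have z0C: "z0 \<in> C" unfolding z0_def by (rule add_mem[OF z u])
  have zz0: "z \<preceq> z0" unfolding z0_def by (rule cle_add_right[OF u])
  \<comment> \<open>Orthogonality of \<open>w0\<close> and \<open>z0\<close> is where the hypothesis on \<open>u\<close> enters.\<close>
  have w0z0: "w0 \<bullet> z0 = 0" using w0z zu[OF w0C w0z] by (simp add: z0_def inner_add_right)
  then have z0w0: "z0 \<bullet> w0 = 0" by (simp add: inner_commute)
  have int: "z0 + c *\<^sub>R w0 \<in> interior C" if "c > 0" for c
    using interior_add[OF zw_int[OF that] u] by (simp add: z0_def add_ac)
  obtain k where k: "cone_aut k" "adjoint k (k (z0 + 1 *\<^sub>R w0)) = z0 + (1/2) *\<^sub>R w0"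
    using scaling_point[OF int[of 1] int[of "1/2"]] by auto
  define h where "h = inv k"
  define g where "g v = adjoint k (k v)" for v
  define gi where "gi v = h (adjoint h v)" for v
  have h: "cone_aut h" unfolding h_def by (rule cone_aut_inv[OF k(1)])
  note ak = cone_aut_adjoint[OF k(1)] and ah = cone_aut_adjoint[OF h]
  note lk = cone_autD(1)[OF k(1)] and lh = cone_autD(1)[OF h]
  have hk: "h (k v) = v" "k (h v) = v" for v
    using cone_autD(2)[OF k(1)] by (auto simp: h_def bij_is_inj bij_is_surj surj_f_inv_f)
  have ahk: "adjoint h (adjoint k v) = v" "adjoint k (adjoint h v) = v" for v
  proof -
    have "x \<bullet> adjoint h (adjoint k v) = x \<bullet> v" "x \<bullet> adjoint k (adjoint h v) = x \<bullet> v" for x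
      by (simp_all add: adjoint_works lk lh hk)
    then show "adjoint h (adjoint k v) = v" "adjoint k (adjoint h v) = v"
      using vector_eq_ldot by blast+
  qed
  have ggi: "g (gi v) = v" "gi (g v) = v" for v by (simp_all add: g_def gi_def hk ahk)
  have g_inner: "g x \<bullet> y = k x \<bullet> k y" for x y
    unfolding g_def using adjoint_works[OF lk, of y "k x"] by (simp add: inner_commute)
  have gi_inner: "gi x \<bullet> y = adjoint h x \<bullet> adjoint h y" for x y
    unfolding gi_def using adjoint_works[OF lh, of "adjoint h x" y] by (simp add: inner_commute)
  have gsym: "g x \<bullet> y = x \<bullet> g y" for x y
    using g_inner[of x y] g_inner[of y x] by (simp add: inner_commute)
  have gisym: "gi x \<bullet> y = x \<bullet> gi y" for x y
    using gi_inner[of x y] gi_inner[of y x] by (simp add: inner_commute)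
  have lin: "linear g" "linear gi"
    unfolding g_def[abs_def] gi_def[abs_def]
    using linear_compose[OF lk adjoint_linear[OF lk]] linear_compose[OF adjoint_linear[OF lh] lh]
    by (simp_all add: o_def)
  have gC: "g v \<in> C" "gi v \<in> C" if "v \<in> C" for v
    using that cone_autD(3)[OF k(1)] cone_autD(3)[OF ak] cone_autD(3)[OF h] cone_autD(3)[OF ah]
    by (simp_all add: g_def gi_def)
  have g_mono: "g x \<preceq> g y" "gi x \<preceq> gi y" if "x \<preceq> y" for x y
    using that gC[of "y - x"] by (simp_all add: cone_le_def linear_diff[OF lin(1)] linear_diff[OF lin(2)])
  \<comment> \<open>Pairing \<open>g (z0 + w0) = z0 + w0 / 2\<close> and its inverse with \<open>w0\<close> bounds the quadratic forms of \<open>g\<close>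
    and of its inverse at \<open>w0\<close>. These bounds are the equality case of the Cauchy-Schwarz inequality,
    so they force \<open>w0\<close> to be an eigenvector.\<close>
  define N where "N = w0 \<bullet> w0"
  have sum: "g z0 + g w0 = z0 + (1/2) *\<^sub>R w0"
    using k(2) by (simp add: g_def[symmetric] linear_add[OF lin(1)])
  have "g z0 \<bullet> w0 + g w0 \<bullet> w0 = N / 2"
    using arg_cong[OF sum, of "\<lambda>v. v \<bullet> w0"] z0w0
    by (simp only: inner_add_left inner_scaleR_left N_def)
  then have 1: "g w0 \<bullet> w0 \<le> N / 2" using inner_nonneg[OF gC(1)[OF z0C] w0C] by simp
  have "gi (z0 + (1/2) *\<^sub>R w0) = z0 + w0"
    using arg_cong[OF sum, of gi] ggi(2)[of "z0 + w0"] by (simp add: linear_add[OF lin(1)])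
  then have sumi: "gi z0 + (1/2) *\<^sub>R gi w0 = z0 + w0"
    by (simp add: linear_add[OF lin(2)] linear_scale[OF lin(2)])
  have "gi z0 \<bullet> w0 + (1/2) * (gi w0 \<bullet> w0) = N"
    using arg_cong[OF sumi, of "\<lambda>v. v \<bullet> w0"] z0w0
    by (simp only: inner_add_left inner_scaleR_left N_def)
  then have 2: "(1/2) * (gi w0 \<bullet> w0) \<le> N" using inner_nonneg[OF gC(2)[OF z0C] w0C] by simp
  define v where "v = w0 - (1/2) *\<^sub>R gi w0"
  have gv: "g v = g w0 - (1/2) *\<^sub>R w0"
    by (simp add: v_def linear_diff[OF lin(1)] linear_scale[OF lin(1)] ggi)
  have "g w0 \<bullet> gi w0 = N" using gsym[of w0 "gi w0"] ggi by (simp add: N_def)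
  then have "g v \<bullet> v = g w0 \<bullet> w0 - N + (1/4) * (gi w0 \<bullet> w0)"
    unfolding gv unfolding v_def
    by (simp add: inner_diff_left inner_diff_right N_def inner_commute[of "gi w0" w0] field_simps)
  then have "k v \<bullet> k v \<le> 0" using 1 2 by (simp add: g_inner)
  then have "k v = 0" by (rule zero_if_inner_self_nonpos)
  then have "v = 0" using hk(1)[of v] linear_0[OF lh] by simp
  then have gw0: "g w0 = (1/2) *\<^sub>R w0" using gv linear_0[OF lin(1)] by simp
  then have gz0: "g z0 = z0" using sum by simp
  then have giz0: "gi z0 = z0" using ggi(2)[of z0] by simp
  \<comment> \<open>All powers of \<open>g\<close>, positive and negative, keep \<open>z\<close> in the order interval below \<open>z0\<close>; for a
    symmetric positive definite map this is only possible if \<open>z\<close> is fixed.\<close>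
  have it: "(g ^^ n) z \<in> C \<and> (g ^^ n) z \<preceq> z0" "(gi ^^ n) z \<in> C \<and> (gi ^^ n) z \<preceq> z0" for n
  proof (induction n)
    case (Suc n)
    show "(g ^^ Suc n) z \<in> C \<and> (g ^^ Suc n) z \<preceq> z0"
      using Suc(1) g_mono(1)[of "(g ^^ n) z" z0] gC gz0 by simp
    show "(gi ^^ Suc n) z \<in> C \<and> (gi ^^ Suc n) z \<preceq> z0"
      using Suc(2) g_mono(2)[of "(gi ^^ n) z" z0] gC giz0 by simp
  qed (use z zz0 in simp_all)
  have n1: "norm (g z) \<le> norm z"
    by (rule norm_le_of_bounded_iterates[OF gsym, where B = "norm z0"]) (use it(1) norm_mono in blast)
  have n2: "norm (gi z) \<le> norm z"
    by (rule norm_le_of_bounded_iterates[OF gisym, where B = "norm z0"]) (use it(2) norm_mono in blast)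
  have "(g z - gi z) \<bullet> (g z - gi z) = g z \<bullet> g z - 2 * (z \<bullet> z) + gi z \<bullet> gi z"
    using gsym[of z "gi z"] ggi by (simp add: inner_diff_left inner_diff_right inner_commute)
  also have "\<dots> \<le> 0" using n1 n2 by (simp add: norm_le)
  finally have "g z - gi z = 0" by (rule zero_if_inner_self_nonpos)
  then have "g z = gi z" by simp
  then have ggz: "g (g z) = z" using ggi by simp
  define d where "d = g z - z"
  have "g d = - d" by (simp add: d_def linear_diff[OF lin(1)] ggz)
  then have "k d \<bullet> k d = - (d \<bullet> d)" using g_inner[of d d] by simp
  then have "d \<bullet> d \<le> 0" using inner_ge_zero[of "k d"] by linarith
  then have "d = 0" by (rule zero_if_inner_self_nonpos)
  then have gz: "g z = z" by (simp add: d_def)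
  obtain c where c: "c > 0" "z0 \<preceq> c *\<^sub>R (z + 1 *\<^sub>R w0)"
    using interior_dominates[OF zw_int[of 1]] by auto
  have le: "z0 \<preceq> c *\<^sub>R (z + ((1/2) ^ n) *\<^sub>R w0)" for n
  proof (induction n)
    case 0
    then show ?case using c(2) by simp
  next
    case (Suc n)
    show ?case
      using g_mono(1)[OF Suc] by (simp add: gz0 gz gw0 linear_add[OF lin(1)] linear_scale[OF lin(1)] mult.commute)
  qed
  have "z0 \<preceq> c *\<^sub>R (z + 0 *\<^sub>R w0)"
  proof (rule cle_lim[OF tendsto_const])
    show "(\<lambda>n. c *\<^sub>R (z + ((1/2) ^ n) *\<^sub>R w0)) \<longlonglongrightarrow> c *\<^sub>R (z + 0 *\<^sub>R w0)"
      by (intro tendsto_intros LIMSEQ_power_zero) simp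
  qed (use le in auto)
  then have "c *\<^sub>R z - z0 \<in> C" by (simp add: cone_le_def)
  from add_mem[OF this z] have "c *\<^sub>R z - u \<in> C" by (simp add: z0_def)
  then have "(1 / c) *\<^sub>R (c *\<^sub>R z - u) \<in> C" using c(1) by (intro scale_mem) auto
  then have "z - (1 / c) *\<^sub>R u \<in> C" using c(1) by (simp add: scaleR_diff_right)
  then show ?thesis using c(1) by (intro exI[of _ "1 / c"]) simp
qed

text \<open>Let \<open>l\<close> be greatest with \<open>l u \<preceq> v\<close>, and \<open>z = v - l u\<close>. Maximality of \<open>l\<close> and facial exposedness
  produce a vector of \<open>C\<close> orthogonal to \<open>z\<close> but not to \<open>u\<close>, hence an extreme one; on that ray the
  ratio equals \<open>l\<close>.\<close>

lemma ratio_minimum_attained: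
  assumes v: "v \<in> C" and u: "u \<in> C" "u \<noteq> 0"
  shows "\<exists>w\<in>Extr C. w \<bullet> u > 0 \<and> (w \<bullet> v / (w \<bullet> u)) *\<^sub>R u \<preceq> v"
proof -
  define S where "S = {l. l *\<^sub>R u \<preceq> v}"
  have 0: "0 \<in> S" using v by (simp add: S_def cle_zero_iff)
  have bdd: "bdd_above S"
  proof (rule bdd_aboveI)
    fix l assume "l \<in> S"
    then have "l * (u \<bullet> u) \<le> u \<bullet> v" using u(1) by (auto simp: S_def cle_iff_inner)
    then show "l \<le> (u \<bullet> v) / (u \<bullet> u)" using u(2) by (simp add: field_simps)
  qed
  have "closed S"
  proof -
    have "S = (\<lambda>l. v - l *\<^sub>R u) -` C" by (auto simp: S_def cone_le_def)
    then show ?thesis using closed_cone by (auto intro!: closed_vimage continuous_intros)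
  qed
  then have "Sup S \<in> S" using closed_contains_Sup 0 bdd by blast
  define l where "l = Sup S"
  define z where "z = v - l *\<^sub>R u"
  have z: "z \<in> C" using \<open>Sup S \<in> S\<close> by (simp add: z_def l_def S_def cone_le_def)
  have "\<not> (\<forall>w. w \<in> C \<longrightarrow> w \<bullet> z = 0 \<longrightarrow> w \<bullet> u = 0)"
  proof
    assume "\<forall>w. w \<in> C \<longrightarrow> w \<bullet> z = 0 \<longrightarrow> w \<bullet> u = 0"
    then obtain d where d: "d > 0" "z - d *\<^sub>R u \<in> C" using facially_exposed[OF z u(1)] by blast
    then have "l + d \<in> S" by (simp add: S_def cone_le_def z_def algebra_simps)
    then have "l + d \<le> l" unfolding l_def using cSup_upper[OF _ bdd] by blast
    then show False using d(1) by simp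
  qed
  then obtain w' where w': "w' \<in> C" "w' \<bullet> z = 0" "w' \<bullet> u \<noteq> 0" by blast
  then have w'0: "w' \<noteq> 0" by auto
  obtain e where e: "e \<in> interior C" using interior_nonempty by blast
  obtain w where w: "w \<in> Extr C" "w \<in> C" "w \<bullet> z = 0" "w' \<bullet> u \<le> (w \<bullet> u) * (w' \<bullet> e)"
    using maximizer_on_extreme_ray[OF e z w'(1) w'0 w'(2), of u] w' by metis
  have "0 < w' \<bullet> u" using w'(3) inner_nonneg[OF w'(1) u(1)] by simp
  then have "w \<bullet> u \<noteq> 0" using w(4) by auto
  then have wu: "0 < w \<bullet> u" using inner_nonneg[OF w(2) u(1)] by simp
  then have "w \<bullet> v / (w \<bullet> u) = l" using w(3) by (simp add: z_def inner_diff_right field_simps)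
  moreover have "l *\<^sub>R u \<preceq> v" using z by (simp add: z_def cone_le_def)
  ultimately show ?thesis using w(1) wu by (intro bexI[of _ w]) simp_all
qed

end

section \<open>The two characterisations\<close>

lemma elog_mono: "a \<le> b \<Longrightarrow> elog a \<le> elog b"
  by (auto simp: elog_def)

lemma (in subhomogeneous_map) log_ratio_maximum:
  assumes y: "y \<in> interior C"
  shows "\<exists>l>0. T y \<preceq> l *\<^sub>R y \<and> (\<forall>m. T y \<preceq> m *\<^sub>R y \<longrightarrow> l \<le> m) \<and>
    is_max {log_ratio w (T y) y |w. w \<in> Extr C} (ereal (ln l))"
proof -
  obtain w where w: "w \<in> Extr C" and max: "\<And>w'. w' \<in> Extr C \<Longrightarrow> w' \<bullet> T y / (w' \<bullet> y) \<le> w \<bullet> T y / (w \<bullet> y)"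
    and le: "T y \<preceq> (w \<bullet> T y / (w \<bullet> y)) *\<^sub>R y"
    using ratio_maximum_attained[OF y, of "T y"] by blast
  define l where "l = w \<bullet> T y / (w \<bullet> y)"
  have wC: "w \<in> C" "w \<noteq> 0" using Extr_subset[OF w] by simp_all
  have wy: "0 < w \<bullet> y" by (rule interior_inner_pos[OF y wC])
  have l: "0 < l"
    unfolding l_def using wy interior_inner_pos[OF maps_interior[OF y] wC] by simp
  have least: "l \<le> m" if "T y \<preceq> m *\<^sub>R y" for m
  proof -
    have "w \<bullet> T y \<le> m * (w \<bullet> y)" using that wC(1) by (auto simp: cle_iff_inner)
    then show ?thesis using wy by (simp add: l_def field_simps)
  qed
  have "is_max {log_ratio w (T y) y |w. w \<in> Extr C} (elog l)"
    unfolding is_max_def log_ratio_def using w max by (auto simp: l_def intro!: elog_mono)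
  then have "is_max {log_ratio w (T y) y |w. w \<in> Extr C} (ereal (ln l))" using l by (simp add: elog_def)
  moreover have "T y \<preceq> l *\<^sub>R y" using le by (simp add: l_def)
  ultimately show ?thesis using l least by blast
qed

lemma (in symmetric_self_dual_cone) log_ratio_minimum:
  assumes v: "v \<in> C" and u: "u \<in> C" "u \<noteq> 0"
  shows "\<exists>l\<ge>0. l *\<^sub>R u \<preceq> v \<and> (\<forall>m. m *\<^sub>R u \<preceq> v \<longrightarrow> m \<le> l) \<and>
    is_min {log_ratio w v u |w. w \<in> Extr C \<and> w \<bullet> u \<noteq> 0} (elog l)"
proof -
  obtain w where w: "w \<in> Extr C" "w \<bullet> u > 0" "(w \<bullet> v / (w \<bullet> u)) *\<^sub>R u \<preceq> v"
    using ratio_minimum_attained[OF v u] by blast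
  define l where "l = w \<bullet> v / (w \<bullet> u)"
  have bound: "m \<le> w' \<bullet> v / (w' \<bullet> u)" if "w' \<in> C" "w' \<bullet> u \<noteq> 0" "m *\<^sub>R u \<preceq> v" for w' m
  proof -
    have "0 < w' \<bullet> u" using inner_nonneg[OF that(1) u(1)] that(2) by simp
    moreover have "m * (w' \<bullet> u) \<le> w' \<bullet> v" using that(1,3) by (auto simp: cle_iff_inner)
    ultimately show ?thesis by (simp add: field_simps)
  qed
  have wC: "w \<in> C" using Extr_subset[OF w(1)] by simp
  have "0 \<le> l" unfolding l_def using w(2) inner_nonneg[OF wC v] by simp
  moreover have "m \<le> l" if "m *\<^sub>R u \<preceq> v" for m
    using bound[OF wC _ that] w(2) by (simp add: l_def)
  moreover have "is_min {log_ratio w v u |w. w \<in> Extr C \<and> w \<bullet> u \<noteq> 0} (elog l)"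
    unfolding is_min_def
  proof (intro conjI ballI)
    show "elog l \<in> {log_ratio w v u |w. w \<in> Extr C \<and> w \<bullet> u \<noteq> 0}"
      using w(1,2) unfolding l_def log_ratio_def by (intro CollectI exI[of _ w]) auto
    fix s assume "s \<in> {log_ratio w v u |w. w \<in> Extr C \<and> w \<bullet> u \<noteq> 0}"
    then obtain w' where w': "s = log_ratio w' v u" "w' \<in> Extr C" "w' \<bullet> u \<noteq> 0" by blast
    have "l \<le> w' \<bullet> v / (w' \<bullet> u)"
      using bound[OF _ w'(3) w(3)] Extr_subset[OF w'(2)] by (simp add: l_def)
    then show "elog l \<le> s" unfolding w'(1) log_ratio_def by (rule elog_mono)
  qed
  moreover have "l *\<^sub>R u \<preceq> v" using w(3) by (simp add: l_def)
  ultimately show ?thesis by blast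
qed

theorem corollary37:
  fixes C :: "'a::euclidean_space set" and T :: "'a \<Rightarrow> 'a" and x :: 'a
  assumes "symmetric_cone C"
    and "T ` interior C \<subseteq> interior C"
    and "order_preserving C T"
    and "sub_homogeneous C T"
    and "x \<in> interior C"
    and "(convergent (escape_seq C T x) \<and> escape_rate C T x > 0) \<or> pos_homogeneous C T"
  shows "convergent (escape_seq C T x) \<and>
    (\<exists>F G :: 'a \<Rightarrow> ereal.
       (\<forall>y\<in>interior C. is_max {log_ratio w (T y) y | w. w \<in> Extr C} (F y)) \<and>
       (INF y\<in>interior C. F y) = ereal (escape_rate C T x) \<and>
       (\<forall>u\<in>C - {0}. is_min {log_ratio w (recession_map C T u) u | w. w \<in> Extr C \<and> w \<bullet> u \<noteq> 0} (G u)) \<and>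
       is_max (G ` (C - {0})) (ereal (escape_rate C T x)))"
proof -
  interpret symmetric_self_dual_cone C
    using assms(1) by unfold_locales (simp_all add: symmetric_cone_def)
  interpret subhomogeneous_map C T
    using assms(2-4) by unfold_locales (auto simp: order_preserving_def sub_homogeneous_def)
  define \<rho> where "\<rho> = escape_rate C T x"
  note rate = escape_rate_eq[OF assms(5,6), folded \<rho>_def]
  have "\<forall>y\<in>interior C. \<exists>l>0. T y \<preceq> l *\<^sub>R y \<and> (\<forall>m. T y \<preceq> m *\<^sub>R y \<longrightarrow> l \<le> m) \<and>
      is_max {log_ratio w (T y) y |w. w \<in> Extr C} (ereal (ln l))"
    using log_ratio_maximum by blast
  from bchoice[OF this] obtain f where f: "\<And>y. y \<in> interior C \<Longrightarrow> 0 < f y"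
      "\<And>y. y \<in> interior C \<Longrightarrow> T y \<preceq> f y *\<^sub>R y"
      "\<And>y m. y \<in> interior C \<Longrightarrow> T y \<preceq> m *\<^sub>R y \<Longrightarrow> f y \<le> m"
      "\<And>y. y \<in> interior C \<Longrightarrow> is_max {log_ratio w (T y) y |w. w \<in> Extr C} (ereal (ln (f y)))"
    by blast
  have "\<forall>u\<in>C - {0}. \<exists>l\<ge>0. l *\<^sub>R u \<preceq> recession_map C T u \<and> (\<forall>m. m *\<^sub>R u \<preceq> recession_map C T u \<longrightarrow> m \<le> l) \<and>
      is_min {log_ratio w (recession_map C T u) u |w. w \<in> Extr C \<and> w \<bullet> u \<noteq> 0} (elog l)"
    using log_ratio_minimum recession_map_limit(1) by blast
  from bchoice[OF this] obtain g where g: "\<And>u. u \<in> C - {0} \<Longrightarrow> 0 \<le> g u"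
      "\<And>u. u \<in> C - {0} \<Longrightarrow> g u *\<^sub>R u \<preceq> recession_map C T u"
      "\<And>u m. u \<in> C - {0} \<Longrightarrow> m *\<^sub>R u \<preceq> recession_map C T u \<Longrightarrow> m \<le> g u"
      "\<And>u. u \<in> C - {0} \<Longrightarrow>
        is_min {log_ratio w (recession_map C T u) u |w. w \<in> Extr C \<and> w \<bullet> u \<noteq> 0} (elog (g u))"
    by blast
  have "(INF y\<in>interior C. ereal (ln (f y))) = ereal \<rho>"
  proof (rule antisym)
    show "(INF y\<in>interior C. ereal (ln (f y))) \<le> ereal \<rho>"
    proof (rule ereal_le_epsilon2)
      fix e :: real assume e: "0 < e"
      obtain y l where y: "y \<in> interior C" "0 < l" "T y \<preceq> l *\<^sub>R y" "ln l < \<rho> + e"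
        using rate(3)[of "\<rho> + e"] e by auto
      have "(INF y\<in>interior C. ereal (ln (f y))) \<le> ereal (ln (f y))" by (rule INF_lower[OF y(1)])
      also have "\<dots> \<le> ereal (ln l)" using f(3)[OF y(1,3)] f(1)[OF y(1)] by (simp add: ln_mono)
      also have "\<dots> \<le> ereal \<rho> + ereal e" using y(4) by simp
      finally show "(INF y\<in>interior C. ereal (ln (f y))) \<le> ereal \<rho> + ereal e" .
    qed
    show "ereal \<rho> \<le> (INF y\<in>interior C. ereal (ln (f y)))"
      using rate(2) f(1,2) by (intro INF_greatest) simp
  qed
  moreover have "is_max ((\<lambda>u. elog (g u)) ` (C - {0})) (ereal \<rho>)"
  proof -
    have le: "elog (g u) \<le> ereal \<rho>" if u: "u \<in> C - {0}" for u
    proof (cases "g u = 0")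
      case False
      then have "0 < g u" using g(1)[OF u] by simp
      then have "ln (g u) \<le> \<rho>" using rate(4)[of u "g u"] u g(2)[OF u] by simp
      then show ?thesis using \<open>0 < g u\<close> by (simp add: elog_def)
    qed (simp add: elog_def)
    obtain u where u: "u \<in> C - {0}" "exp \<rho> *\<^sub>R u \<preceq> recession_map C T u"
      using rate(5) by blast
    have "elog (exp \<rho>) \<le> elog (g u)" using g(3)[OF u] by (rule elog_mono)
    then have "elog (g u) = ereal \<rho>" using le[OF u(1)] by (simp add: elog_def antisym)
    then show ?thesis unfolding is_max_def using le u(1) by (auto intro: image_eqI[of _ _ u])
  qed
  ultimately show ?thesis
    unfolding \<rho>_def[symmetric] using rate(1) f(4) g(4)
    by (intro conjI exI[of _ "\<lambda>y. ereal (ln (f y))"] exI[of _ "\<lambda>u. elog (g u)"]) auto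
qed

end
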